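(* Let $n\ge 2$, $0<s<1$, and let $\Omega\subset\mathbb{R}^n$ be a bounded domain with $C^{1,1}$ boundary. Let $A\in L^\infty(\mathbb{R}^n;\mathbb{R}^n)$ be a real vector-valued magnetic potential and suppose $\Omega\cup\mathrm{supp}\,A\subset B_r(0)$ for some constant $r>0$ and $\|A\|_{L^\infty(\mathbb{R}^n)}\le \pi/(8\sqrt{n}\,r)$. For $j=1,2$, let $a^{(j)}:\Omega\times\mathbb{R}\to\mathbb{R}$ satisfy: (i) $z\mapsto a^{(j)}(\cdot,z)$ is analytic with values in $C^s(\Omega)$; (ii) $a^{(j)}(x,0)=0$ and $\partial_z a^{(j)}(x,0)\ge c>0$ for all $x\in\Omega$, for some constant $c>0$. Let $W_1,W_2\subset\mathbb{R}^n$ be nonempty open sets with $W_j\cap B_{3r}(0)=\emptyset$ ($j=1,2$). Suppose there is $\rho_0>0$ such that $$\Lambda_{A,a^{(1)}}g|_{W_2}=\Lambda_{A,a^{(2)}}g|_{W_2}\quad\text{for all } g\in C^\infty_c(W_1)\text{ with }\|g\|_{C^2(\mathbb{R}^n)}\le\rho_0$$ (with $\rho_0$ small enough that both Dirichlet-to-Neumann maps $\Lambda_{A,a^{(j)}}$ are defined for such $g$). Then $a^{(1)}=a^{(2)}$ in $\Omega\times\mathbb{R}$.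
   Context: All function spaces are real-valued. $B_r(0)$ is the open ball of radius $r$ centered at $0$, and $\Omega_e:=\mathbb{R}^n\setminus\bar\Omega$. For $A=(A_1,\dots,A_n)$, $\|A\|_{L^\infty(\mathbb{R}^n)}=\max_j\|A_j\|_{L^\infty(\mathbb{R}^n)}$. $\|f\|_{C^2(\mathbb{R}^n)}=\sum_{|\alpha|\le2}\|\partial^\alpha f\|_{L^\infty(\mathbb{R}^n)}$. For an open set $U$, $C^s(U)=C^{0,s}(U)$ is the Hölder space with norm $\|f\|_{L^\infty(U)}+\sup_{x\ne y\in U}|f(x)-f(y)|/|x-y|^s$. $H^t(\mathbb{R}^n)$ is the $L^2$-based Sobolev space, $H^{-s}(\mathbb{R}^n)=H^s(\mathbb{R}^n)^*$ with pairing $\langle\cdot,\cdot\rangle$, and $\tilde H^s(\Omega)$ is the closure of $C_c^\infty(\Omega)$ in $H^s(\mathbb{R}^n)$. Operator. Let $K(x,y)=c_{n,s}/|x-y|^{n+2s}$, where $c_{n,s}>0$ is the normalization constant for which the operator below equals the fractional Laplacian $(-\Delta)^s$ when $A=0$. Let $R_A(x,y)=\cos\big((x-y)\cdot A(\tfrac{x+y}{2})\big)$. The bounded operator $\mathcal{R}^s_A:H^s(\mathbb{R}^n)\to H^{-s}(\mathbb{R}^n)$ is defined by $$\langle\mathcal{R}^s_Au,v\rangle=\mathrm{Re}\int_{\mathbb{R}^n}\int_{\mathbb{R}^n}\big(u(x)-e^{i(x-y)\cdot A(\frac{x+y}{2})}u(y)\big)\big(v(x)-e^{-i(x-y)\cdot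 A(\frac{x+y}{2})}v(y)\big)K(x,y)\,dx\,dy .$$ Formally, $\mathcal{R}^s_Au(x)=2\lim_{\epsilon\to0^+}\int_{\mathbb{R}^n\setminus B_\epsilon(x)}(u(x)-R_A(x,y)u(y))K(x,y)\,dy$. Nonlinearity. Analyticity in (i) means that, writing $a_k(x)=\partial_z^ka(x,0)\in C^s(\Omega)$, the Taylor expansion $a(x,z)=\sum_{k=1}^\infty a_k(x)z^k/k!$ holds for all $z$, with convergence in $C^s(\Omega)$ (the zeroth coefficient vanishes by (ii)); $a$ is extended to complex $z$ by the same series. Linear solution operator. For $q\in L^\infty(\Omega)$ with $q\ge c>0$ and $g\in H^s(\mathbb{R}^n)$, $P_{A,q}g$ denotes the unique $u\in H^s(\mathbb{R}^n)$ with $u-g\in\tilde H^s(\Omega)$ and $\langle\mathcal{R}^s_Au,v\rangle+\int_\Omega quv=0$ for all $v\in\tilde H^s(\Omega)$. Nonlinear solution operator and Dirichlet-to-Neumann map. Let $W\subset\mathbb{R}^n$ be open with $W\cap B_{3r}(0)=\emptyset$. For all sufficiently small $\rho>0$ and every $g\in C^\infty_c(W)$ with $\|g\|_{C^2(\mathbb{R}^n)}\le\rho$, the problem $\mathcal{R}^s_Au+a(x,u)=0$ in $\Omega$, $u=g$ in $\Omega_e$ (in the weak sense: $u-g\in\tilde H^s(\Omega)$ and $\langle\mathcal{R}^s_Au,v\rangle+\int_\Omega a(x,u)v\,dx=0$ for all $v\in\tilde H^s(\Omega)$) has a unique solution $u\in H^s(\mathbb{R}^n)\cap C^s(\mathbb{R}^n)$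 with $u-P_{A,a_1}g\in\{v\in C^s(\mathbb{R}^n):v|_{\Omega_e}=0,\ \|v\|_{C^s(\mathbb{R}^n)}\le\rho\}$. This solution is denoted $Q_{A,a}(g)$. The Dirichlet-to-Neumann map is $\Lambda_{A,a}g:=\mathcal{R}^s_A(Q_{A,a}(g))|_{\Omega_e}$ (restriction of an element of $H^{-s}(\mathbb{R}^n)$, as a distribution). *)

theory Defs
  imports "HOL-Analysis.Analysis" "HOL-Probability.Essential_Supremum"
begin

section \<open>Norms and function spaces\<close>

definition linf_norm :: "('a::euclidean_space) set \<Rightarrow> ('a \<Rightarrow> real) \<Rightarrow> ereal" where
  "linf_norm U f = esssup (lebesgue_on U) (\<lambda>x. ereal \<bar>f x\<bar>)"

definition Linf_vec :: "(real^'n \<Rightarrow> real^'n) set" where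
  "Linf_vec = {A. A \<in> borel_measurable lebesgue \<and> (\<forall>j. linf_norm UNIV (\<lambda>x. A x $ j) < \<infinity>)}"

definition linf_norm_vec :: "(real^'n \<Rightarrow> real^'n) \<Rightarrow> ereal" where
  "linf_norm_vec A = Max (range (\<lambda>j. linf_norm UNIV (\<lambda>x. A x $ j)))"

text \<open>Support of a function that is only defined up to null sets: the complement of the largest
  open set on which it vanishes almost everywhere.\<close>
definition ess_support :: "('a::euclidean_space \<Rightarrow> 'b::zero) \<Rightarrow> 'a set" where
  "ess_support f = - \<Union>{U. open U \<and> (AE x in lebesgue. x \<in> U \<longrightarrow> f x = 0)}"

definition holder_norm :: "real \<Rightarrow> ('a::euclidean_space) set \<Rightarrow> ('a \<Rightarrow> real) \<Rightarrow> ereal" where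
  "holder_norm s U f = linf_norm U f +
     (SUP (x, y) \<in> {(x, y). x \<in> U \<and> y \<in> U \<and> x \<noteq> y}. ereal (\<bar>f x - f y\<bar> / norm (x - y) powr s))"

definition holder_space :: "real \<Rightarrow> ('a::euclidean_space) set \<Rightarrow> ('a \<Rightarrow> real) set" where
  "holder_space s U = {f. holder_norm s U f < \<infinity>}"

definition partial_deriv :: "'n \<Rightarrow> (real^'n \<Rightarrow> real) \<Rightarrow> real^'n \<Rightarrow> real" where
  "partial_deriv j f x = deriv (\<lambda>t. f (x + t *\<^sub>R axis j 1)) 0"

fun iter_partial :: "'n list \<Rightarrow> (real^'n \<Rightarrow> real) \<Rightarrow> real^'n \<Rightarrow> real" where
  "iter_partial [] f = f"
| "iter_partial (j # js) f = partial_deriv j (iter_partial js f)"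

text \<open>All iterated partial derivatives being (totally) differentiable everywhere is the same as all
  of them existing and being continuous.\<close>
definition smooth_fun :: "(real^'n \<Rightarrow> real) \<Rightarrow> bool" where
  "smooth_fun f \<longleftrightarrow> (\<forall>js x. iter_partial js f differentiable (at x))"

text \<open>A multi-index is a function from the coordinate indices to \<open>nat\<close>. The index type carries no
  order; as the partial derivatives of a smooth function commute, any order of differentiation
  may be selected.\<close>
definition multi_partial :: "('n \<Rightarrow> nat) \<Rightarrow> (real^'n \<Rightarrow> real) \<Rightarrow> real^'n \<Rightarrow> real" where
  "multi_partial \<alpha> f = iter_partial (SOME js. \<forall>j. count_list js j = \<alpha> j) f"

definition multi_indices :: "nat \<Rightarrow> ('n::finite \<Rightarrow> nat) set" where
  "multi_indices k = {\<alpha>. (\<Sum>j\<in>UNIV. \<alpha> j) \<le> k}"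

lemma finite_multi_indices: "finite (multi_indices k :: ('n::finite \<Rightarrow> nat) set)"
proof (rule finite_subset)
  show "multi_indices k \<subseteq> (UNIV :: 'n set) \<rightarrow>\<^sub>E {..k}"
  proof
    fix \<alpha> :: "'n \<Rightarrow> nat" assume "\<alpha> \<in> multi_indices k"
    then have "\<alpha> j \<le> k" for j
      using member_le_sum[of j UNIV \<alpha>] by (auto simp: multi_indices_def)
    then show "\<alpha> \<in> UNIV \<rightarrow>\<^sub>E {..k}" by auto
  qed
qed (auto intro: finite_PiE)

definition c2_norm :: "(real^'n \<Rightarrow> real) \<Rightarrow> ereal" where
  "c2_norm f = (\<Sum>\<alpha>\<in>multi_indices 2. linf_norm UNIV (multi_partial \<alpha> f))"

definition test_functions :: "(real^'n) set \<Rightarrow> (real^'n \<Rightarrow> real) set" where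
  "test_functions U = {f. smooth_fun f \<and> compact (closure {x. f x \<noteq> 0}) \<and> closure {x. f x \<noteq> 0} \<subseteq> U}"

text \<open>For \<open>0 < s < 1\<close>, the \<open>L\<^sup>2\<close>-based Sobolev space \<open>H\<^sup>s\<close> in its Gagliardo form. Its elements are
  represented by Lebesgue measurable functions, two of which stand for the same element iff they
  agree almost everywhere.\<close>
definition Hs :: "real \<Rightarrow> (real^'n \<Rightarrow> real) set" where
  "Hs s = {u. u \<in> borel_measurable lebesgue \<and> integrable lebesgue (\<lambda>x. (u x)\<^sup>2) \<and>
     integrable lebesgue (\<lambda>(x, y). (u x - u y)\<^sup>2 / norm (x - y) powr (real CARD('n) + 2 * s))}"

definition Hs_norm :: "real \<Rightarrow> (real^'n \<Rightarrow> real) \<Rightarrow> real" where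
  "Hs_norm s u = sqrt ((\<integral>x. (u x)\<^sup>2 \<partial>lebesgue) +
     (\<integral>(x, y). (u x - u y)\<^sup>2 / norm (x - y) powr (real CARD('n) + 2 * s) \<partial>lebesgue))"

definition Hs_tilde :: "real \<Rightarrow> (real^'n) set \<Rightarrow> (real^'n \<Rightarrow> real) set" where
  "Hs_tilde s \<Omega> = {u \<in> Hs s. \<forall>\<epsilon>>0. \<exists>\<phi>\<in>test_functions \<Omega>. Hs_norm s (\<lambda>x. u x - \<phi> x) < \<epsilon>}"

section \<open>Domains\<close>

definition C11_fun :: "(real^'n \<Rightarrow> real) \<Rightarrow> bool" where
  "C11_fun \<gamma> \<longleftrightarrow> (\<exists>G L. (\<forall>y. GDERIV \<gamma> y :> G y) \<and> L-lipschitz_on UNIV G)"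

text \<open>Near each boundary point the domain is, in a rotated coordinate system with last axis \<open>\<nu>\<close>, the
  region above the graph of a \<open>C\<^sup>1\<^sup>,\<^sup>1\<close> function on the hyperplane orthogonal to \<open>\<nu>\<close>. Functions on this
  hyperplane are represented by functions on the whole space, evaluated at the projection.\<close>
definition C11_boundary :: "(real^'n) set \<Rightarrow> bool" where
  "C11_boundary \<Omega> \<longleftrightarrow> (\<forall>x\<^sub>0\<in>frontier \<Omega>. \<exists>\<delta>>0. \<exists>\<nu> \<gamma>. norm \<nu> = 1 \<and> C11_fun \<gamma> \<and>
     \<Omega> \<inter> ball x\<^sub>0 \<delta> = {x \<in> ball x\<^sub>0 \<delta>. x \<bullet> \<nu> > \<gamma> (x - (x \<bullet> \<nu>) *\<^sub>R \<nu>)})"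

definition bounded_C11_domain :: "(real^'n) set \<Rightarrow> bool" where
  "bounded_C11_domain \<Omega> \<longleftrightarrow> open \<Omega> \<and> connected \<Omega> \<and> \<Omega> \<noteq> {} \<and> bounded \<Omega> \<and> C11_boundary \<Omega>"

definition exterior :: "(real^'n) set \<Rightarrow> (real^'n) set" where
  "exterior \<Omega> = - closure \<Omega>"

section \<open>The operator\<close>

text \<open>With the usual constant \<open>C(n,s) = 4\<^sup>s \<Gamma>(n/2 + s) / (\<pi>\<^bsup>n/2\<^esup> |\<Gamma>(-s)|)\<close> one has
  \<open>(-\<Delta>)\<^sup>s u(x) = C(n,s) PV \<integral> (u(x) - u(y)) / |x - y|\<^bsup>n+2s\<^esup> dy\<close>. The operator below carries a factor 2 in
  front of the principal value integral, so the constant in its kernel is \<open>C(n,s) / 2\<close>.\<close>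
definition frac_const :: "nat \<Rightarrow> real \<Rightarrow> real" where
  "frac_const n s =
     4 powr s * Gamma (real n / 2 + s) / (2 * pi powr (real n / 2) * \<bar>Gamma (- s)\<bar>)"

definition frac_kernel :: "real \<Rightarrow> real^'n \<Rightarrow> real^'n \<Rightarrow> real" where
  "frac_kernel s x y = frac_const CARD('n) s / norm (x - y) powr (real CARD('n) + 2 * s)"

definition mag_phase :: "(real^'n \<Rightarrow> real^'n) \<Rightarrow> real^'n \<Rightarrow> real^'n \<Rightarrow> real" where
  "mag_phase A x y = (x - y) \<bullet> A ((1/2) *\<^sub>R (x + y))"

definition mag_form ::
  "real \<Rightarrow> (real^'n \<Rightarrow> real^'n) \<Rightarrow> (real^'n \<Rightarrow> real) \<Rightarrow> (real^'n \<Rightarrow> real) \<Rightarrow> real" where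
  "mag_form s A u v = Re (\<integral>(x, y).
       (complex_of_real (u x) - exp (\<i> * complex_of_real (mag_phase A x y)) * complex_of_real (u y)) *
       (complex_of_real (v x) - exp (- \<i> * complex_of_real (mag_phase A x y)) * complex_of_real (v y)) *
       complex_of_real (frac_kernel s x y) \<partial>lebesgue)"

text \<open>Elements of \<open>H\<^sup>-\<^sup>s\<close> are functionals on \<open>H\<^sup>s\<close>, and \<open>undefined\<close> off \<open>H\<^sup>s\<close>.\<close>
definition mag_op ::
  "real \<Rightarrow> (real^'n \<Rightarrow> real^'n) \<Rightarrow> (real^'n \<Rightarrow> real) \<Rightarrow> (real^'n \<Rightarrow> real) \<Rightarrow> real" where
  "mag_op s A u = restrict (mag_form s A u) (Hs s)"

text \<open>Restriction of a distribution to an open set: restriction of the functional to the test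
  functions supported there.\<close>
definition dist_restrict ::
  "((real^'n \<Rightarrow> real) \<Rightarrow> real) \<Rightarrow> (real^'n) set \<Rightarrow> (real^'n \<Rightarrow> real) \<Rightarrow> real" where
  "dist_restrict T U = restrict T (test_functions U)"

section \<open>The nonlinearity\<close>

definition taylor_coeff :: "(real^'n \<Rightarrow> real \<Rightarrow> real) \<Rightarrow> nat \<Rightarrow> real^'n \<Rightarrow> real" where
  "taylor_coeff a k x = (deriv ^^ k) (a x) 0"

definition analytic_Cs :: "real \<Rightarrow> (real^'n) set \<Rightarrow> (real^'n \<Rightarrow> real \<Rightarrow> real) \<Rightarrow> bool" where
  "analytic_Cs s \<Omega> a \<longleftrightarrow> (\<forall>k\<ge>1. taylor_coeff a k \<in> holder_space s \<Omega>) \<and>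
     (\<forall>z. (\<lambda>N. holder_norm s \<Omega> (\<lambda>x. a x z - (\<Sum>k=1..N. taylor_coeff a k x * z ^ k / fact k)))
            \<longlonglongrightarrow> 0)"

definition positive_slope_at_zero :: "(real^'n) set \<Rightarrow> (real^'n \<Rightarrow> real \<Rightarrow> real) \<Rightarrow> bool" where
  "positive_slope_at_zero \<Omega> a \<longleftrightarrow>
     (\<exists>c>0. \<forall>x\<in>\<Omega>. a x 0 = 0 \<and> deriv (a x) 0 \<ge> c)"

section \<open>Solution operators and the Dirichlet-to-Neumann map\<close>

definition lin_solution ::
  "real \<Rightarrow> (real^'n) set \<Rightarrow> (real^'n \<Rightarrow> real^'n) \<Rightarrow> (real^'n \<Rightarrow> real) \<Rightarrow> (real^'n \<Rightarrow> real) \<Rightarrow>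
   (real^'n \<Rightarrow> real) \<Rightarrow> bool" where
  "lin_solution s \<Omega> A q g u \<longleftrightarrow> u \<in> Hs s \<and> (\<lambda>x. u x - g x) \<in> Hs_tilde s \<Omega> \<and>
     (\<forall>v\<in>Hs_tilde s \<Omega>. mag_op s A u v + (LINT x:\<Omega>|lebesgue. q x * u x * v x) = 0)"

text \<open>The solution is unique only as an element of \<open>H\<^sup>s\<close>; an arbitrary representative is chosen.\<close>
definition lin_solve ::
  "real \<Rightarrow> (real^'n) set \<Rightarrow> (real^'n \<Rightarrow> real^'n) \<Rightarrow> (real^'n \<Rightarrow> real) \<Rightarrow> (real^'n \<Rightarrow> real) \<Rightarrow>
   real^'n \<Rightarrow> real" where
  "lin_solve s \<Omega> A q g = (SOME u. lin_solution s \<Omega> A q g u)"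

text \<open>The solution is looked for among continuous functions, so it is unique as a function, in
  contrast to the representative of the linear solution; hence the \<open>AE\<close> in the last line.\<close>
definition nl_solution ::
  "real \<Rightarrow> (real^'n) set \<Rightarrow> (real^'n \<Rightarrow> real^'n) \<Rightarrow> (real^'n \<Rightarrow> real \<Rightarrow> real) \<Rightarrow> real \<Rightarrow>
   (real^'n \<Rightarrow> real) \<Rightarrow> (real^'n \<Rightarrow> real) \<Rightarrow> bool" where
  "nl_solution s \<Omega> A a \<rho> g u \<longleftrightarrow>
     u \<in> Hs s \<inter> holder_space s UNIV \<and> (\<lambda>x. u x - g x) \<in> Hs_tilde s \<Omega> \<and>
     (\<forall>v\<in>Hs_tilde s \<Omega>. mag_op s A u v + (LINT x:\<Omega>|lebesgue. a x (u x) * v x) = 0) \<and>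
     (\<exists>w\<in>holder_space s UNIV. (\<forall>x\<in>exterior \<Omega>. w x = 0) \<and> holder_norm s UNIV w \<le> ereal \<rho> \<and>
        (AE x in lebesgue. u x - lin_solve s \<Omega> A (taylor_coeff a 1) g x = w x))"

text \<open>The radius \<open>\<rho>\<close> is small enough: for it and all smaller radii the nonlinear problem is well-posed.\<close>
definition small_radius ::
  "real \<Rightarrow> (real^'n) set \<Rightarrow> (real^'n \<Rightarrow> real^'n) \<Rightarrow> (real^'n) set \<Rightarrow> (real^'n \<Rightarrow> real \<Rightarrow> real) \<Rightarrow>
   real \<Rightarrow> bool" where
  "small_radius s \<Omega> A W a \<rho> \<longleftrightarrow> \<rho> > 0 \<and>
     (\<forall>\<rho>'. 0 < \<rho>' \<and> \<rho>' \<le> \<rho> \<longrightarrow>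
        (\<forall>g\<in>test_functions W. c2_norm g \<le> ereal \<rho>' \<longrightarrow> (\<exists>!u. nl_solution s \<Omega> A a \<rho>' g u)))"

text \<open>Solutions for a smaller radius are solutions for a larger one, so the solution does not depend
  on the choice of the small radius \<open>\<rho>\<close> (see \<open>nl_solve_eqI\<close>).\<close>
definition nl_solve ::
  "real \<Rightarrow> (real^'n) set \<Rightarrow> (real^'n \<Rightarrow> real^'n) \<Rightarrow> (real^'n) set \<Rightarrow> (real^'n \<Rightarrow> real \<Rightarrow> real) \<Rightarrow>
   (real^'n \<Rightarrow> real) \<Rightarrow> real^'n \<Rightarrow> real" where
  "nl_solve s \<Omega> A W a g =
     (THE u. \<exists>\<rho>. small_radius s \<Omega> A W a \<rho> \<and> c2_norm g \<le> ereal \<rho> \<and> nl_solution s \<Omega> A a \<rho> g u)"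

lemma nl_solution_mono:
  assumes "nl_solution s \<Omega> A a \<rho> g u" "\<rho> \<le> \<rho>'"
  shows "nl_solution s \<Omega> A a \<rho>' g u"
proof -
  have le: "N \<le> ereal \<rho> \<Longrightarrow> N \<le> ereal \<rho>'" for N
    using assms(2) order_trans[of N "ereal \<rho>" "ereal \<rho>'"] by simp
  show ?thesis using assms(1) unfolding nl_solution_def by (blast intro: le)
qed

lemma nl_solve_eqI:
  assumes \<rho>: "small_radius s \<Omega> A W a \<rho>" and g: "g \<in> test_functions W" "c2_norm g \<le> ereal \<rho>"
    and u: "nl_solution s \<Omega> A a \<rho> g u"
  shows "nl_solve s \<Omega> A W a g = u"
  unfolding nl_solve_def
proof (rule the_equality)
  show "\<exists>\<rho>. small_radius s \<Omega> A W a \<rho> \<and> c2_norm g \<le> ereal \<rho> \<and> nl_solution s \<Omega> A a \<rho> g u"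
    using assms by blast
next
  fix w assume "\<exists>\<sigma>. small_radius s \<Omega> A W a \<sigma> \<and> c2_norm g \<le> ereal \<sigma> \<and> nl_solution s \<Omega> A a \<sigma> g w"
  then obtain \<sigma> where \<sigma>: "small_radius s \<Omega> A W a \<sigma>" "c2_norm g \<le> ereal \<sigma>" "nl_solution s \<Omega> A a \<sigma> g w"
    by blast
  have uniq: "\<exists>!v. nl_solution s \<Omega> A a (max \<rho> \<sigma>) g v"
  proof (cases "\<rho> \<le> \<sigma>")
    case True then show ?thesis using \<sigma> g(1) by (auto simp: small_radius_def max_def)
  next
    case False then show ?thesis using \<rho> g by (auto simp: small_radius_def max_def)
  qed
  have "nl_solution s \<Omega> A a (max \<rho> \<sigma>) g u" "nl_solution s \<Omega> A a (max \<rho> \<sigma>) g w"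
    using nl_solution_mono u \<sigma>(3) by (metis max.cobounded1, metis max.cobounded2)
  then show "w = u" using uniq by blast
qed

definition DN_map ::
  "real \<Rightarrow> (real^'n) set \<Rightarrow> (real^'n \<Rightarrow> real^'n) \<Rightarrow> (real^'n) set \<Rightarrow> (real^'n \<Rightarrow> real \<Rightarrow> real) \<Rightarrow>
   (real^'n \<Rightarrow> real) \<Rightarrow> (real^'n \<Rightarrow> real) \<Rightarrow> real" where
  "DN_map s \<Omega> A W a g = dist_restrict (mag_op s A (nl_solve s \<Omega> A W a g)) (exterior \<Omega>)"

end

theory Submission
  imports Defs "HOL-Real_Asymp.Real_Asymp"
begin

text \<open>One exterior datum already determines the nonlinearity. Let \<open>g \<ge> 0\<close> be a small nonzero bump in \<open>W\<^sub>1\<close>,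
  let \<open>u\<^sub>1\<close> and \<open>u\<^sub>2\<close> be the solutions for the two nonlinearities with this datum, and let \<open>w = u\<^sub>1 - u\<^sub>2\<close>,
  which vanishes outside \<open>\<Omega>\<close>.

  The midpoint of a point of \<open>\<Omega>\<close> and a point of \<open>W\<^sub>2\<close> is outside the support of \<open>A\<close>, so the operator has
  its nonmagnetic form there, and the equality of the Dirichlet-to-Neumann data says that the Riesz
  potential \<open>\<integral> w(y) |x - y|\<^bsup>-n-2s\<^esup> dy\<close> vanishes for \<open>x\<close> in \<open>W\<^sub>2\<close>. This forces \<open>w = 0\<close>
  (\<open>unique_continuation\<close>): derivatives of the potential with respect to \<open>x\<close> at a single point already
  test \<open>w\<close> against all polynomials in the inverted variable \<open>(x - y) / |x - y|\<^sup>2\<close>, up to a fixed positive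
  weight (\<open>riesz_potential_injective\<close>).

  Hence \<open>u\<^sub>1 = u\<^sub>2 = u\<close>, and the two equations give \<open>a\<^sub>1(x,u(x)) = a\<^sub>2(x,u(x))\<close> for almost all \<open>x\<close> in \<open>\<Omega>\<close>. If
  the nonlinearities were different, then by analyticity there would be a box in \<open>\<Omega>\<close> and \<open>\<eta> > 0\<close> such that
  \<open>a\<^sub>1(x,z) \<noteq> a\<^sub>2(x,z)\<close> for \<open>x\<close> in the box and \<open>0 < |z| < \<eta>\<close> (\<open>distinct_nonlinearities_separate\<close>). As \<open>u\<close> is
  small with \<open>g\<close>, it vanishes on the box. The equation, tested with a bump \<open>\<phi>\<close> in the box, then reads
  \<open>\<integral>\<integral> cos \<theta>(x,y) \<phi>(x) u(y) K(x,y) dx dy = 0\<close>, where \<open>\<theta>\<close> is the magnetic phase. But \<open>u \<ge> 0\<close>, the bound on \<open>A\<close> makes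
  \<open>cos \<theta>(x,y) \<ge> 0\<close> for \<open>x\<close> in \<open>\<Omega>\<close>, and \<open>cos \<theta>(x,y) = 1\<close> for \<open>y\<close> in \<open>W\<^sub>1\<close>, where \<open>u = g\<close> is positive somewhere;
  so the integral is positive (\<open>form_with_bump_nonzero\<close>).

  The bounds \<open>0 \<le> u \<le> max g\<close> come from the linear problem, as \<open>u\<close> is the solution of the linear problem with
  the positive potential \<open>a(x,u(x)) / u(x)\<close> (\<open>nl_solution_bounded\<close>). The linear problem is solved by
  minimising its energy, which does not increase when the values of a competitor are clamped to the
  range of \<open>g\<close>, again because \<open>cos \<theta> \<ge> 0\<close> (\<open>lin_solution_exists_bounded\<close>).\<close>

section \<open>Smooth functions and bump functions\<close>

definition smooth1 :: "(real \<Rightarrow> real) \<Rightarrow> bool" where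
  "smooth1 H \<longleftrightarrow> (\<forall>k x. (deriv ^^ k) H differentiable (at x))"

lemma smooth1_coinduct:
  assumes "P H" and step: "\<And>F. P F \<Longrightarrow> (\<forall>x. F differentiable (at x)) \<and> P (deriv F)"
  shows "smooth1 H"
proof -
  have "P ((deriv ^^ k) H)" for k
    by (induction k) (use assms in auto)
  then show ?thesis using step by (auto simp: smooth1_def)
qed

lemma smooth1_deriv: "smooth1 H \<Longrightarrow> smooth1 (deriv H)"
  unfolding smooth1_def by (metis funpow_Suc_right comp_apply)

lemma smooth1_differentiable: "smooth1 H \<Longrightarrow> H differentiable (at x)"
  unfolding smooth1_def by (metis funpow_0)

text \<open>Smoothness speaks about all iterated partial derivatives at once. It therefore follows as soon as
  the function lies in some class of differentiable functions that is closed under partial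
  derivatives; the smoothness proofs below consist in exhibiting such a class.\<close>

lemma smooth_fun_coinduct:
  assumes "P f" and step: "\<And>g. P g \<Longrightarrow> (\<forall>x. g differentiable (at x)) \<and> (\<forall>j. P (partial_deriv j g))"
  shows "smooth_fun f"
proof -
  have "P (iter_partial js f)" for js
    by (induction js) (use assms in auto)
  then show ?thesis using step by (auto simp: smooth_fun_def)
qed

lemma iter_partial_append: "iter_partial (js @ ks) f = iter_partial js (iter_partial ks f)"
  by (induction js) auto

lemma smooth_fun_iter_partial: "smooth_fun f \<Longrightarrow> smooth_fun (iter_partial js f)"
  unfolding smooth_fun_def by (metis iter_partial_append)

lemma smooth_fun_partial: "smooth_fun f \<Longrightarrow> smooth_fun (partial_deriv j f)"
  using smooth_fun_iter_partial[of f "[j]"] by simp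

lemma smooth_fun_differentiable: "smooth_fun f \<Longrightarrow> f differentiable (at x)"
  unfolding smooth_fun_def by (metis iter_partial.simps(1))

lemma smooth_fun_continuous: "smooth_fun f \<Longrightarrow> continuous_on S f"
  by (meson continuous_at_imp_continuous_on differentiable_imp_continuous_within smooth_fun_differentiable)

lemma partial_deriv_eq:
  fixes f :: "real^'n \<Rightarrow> real"
  assumes "(f has_derivative D) (at x)"
  shows "partial_deriv j f x = D (axis j 1)"
proof -
  have lin: "linear D" using assms has_derivative_linear by blast
  have "((\<lambda>t. x + t *\<^sub>R axis j 1) has_derivative (\<lambda>t. t *\<^sub>R axis j 1)) (at 0)"
    by (auto intro!: derivative_eq_intros)
  moreover have "(f has_derivative D) (at (x + 0 *\<^sub>R axis j 1))" using assms by simp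
  ultimately have "((\<lambda>t. f (x + t *\<^sub>R axis j 1)) has_derivative (\<lambda>t. D (t *\<^sub>R axis j 1))) (at 0)"
    by (rule has_derivative_compose)
  moreover have "(\<lambda>t. D (t *\<^sub>R axis j 1)) = (\<lambda>t. D (axis j 1) * t)"
    using linear_scale[OF lin] by (auto simp: mult.commute)
  ultimately show ?thesis
    unfolding partial_deriv_def by (intro DERIV_imp_deriv) (simp add: has_field_derivative_def)
qed

text \<open>Sums, products and compositions are treated together, because the partial derivatives of a
  composition are products of a composition and a partial derivative.\<close>

inductive smooth_alg :: "(real^'n \<Rightarrow> real) \<Rightarrow> bool" where
  base: "smooth_fun f \<Longrightarrow> smooth_alg f"
| add: "smooth_alg f \<Longrightarrow> smooth_alg g \<Longrightarrow> smooth_alg (\<lambda>x. f x + g x)"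
| mult: "smooth_alg f \<Longrightarrow> smooth_alg g \<Longrightarrow> smooth_alg (\<lambda>x. f x * g x)"
| comp: "smooth_alg f \<Longrightarrow> smooth1 H \<Longrightarrow> smooth_alg (\<lambda>x. H (f x))"

lemma smooth_alg_step:
  assumes "smooth_alg f"
  shows "(\<forall>x. f differentiable (at x)) \<and> (\<forall>j. smooth_alg (partial_deriv j f))"
  using assms
proof induction
  case (base f)
  then show ?case using smooth_fun_partial smooth_fun_differentiable smooth_alg.base by blast
next
  case (add f g)
  have "partial_deriv j (\<lambda>x. f x + g x) = (\<lambda>x. partial_deriv j f x + partial_deriv j g x)" for j
  proof
    fix x
    from add.IH have "f differentiable (at x)" "g differentiable (at x)" by auto
    then obtain D E where *: "(f has_derivative D) (at x)" "(g has_derivative E) (at x)"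
      unfolding differentiable_def by blast
    from partial_deriv_eq[OF has_derivative_add[OF *]] partial_deriv_eq[OF *(1)] partial_deriv_eq[OF *(2)]
    show "partial_deriv j (\<lambda>x. f x + g x) x = partial_deriv j f x + partial_deriv j g x"
      by simp
  qed
  then show ?case using add by (auto intro: smooth_alg.add)
next
  case (mult f g)
  have "partial_deriv j (\<lambda>x. f x * g x) = (\<lambda>x. f x * partial_deriv j g x + partial_deriv j f x * g x)" for j
  proof
    fix x
    from mult.IH have "f differentiable (at x)" "g differentiable (at x)" by auto
    then obtain D E where *: "(f has_derivative D) (at x)" "(g has_derivative E) (at x)"
      unfolding differentiable_def by blast
    from partial_deriv_eq[OF has_derivative_mult[OF *]] partial_deriv_eq[OF *(1)] partial_deriv_eq[OF *(2)]
    show "partial_deriv j (\<lambda>x. f x * g x) x = f x * partial_deriv j g x + partial_deriv j f x * g x"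
      by simp
  qed
  then show ?case using mult by (auto intro!: smooth_alg.add smooth_alg.mult)
next
  case (comp f H)
  have d: "(H has_real_derivative deriv H t) (at t)" for t
    using smooth1_differentiable[OF comp(2)] by (simp add: DERIV_deriv_iff_real_differentiable)
  have *: "((\<lambda>x. H (f x)) has_derivative (\<lambda>v. deriv H (f x) * D v)) (at x)"
    if "(f has_derivative D) (at x)" for x D
    using has_derivative_compose[OF that, of H "\<lambda>t. deriv H (f x) * t"] d
    by (simp add: has_field_derivative_def)
  have "partial_deriv j (\<lambda>x. H (f x)) = (\<lambda>x. deriv H (f x) * partial_deriv j f x)" for j
  proof
    fix x
    from comp.IH have "f differentiable (at x)" by auto
    then obtain D where D: "(f has_derivative D) (at x)"
      unfolding differentiable_def by blast
    from partial_deriv_eq[OF *[OF D]] partial_deriv_eq[OF D]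
    show "partial_deriv j (\<lambda>x. H (f x)) x = deriv H (f x) * partial_deriv j f x"
      by simp
  qed
  moreover have "(\<lambda>x. H (f x)) differentiable (at x)" for x
  proof -
    from comp.IH have "f differentiable (at x)" by auto
    then obtain D where D: "(f has_derivative D) (at x)"
      unfolding differentiable_def by blast
    from *[OF D] show ?thesis unfolding differentiable_def by blast
  qed
  moreover have "smooth_alg (\<lambda>x. deriv H (f x) * partial_deriv j f x)" for j
    using smooth_alg.mult[OF smooth_alg.comp[OF comp.hyps(1) smooth1_deriv[OF comp.hyps(2)]]] comp.IH
    by simp
  ultimately show ?case by simp
qed

lemma smooth_alg_smooth: "smooth_alg f \<Longrightarrow> smooth_fun f"
  by (rule smooth_fun_coinduct[of smooth_alg]) (use smooth_alg_step in auto)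

lemma smooth_fun_add: "smooth_fun f \<Longrightarrow> smooth_fun g \<Longrightarrow> smooth_fun (\<lambda>x. f x + g x)"
  using smooth_alg_smooth[OF smooth_alg.add[OF smooth_alg.base smooth_alg.base]] .

lemma smooth_fun_mult: "smooth_fun f \<Longrightarrow> smooth_fun g \<Longrightarrow> smooth_fun (\<lambda>x. f x * g x)"
  using smooth_alg_smooth[OF smooth_alg.mult[OF smooth_alg.base smooth_alg.base]] .

lemma smooth_fun_compose: "smooth_fun f \<Longrightarrow> smooth1 H \<Longrightarrow> smooth_fun (\<lambda>x. H (f x))"
  using smooth_alg_smooth[OF smooth_alg.comp[OF smooth_alg.base]] .

lemma smooth_fun_affine: "smooth_fun (\<lambda>x::real^'n. v \<bullet> x + c)"
proof (rule smooth_fun_coinduct[of "\<lambda>f. \<exists>v c. f = (\<lambda>x. v \<bullet> x + c)"])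
  fix g :: "real^'n \<Rightarrow> real" assume "\<exists>v c. g = (\<lambda>x. v \<bullet> x + c)"
  then obtain v c where g: "g = (\<lambda>x. v \<bullet> x + c)" by blast
  have d: "(g has_derivative (\<lambda>h. v \<bullet> h)) (at x)" for x
    unfolding g by (auto intro!: derivative_eq_intros)
  have "partial_deriv j g = (\<lambda>x. 0 \<bullet> x + v \<bullet> axis j 1)" for j
    using partial_deriv_eq[OF d] by auto
  then show "(\<forall>x. g differentiable (at x)) \<and> (\<forall>j. \<exists>v c. partial_deriv j g = (\<lambda>x. v \<bullet> x + c))"
    using d unfolding differentiable_def by blast
qed auto

lemma smooth_fun_const: "smooth_fun (\<lambda>x::real^'n. c)"
  using smooth_fun_affine[of 0 c] by simp

lemma smooth_fun_component: "smooth_fun (\<lambda>x::real^'n. x $ i + c)"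
  using smooth_fun_affine[of "axis i 1" c] by (simp add: inner_axis_axis inner_axis inner_commute)

lemma smooth_fun_scale: "smooth_fun f \<Longrightarrow> smooth_fun (\<lambda>x. k * f x)"
  using smooth_fun_mult[OF smooth_fun_const] by blast

lemma smooth_fun_diff: "smooth_fun f \<Longrightarrow> smooth_fun g \<Longrightarrow> smooth_fun (\<lambda>x. f x - g x)"
  using smooth_fun_add[OF _ smooth_fun_scale[of g "-1"]] by simp

lemma smooth_fun_prod: "finite I \<Longrightarrow> (\<And>i. i \<in> I \<Longrightarrow> smooth_fun (f i)) \<Longrightarrow> smooth_fun (\<lambda>x. \<Prod>i\<in>I. f i x)"
  by (induction I rule: finite_induct) (auto intro: smooth_fun_mult smooth_fun_const)

definition flat_exp :: "real \<Rightarrow> real" where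
  "flat_exp t = (if t > 0 then exp (- 1 / t) else 0)"

lemma flat_exp_nonneg: "flat_exp t \<ge> 0" and flat_exp_eq_0_iff: "flat_exp t = 0 \<longleftrightarrow> t \<le> 0"
  by (auto simp: flat_exp_def)

lemma poly_exp_decay: "((\<lambda>t. poly p (1 / t) * exp (- 1 / t)) \<longlongrightarrow> 0) (at_right (0::real))"
proof -
  have "((\<lambda>y. poly p y / exp y) \<longlongrightarrow> 0) at_top"
  proof (induction p)
    case (pCons a p)
    have "((\<lambda>y. a / exp y + (\<Sum>i\<le>degree p. coeff p i * (y ^ Suc i / exp y))) \<longlongrightarrow> 0 + (\<Sum>i\<le>degree p. coeff p i * 0)) at_top"
      by (intro tendsto_add tendsto_sum tendsto_mult tendsto_const tendsto_power_div_exp_0)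
         (use tendsto_mult[OF tendsto_const[of a] tendsto_power_div_exp_0[of 0]] in simp)
    moreover have "a / exp y + (\<Sum>i\<le>degree p. coeff p i * (y ^ Suc i / exp y)) = poly (pCons a p) y / exp y" for y
      by (simp only: poly_pCons poly_altdef[of p])
         (simp add: sum_distrib_left sum_divide_distrib add_divide_distrib mult_ac)
    ultimately show ?case by simp
  qed simp
  then have "((\<lambda>t. poly p (inverse t) / exp (inverse t)) \<longlongrightarrow> 0) (at_right (0::real))"
    by (rule filterlim_compose[OF _ filterlim_inverse_at_top_right])
  then show ?thesis by (simp add: exp_minus field_simps)
qed

text \<open>All derivatives of \<open>flat_exp\<close> have this form, with a polynomial in \<open>1 / t\<close> as the factor.\<close>

definition flat_poly :: "real poly \<Rightarrow> real \<Rightarrow> real" where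
  "flat_poly p t = (if t > 0 then poly p (1 / t) * exp (- 1 / t) else 0)"

lemma flat_exp_eq_flat_poly: "flat_exp = flat_poly 1"
  by (auto simp: flat_exp_def flat_poly_def)

lemma flat_poly_DERIV:
  "(flat_poly p has_real_derivative flat_poly ([:0,0,1:] * (p - pderiv p)) t) (at t)"
proof -
  consider "t > 0" | "t < 0" | "t = 0" by linarith
  then show ?thesis
  proof cases
    case 1
    have "((\<lambda>t. poly p (1 / t) * exp (- 1 / t)) has_real_derivative flat_poly ([:0,0,1:] * (p - pderiv p)) t) (at t)"
      using 1 unfolding flat_poly_def
      by (auto intro!: derivative_eq_intros DERIV_chain2[OF poly_DERIV] simp: field_simps power2_eq_square)
    moreover have "\<forall>\<^sub>F t in nhds t. flat_poly p t = poly p (1 / t) * exp (- 1 / t)"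
      using 1 eventually_nhds_in_open[of "{0<..}" t] by (auto simp: flat_poly_def elim: eventually_mono)
    ultimately show ?thesis by (subst DERIV_cong_ev) auto
  next
    case 2
    have "\<forall>\<^sub>F t in nhds t. flat_poly p t = 0"
      using 2 eventually_nhds_in_open[of "{..<0}" t] by (auto simp: flat_poly_def elim: eventually_mono)
    then show ?thesis using 2 by (subst DERIV_cong_ev) (auto simp: flat_poly_def)
  next
    case 3
    have "((\<lambda>t. flat_poly p t / t) \<longlongrightarrow> 0) (at_right 0)"
    proof (rule tendsto_cong[THEN iffD1, OF _ poly_exp_decay[of "[:0,1:] * p"]])
      show "\<forall>\<^sub>F t in at_right 0. poly ([:0,1:] * p) (1 / t) * exp (- 1 / t) = flat_poly p t / t"
        by (auto simp: flat_poly_def intro!: eventually_mono[OF eventually_at_right_less])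
    qed
    moreover have "((\<lambda>t. flat_poly p t / t) \<longlongrightarrow> 0) (at_left 0)"
      by (rule tendsto_cong[THEN iffD1, OF _ tendsto_const])
         (auto simp: flat_poly_def eventually_at_left_field intro: exI[of _ "-1"])
    ultimately have "((\<lambda>t. flat_poly p t / t) \<longlongrightarrow> 0) (at 0)"
      by (simp add: filterlim_at_split)
    then show ?thesis using 3 by (simp add: has_field_derivative_iff flat_poly_def)
  qed
qed

lemma smooth1_flat_exp: "smooth1 flat_exp"
proof (rule smooth1_coinduct[of "\<lambda>F. \<exists>p. F = flat_poly p"])
  fix F assume "\<exists>p. F = flat_poly p"
  then obtain p where F: "F = flat_poly p" by blast
  have "deriv F = flat_poly ([:0,0,1:] * (p - pderiv p))"
    unfolding F using DERIV_imp_deriv[OF flat_poly_DERIV] by blast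
  moreover have "\<forall>x. F differentiable (at x)"
    unfolding F using flat_poly_DERIV real_differentiable_def by blast
  ultimately show "(\<forall>x. F differentiable (at x)) \<and> (\<exists>p. deriv F = flat_poly p)" by blast
qed (use flat_exp_eq_flat_poly in blast)

text \<open>With \<open>y = 1 / t\<close> the derivative is \<open>y\<^sup>2 exp (- y)\<close>, which is at most 1 because \<open>y \<le> exp (y / 2)\<close>.\<close>

lemma flat_exp_mono_lipschitz:
  assumes "b \<le> a" shows "0 \<le> flat_exp a - flat_exp b" "flat_exp a - flat_exp b \<le> a - b"
proof -
  define D where "D = flat_poly ([:0,0,1:] * (1 - pderiv 1))"
  have D: "(flat_exp has_real_derivative D t) (at t)" for t
    unfolding D_def flat_exp_eq_flat_poly by (rule flat_poly_DERIV)
  have D0: "D t \<ge> 0" for t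
    by (auto simp: D_def flat_poly_def)
  have D1: "D t \<le> 1" for t
  proof (cases "t > 0")
    case True
    define y where "y = 1 / t"
    have y: "y > 0" using True by (simp add: y_def)
    have "y \<le> 1 + y / 2 + (y / 2)\<^sup>2 / 2" 
      using zero_le_power2[of "y / 2 - 1"] by (simp add: power2_eq_square field_simps)
    also have "\<dots> \<le> exp (y / 2)" using exp_lower_Taylor_quadratic[of "y/2"] y by simp
    finally have "y\<^sup>2 \<le> (exp (y / 2))\<^sup>2" using y by (intro power_mono) auto
    also have "\<dots> = exp y" by (simp add: power2_eq_square flip: exp_add)
    finally have "y\<^sup>2 * exp (- y) \<le> 1" by (simp add: exp_minus field_simps)
    then show ?thesis using True
      by (simp add: D_def flat_poly_def y_def power2_eq_square pderiv_1)
  qed (simp add: D_def flat_poly_def)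
  show "0 \<le> flat_exp a - flat_exp b"
    using DERIV_nonneg_imp_nondecreasing[OF assms, of flat_exp] D D0 by fastforce
  have "((\<lambda>t. t - flat_exp t) has_real_derivative 1 - D t) (at t)" for t
    by (auto intro!: derivative_eq_intros D)
  then have "b - flat_exp b \<le> a - flat_exp a"
    using DERIV_nonneg_imp_nondecreasing[OF assms, of "\<lambda>t. t - flat_exp t"] D1
    by (metis diff_ge_0_iff_ge)
  then show "flat_exp a - flat_exp b \<le> a - b" by simp
qed

text \<open>A smooth substitute for the truncation of values to the interval from 0 to \<open>M\<close>: it is a
  contraction, and its fixed points are exactly the points of this interval. It does not map into
  the interval, but energy estimates only use the contraction property, and in the limit of a
  minimising sequence the fixed point property is enough. Smoothness matters because it keeps the
  truncation of a test function a test function.\<close>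

definition soft_clamp :: "real \<Rightarrow> real \<Rightarrow> real" where
  "soft_clamp M z = z - flat_exp (z - M) + flat_exp (- z)"

lemma soft_clamp_lipschitz: "\<bar>soft_clamp M a - soft_clamp M b\<bar> \<le> \<bar>a - b\<bar>"
proof (induction a b rule: linorder_wlog)
  case (le a b)
  then show ?case
    using flat_exp_mono_lipschitz[of "a - M" "b - M"] flat_exp_mono_lipschitz[of "- b" "- a"]
    by (auto simp: soft_clamp_def abs_le_iff)
qed (simp add: abs_minus_commute)

lemma soft_clamp_zero: "M \<ge> 0 \<Longrightarrow> soft_clamp M 0 = 0"
  by (simp add: soft_clamp_def flat_exp_def)

lemma soft_clamp_abs_le: "M \<ge> 0 \<Longrightarrow> \<bar>soft_clamp M z\<bar> \<le> \<bar>z\<bar>"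
  using soft_clamp_lipschitz[of M z 0] soft_clamp_zero by simp

lemma soft_clamp_fixed_iff: "M \<ge> 0 \<Longrightarrow> soft_clamp M z = z \<longleftrightarrow> 0 \<le> z \<and> z \<le> M"
  by (auto simp: soft_clamp_def flat_exp_def)

lemma smooth_fun_soft_clamp: "smooth_fun f \<Longrightarrow> smooth_fun (\<lambda>x. soft_clamp M (f x))"
  unfolding soft_clamp_def
  using smooth_fun_compose[OF smooth_fun_diff[OF _ smooth_fun_const] smooth1_flat_exp, of f M]
    smooth_fun_compose[OF smooth_fun_scale smooth1_flat_exp, of f "-1"]
  by (auto intro!: smooth_fun_add smooth_fun_diff)

definition bump :: "real^'n \<Rightarrow> real^'n \<Rightarrow> real^'n \<Rightarrow> real" where
  "bump a b x = (\<Prod>i\<in>UNIV. flat_exp (x $ i - a $ i) * flat_exp (b $ i - x $ i))"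

lemma bump_nonneg: "bump a b x \<ge> 0"
  unfolding bump_def by (intro prod_nonneg) (auto simp: flat_exp_nonneg)

lemma bump_pos_iff: "bump a b x > 0 \<longleftrightarrow> x \<in> box a b"
proof -
  have "bump a b x > 0 \<longleftrightarrow> bump a b x \<noteq> 0" using bump_nonneg[of a b x] by auto
  also have "\<dots> \<longleftrightarrow> x \<in> box a b"
    unfolding bump_def by (auto simp: flat_exp_eq_0_iff mem_box_cart not_le)
  finally show ?thesis .
qed

lemma smooth_fun_bump:
  fixes a b :: "real^'n"
  shows "smooth_fun (bump a b)"
proof -
  have 1: "smooth_fun (\<lambda>x::real^'n. flat_exp (x $ i - a $ i))" for i
    using smooth_fun_compose[OF smooth_fun_component[of i "- a $ i"] smooth1_flat_exp] by simp
  have 2: "smooth_fun (\<lambda>x::real^'n. flat_exp (b $ i - x $ i))" for i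
    using smooth_fun_compose[OF smooth_fun_diff[OF smooth_fun_const[of "b $ i"] smooth_fun_component[of i 0]] smooth1_flat_exp] by simp
  have "bump a b = (\<lambda>x. \<Prod>i\<in>UNIV. flat_exp (x $ i - a $ i) * flat_exp (b $ i - x $ i))"
    by (auto simp: bump_def)
  then show ?thesis using smooth_fun_prod[OF finite smooth_fun_mult[OF 1 2]] by simp
qed

lemma test_functionsI:
  assumes "smooth_fun f" "compact K" "K \<subseteq> U" "\<And>x. x \<notin> K \<Longrightarrow> f x = 0"
  shows "f \<in> test_functions U"
proof -
  have "closure {x. f x \<noteq> 0} \<subseteq> K"
    using assms by (intro closure_minimal compact_imp_closed) auto
  moreover have "bounded {x. f x \<noteq> 0}"
    by (rule bounded_subset[OF compact_imp_bounded[OF assms(2)]]) (use assms(4) in auto)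
  ultimately show ?thesis
    using assms unfolding test_functions_def by auto
qed

lemma test_functions_smooth: "f \<in> test_functions U \<Longrightarrow> smooth_fun f"
  by (simp add: test_functions_def)

lemma test_functions_off: "f \<in> test_functions U \<Longrightarrow> x \<notin> U \<Longrightarrow> f x = 0"
  using closure_subset[of "{x. f x \<noteq> 0}"] by (auto simp: test_functions_def)

lemma test_functions_compact:
  assumes "f \<in> test_functions U"
  obtains K where "compact K" "K \<subseteq> U" "\<And>x. x \<notin> K \<Longrightarrow> f x = 0"
proof (rule that[of "closure {x. f x \<noteq> 0}"])
  show "f x = 0" if "x \<notin> closure {x. f x \<noteq> 0}" for x
    using that closure_subset[of "{x. f x \<noteq> 0}"] by auto
qed (use assms in \<open>auto simp: test_functions_def\<close>)

lemma test_functions_lincomb: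
  assumes "f \<in> test_functions U" "g \<in> test_functions U"
  shows "(\<lambda>x. \<alpha> * f x + \<beta> * g x) \<in> test_functions U"
proof -
  obtain K where K: "compact K" "K \<subseteq> U" "\<And>x. x \<notin> K \<Longrightarrow> f x = 0" using test_functions_compact[OF assms(1)] by blast
  obtain L where L: "compact L" "L \<subseteq> U" "\<And>x. x \<notin> L \<Longrightarrow> g x = 0" using test_functions_compact[OF assms(2)] by blast
  show ?thesis
    by (rule test_functionsI[of _ "K \<union> L"])
       (use K L test_functions_smooth[OF assms(1)] test_functions_smooth[OF assms(2)]
        in \<open>auto intro!: smooth_fun_add smooth_fun_scale compact_Un\<close>)
qed

lemma test_functions_zero: "(\<lambda>x. 0) \<in> test_functions U"
  by (rule test_functionsI[of _ "{}"]) (auto intro: smooth_fun_const)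

lemma smooth1_one_minus_exp: "smooth1 (\<lambda>t. 1 - exp (- (m * t)))"
proof (rule smooth1_coinduct[of "\<lambda>F. \<exists>c d. F = (\<lambda>t. c + d * exp (- (m * t)))"])
  show "\<exists>c d. (\<lambda>t. 1 - exp (- (m * t))) = (\<lambda>t. c + d * exp (- (m * t)))"
    by (rule exI[of _ 1], rule exI[of _ "-1"]) auto
next
  fix F :: "real \<Rightarrow> real"
  assume "\<exists>c d. F = (\<lambda>t. c + d * exp (- (m * t)))"
  then obtain c d where F: "F = (\<lambda>t. c + d * exp (- (m * t)))" by blast
  have D: "(F has_real_derivative (0 + (- (d * m)) * exp (- (m * t)))) (at t)" for t
    unfolding F by (auto intro!: derivative_eq_intros)
  have "deriv F = (\<lambda>t. 0 + (- (d * m)) * exp (- (m * t)))"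
    using DERIV_imp_deriv[OF D] by blast
  moreover have "\<forall>x. F differentiable (at x)"
    using D real_differentiable_def by blast
  ultimately show "(\<forall>x. F differentiable (at x)) \<and> (\<exists>c d. deriv F = (\<lambda>t. c + d * exp (- (m * t))))"
    by blast
qed

lemma bump_off: "x \<notin> cbox a b \<Longrightarrow> bump a b x = 0"
  using bump_pos_iff[of a b x] bump_nonneg[of a b x] box_subset_cbox by fastforce

lemma bump_test_function: "cbox a b \<subseteq> U \<Longrightarrow> bump a b \<in> test_functions U"
  by (rule test_functionsI[OF smooth_fun_bump compact_cbox]) (auto simp: bump_off)

text \<open>Test functions that increase to the indicator function of an open box as \<open>m\<close> grows.\<close>

definition plateau :: "nat \<Rightarrow> real^'n \<Rightarrow> real^'n \<Rightarrow> real^'n \<Rightarrow> real" where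
  "plateau m a b x = 1 - exp (- (real m * bump a b x))"

lemma smooth_fun_plateau: "smooth_fun (plateau m a b)"
  using smooth_fun_compose[OF smooth_fun_bump[of a b] smooth1_one_minus_exp[of "real m"]]
  by (simp add: plateau_def[abs_def])

lemma plateau_test_function: "cbox a b \<subseteq> U \<Longrightarrow> plateau m a b \<in> test_functions U"
  by (rule test_functionsI[OF smooth_fun_plateau compact_cbox]) (auto simp: plateau_def bump_off)

lemma plateau_measurable: "plateau m a b \<in> borel_measurable borel"
  by (intro borel_measurable_continuous_onI smooth_fun_continuous smooth_fun_plateau)

lemma plateau_abs_le: "\<bar>plateau m a b x\<bar> \<le> 1"
proof -
  have "exp (- (real m * bump a b x)) \<le> 1" "exp (- (real m * bump a b x)) > 0"
    using bump_nonneg[of a b x] by simp_all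
  then show ?thesis by (simp add: plateau_def abs_le_iff)
qed

lemma plateau_off: "x \<notin> box a b \<Longrightarrow> plateau m a b x = 0"
  using bump_pos_iff[of a b x] bump_nonneg[of a b x] by (fastforce simp: plateau_def)

lemma plateau_tendsto: "(\<lambda>m. plateau m a b x) \<longlonglongrightarrow> indicator (box a b) x"
proof (cases "x \<in> box a b")
  case True
  then have "bump a b x > 0" by (simp add: bump_pos_iff)
  then have "(\<lambda>m::nat. 1 - exp (- (real m * bump a b x))) \<longlonglongrightarrow> 1" by real_asymp
  then show ?thesis using True by (simp add: plateau_def)
qed (simp add: plateau_off)

lemma iter_partial_off:
  assumes "compact K" "\<And>x. x \<notin> K \<Longrightarrow> f x = 0" "x \<notin> K"
  shows "iter_partial js f x = 0"
  using assms(3)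
proof (induction js arbitrary: x)
  case (Cons j js)
  have "open (- K)" using assms(1) compact_imp_closed by blast
  have "(iter_partial js f has_derivative (\<lambda>h. 0)) (at x)"
    by (rule has_derivative_transform_within_open[OF has_derivative_const[of 0] \<open>open (- K)\<close>])
       (use Cons in auto)
  then show ?case using partial_deriv_eq by force
qed (use assms in auto)

lemma test_functions_bounded:
  assumes "f \<in> test_functions U"
  obtains C where "\<And>x. \<bar>iter_partial js f x\<bar> \<le> C"
proof -
  obtain K where K: "compact K" "K \<subseteq> U" "\<And>x. x \<notin> K \<Longrightarrow> f x = 0" using test_functions_compact[OF assms(1)] by blast
  have "continuous_on K (iter_partial js f)"
    by (intro smooth_fun_continuous smooth_fun_iter_partial test_functions_smooth[OF assms])
  then have "bounded (iter_partial js f ` K)" using K compact_continuous_image compact_imp_bounded by blast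
  then obtain C where "\<And>x. x \<in> K \<Longrightarrow> \<bar>iter_partial js f x\<bar> \<le> C"
    unfolding bounded_iff by auto
  then have "\<bar>iter_partial js f x\<bar> \<le> max C 0" for x
    using iter_partial_off[of K f x js] K by (cases "x \<in> K") (force, simp)
  then show ?thesis using that by blast
qed

lemma test_functions_lipschitz:
  fixes f :: "real^'n \<Rightarrow> real"
  assumes "f \<in> test_functions U"
  obtains L where "L \<ge> 0" "\<And>x y. \<bar>f x - f y\<bar> \<le> L * norm (x - y)"
proof -
  have "\<exists>C. \<forall>x. \<bar>iter_partial [j] f x\<bar> \<le> C" for j
    using test_functions_bounded[OF assms, of "[j]"] by blast
  then have "\<forall>j. \<exists>C. \<forall>x. \<bar>partial_deriv j f x\<bar> \<le> C" by simp
  from choice[OF this] obtain C where C: "\<And>j x. \<bar>partial_deriv j f x\<bar> \<le> C j" by blast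
  define L where "L = (\<Sum>j\<in>UNIV. C j)"
  have L0: "L \<ge> 0" unfolding L_def by (intro sum_nonneg) (use C abs_ge_zero order_trans in blast)
  have "\<forall>x. \<exists>D. (f has_derivative D) (at x)"
    using smooth_fun_differentiable[OF test_functions_smooth[OF assms]]
    unfolding differentiable_def by blast
  from choice[OF this] obtain D where D: "\<And>x. (f has_derivative D x) (at x)" by blast
  have on: "onorm (D x) \<le> L" for x
  proof (rule onorm_bound[OF L0])
    fix v
    have lin: "linear (D x)" using D has_derivative_linear by blast
    have "D x v = D x (\<Sum>j\<in>UNIV. v $ j *\<^sub>R axis j 1)"
      using basis_expansion[of v] by (simp add: scalar_mult_eq_scaleR)
    also have "\<dots> = (\<Sum>j\<in>UNIV. v $ j * partial_deriv j f x)"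
      using partial_deriv_eq[OF D] by (simp add: linear_sum[OF lin] linear_scale[OF lin])
    also have "norm \<dots> \<le> (\<Sum>j\<in>UNIV. norm v * C j)"
      by (rule sum_norm_le) (auto simp: abs_mult intro!: mult_mono component_le_norm_cart C)
    finally show "norm (D x v) \<le> L * norm v" by (simp add: L_def sum_distrib_left mult.commute)
  qed
  have "norm (f x - f y) \<le> L * norm (x - y)" for x y
    by (rule differentiable_bound[of UNIV f D]) (use D on in auto)
  then show ?thesis using that L0 by auto
qed

section \<open>Lebesgue measure on pairs\<close>

text \<open>Elements of the function spaces are only determined up to null sets. Composition with the two
  projections of a pair and with its midpoint is compatible with this, since these maps pull null
  sets back to null sets.\<close>

definition null_preserving :: "('a::euclidean_space \<Rightarrow> 'b::euclidean_space) \<Rightarrow> bool" where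
  "null_preserving f \<longleftrightarrow> f \<in> borel_measurable borel \<and> (\<forall>N\<in>null_sets lborel. f -` N \<in> null_sets lborel)"

lemma null_preserving_measurable:
  assumes "null_preserving f"
  shows "f \<in> lebesgue \<rightarrow>\<^sub>M lebesgue"
proof (rule completion.measurable_completion2)
  show m: "f \<in> lebesgue \<rightarrow>\<^sub>M lborel"
    using assms measurable_completion[of f lborel lborel] by (simp add: null_preserving_def)
  show "null_sets lborel \<subseteq> null_sets (distr lebesgue lborel f)"
  proof
    fix N :: "'b set" assume N: "N \<in> null_sets lborel"
    then have "f -` N \<in> null_sets lborel" using assms by (simp add: null_preserving_def)
    then show "N \<in> null_sets (distr lebesgue lborel f)"
      using N m by (auto simp: null_sets_def emeasure_distr)
  qed
qed

lemma null_preserving_AE: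
  assumes f: "null_preserving f" and P: "AE x in lebesgue. P x"
  shows "AE p in lebesgue. P (f p)"
proof -
  have "AE x in lborel. P x" using P by (simp add: AE_completion_iff)
  then obtain N where N: "N \<in> null_sets lborel" "{x. \<not> P x} \<subseteq> N"
    by (auto elim!: AE_E simp: null_sets_def)
  have "AE p in lborel. P (f p)"
    by (rule AE_I'[of "f -` N"]) (use N f in \<open>auto simp: null_preserving_def\<close>)
  then show ?thesis by (simp add: AE_completion_iff)
qed

lemma null_preserving_fst: "null_preserving (fst :: ('a::euclidean_space \<times> 'a) \<Rightarrow> 'a)"
  unfolding null_preserving_def
proof safe
  fix N :: "'a set" assume N: "N \<in> null_sets lborel"
  have "fst -` N = N \<times> (UNIV :: 'a set)" by auto
  moreover have "emeasure (lborel \<Otimes>\<^sub>M lborel) (N \<times> (UNIV :: 'a set)) = 0"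
    using N by (subst lborel.emeasure_pair_measure_Times) auto
  moreover have "N \<times> (UNIV :: 'a set) \<in> sets (lborel \<Otimes>\<^sub>M lborel)"
    using N by (intro pair_measureI) auto
  ultimately show "(fst :: ('a \<times> 'a) \<Rightarrow> 'a) -` N \<in> null_sets lborel"
    by (simp only: lborel_prod null_sets_def mem_Collect_eq)
qed (intro borel_measurable_continuous_onI continuous_intros)

lemma null_preserving_snd: "null_preserving (snd :: ('a::euclidean_space \<times> 'a) \<Rightarrow> 'a)"
  unfolding null_preserving_def
proof safe
  fix N :: "'a set" assume N: "N \<in> null_sets lborel"
  have "snd -` N = (UNIV :: 'a set) \<times> N" by auto
  moreover have "emeasure (lborel \<Otimes>\<^sub>M lborel) ((UNIV :: 'a set) \<times> N) = 0"
    using N by (subst lborel.emeasure_pair_measure_Times) auto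
  moreover have "(UNIV :: 'a set) \<times> N \<in> sets (lborel \<Otimes>\<^sub>M lborel)"
    using N by (intro pair_measureI) auto
  ultimately show "(snd :: ('a \<times> 'a) \<Rightarrow> 'a) -` N \<in> null_sets lborel"
    by (simp only: lborel_prod null_sets_def mem_Collect_eq)
qed (intro borel_measurable_continuous_onI continuous_intros)

definition midpt :: "'a::euclidean_space \<times> 'a \<Rightarrow> 'a" where
  "midpt p = (1/2) *\<^sub>R (fst p + snd p)"

text \<open>For a fixed first component the midpoint map is an affine bijection, and the section of the
  preimage of \<open>N\<close> is the image of \<open>N\<close> under its inverse. So all sections are null sets.\<close>

lemma null_preserving_midpt: "null_preserving (midpt :: ('a::euclidean_space \<times> 'a) \<Rightarrow> 'a)"
  unfolding null_preserving_def
proof safe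
  show m: "(midpt :: ('a \<times> 'a) \<Rightarrow> 'a) \<in> borel_measurable borel"
    unfolding midpt_def by (intro borel_measurable_continuous_onI continuous_intros)
  fix N :: "'a set" assume N: "N \<in> null_sets lborel"
  have mN: "(midpt :: ('a \<times> 'a) \<Rightarrow> 'a) -` N \<in> sets borel"
    using measurable_sets[OF m, of N] N by auto
  have null: "emeasure lborel (Pair x -` (midpt -` N)) = 0" for x
  proof -
    have "Pair x -` (midpt -` N) = (\<lambda>z. 2 *\<^sub>R z - x) ` N"
    proof -
      have "2 *\<^sub>R ((1/2) *\<^sub>R (x + y)) - x = y" "(1/2) *\<^sub>R (x + (2 *\<^sub>R y - x)) = y" for y
        by (auto simp: algebra_simps)
      then show ?thesis unfolding midpt_def by (force simp: image_iff)
    qed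
    moreover have "negligible ((\<lambda>z. 2 *\<^sub>R z - x) ` N)"
    proof (rule negligible_differentiable_image_negligible)
      show "negligible N" using N by (simp add: negligible_iff_null_sets null_sets_completionI)
    qed (auto intro!: derivative_intros simp: differentiable_on_def)
    moreover have "Pair x -` (midpt -` N) \<in> sets lborel"
      using sets_Pair1[of "midpt -` N" lborel lborel x] mN by (simp only: lborel_prod) simp
    ultimately show ?thesis
      using emeasure_completion[of "Pair x -` (midpt -` N)" lborel]
      by (simp add: negligible_iff_null_sets null_sets_def main_part_sets)
  qed
  have "emeasure lborel (midpt -` N) = emeasure (lborel \<Otimes>\<^sub>M lborel) (midpt -` N :: ('a \<times> 'a) set)"
    by (simp only: lborel_prod)
  also have "\<dots> = (\<integral>\<^sup>+x. emeasure lborel (Pair x -` (midpt -` N)) \<partial>lborel)"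
    by (rule lborel.emeasure_pair_measure_alt) (use mN in \<open>simp only: lborel_prod sets_lborel\<close>)
  finally have "emeasure lborel (midpt -` N :: ('a \<times> 'a) set) = 0" using null by simp
  then show "(midpt -` N :: ('a \<times> 'a) set) \<in> null_sets lborel"
    using mN by (simp add: null_sets_def)
qed

lemmas measurable_fst_lebesgue = null_preserving_measurable[OF null_preserving_fst]
lemmas measurable_snd_lebesgue = null_preserving_measurable[OF null_preserving_snd]
lemmas measurable_midpt_lebesgue = null_preserving_measurable[OF null_preserving_midpt]

lemma measurable_comp_fst_snd:
  assumes "f \<in> borel_measurable (lebesgue :: ('a::euclidean_space) measure)"
  shows "(\<lambda>p. f (fst p)) \<in> borel_measurable (lebesgue :: ('a \<times> 'a) measure)"
    "(\<lambda>p. f (snd p)) \<in> borel_measurable (lebesgue :: ('a \<times> 'a) measure)"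
    "(\<lambda>p. f (midpt p)) \<in> borel_measurable (lebesgue :: ('a \<times> 'a) measure)"
  using measurable_compose[OF measurable_fst_lebesgue assms] measurable_compose[OF measurable_snd_lebesgue assms]
    measurable_compose[OF measurable_midpt_lebesgue assms] by auto

lemma measurable_lebesgueI: "f \<in> borel_measurable borel \<Longrightarrow> f \<in> borel_measurable lebesgue"
  by (simp add: measurable_completion)

lemma nn_integral_lborel_translate:
  fixes k :: "'a::euclidean_space \<Rightarrow> ennreal"
  assumes "k \<in> borel_measurable borel"
  shows "(\<integral>\<^sup>+x. k (x - y) \<partial>lborel) = (\<integral>\<^sup>+x. k x \<partial>lborel)"
proof -
  have "(\<integral>\<^sup>+x. k x \<partial>lborel) = (\<integral>\<^sup>+x. k x \<partial>distr lborel borel ((+) (- y)))"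
    by (simp add: lborel_distr_plus)
  also have "\<dots> = (\<integral>\<^sup>+x. k (- y + x) \<partial>lborel)"
    using assms by (intro nn_integral_distr) auto
  finally show ?thesis by simp
qed

lemma nn_integral_lborel_reflect:
  fixes k :: "'a::euclidean_space \<Rightarrow> ennreal"
  assumes "k \<in> borel_measurable borel"
  shows "(\<integral>\<^sup>+x. k (y - x) \<partial>lborel) = (\<integral>\<^sup>+x. k x \<partial>lborel)"
proof -
  have "(lborel :: 'a measure) = density (distr lborel borel (\<lambda>x. 0 + (- 1) *\<^sub>R x)) (\<lambda>_. \<bar>- 1 :: real\<bar>^DIM('a))"
    by (rule lborel_affine) simp
  also have "\<dots> = distr lborel borel (uminus :: 'a \<Rightarrow> 'a)" by (simp add: density_1)
  finally have "(\<integral>\<^sup>+x. k x \<partial>lborel) = (\<integral>\<^sup>+x. k x \<partial>distr lborel borel uminus)"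
    by (rule arg_cong)
  also have "\<dots> = (\<integral>\<^sup>+x. k (- x) \<partial>lborel)"
    using assms by (intro nn_integral_distr) auto
  also have "\<dots> = (\<integral>\<^sup>+x. k (- (x - y)) \<partial>lborel)"
    by (rule nn_integral_lborel_translate[symmetric]) (use assms in auto)
  finally show ?thesis by simp
qed

text \<open>Tonelli's theorem and translation invariance, applied to a Borel function that agrees with \<open>f\<close>
  almost everywhere.\<close>

lemma nn_integral_convolution:
  fixes k f :: "'a::euclidean_space \<Rightarrow> ennreal"
  assumes k: "k \<in> borel_measurable borel" and f: "f \<in> borel_measurable lebesgue"
  shows "(\<integral>\<^sup>+p. k (fst p - snd p) * f (snd p) \<partial>lebesgue) = (\<integral>\<^sup>+z. k z \<partial>lborel) * (\<integral>\<^sup>+y. f y \<partial>lebesgue)"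
    and "(\<integral>\<^sup>+p. k (fst p - snd p) * f (fst p) \<partial>lebesgue) = (\<integral>\<^sup>+z. k z \<partial>lborel) * (\<integral>\<^sup>+y. f y \<partial>lebesgue)"
proof -
  obtain g where g: "g \<in> borel_measurable lborel" "AE x in lborel. f x = g x"
    using completion_ex_borel_measurable[OF f] by blast
  have gb[measurable]: "g \<in> borel_measurable borel" using g by simp
  note k[measurable]
  have ae: "AE x in lebesgue. f x = g x" using g by (simp add: AE_completion_iff)
  have fg: "(\<integral>\<^sup>+y. f y \<partial>lebesgue) = (\<integral>\<^sup>+y. g y \<partial>lborel)"
    using g by (simp add: nn_integral_completion cong: nn_integral_cong_AE)
  have "(\<integral>\<^sup>+p. k (fst p - snd p) * f (snd p) \<partial>lebesgue) = (\<integral>\<^sup>+p. k (fst p - snd p) * g (snd p) \<partial>lebesgue)"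
    by (rule nn_integral_cong_AE) (use null_preserving_AE[OF null_preserving_snd ae] in auto)
  also have "\<dots> = (\<integral>\<^sup>+(x, y). k (x - y) * g y \<partial>(lborel \<Otimes>\<^sub>M lborel))"
    by (simp add: nn_integral_completion lborel_prod case_prod_beta')
  also have "\<dots> = (\<integral>\<^sup>+y. \<integral>\<^sup>+x. k (x - y) * g y \<partial>lborel \<partial>lborel)"
    by (subst lborel_pair.nn_integral_snd[symmetric]) (auto simp: split_beta')
  also have "\<dots> = (\<integral>\<^sup>+y. (\<integral>\<^sup>+z. k z \<partial>lborel) * g y \<partial>lborel)"
    by (intro nn_integral_cong) (simp add: nn_integral_multc nn_integral_lborel_translate)
  also have "\<dots> = (\<integral>\<^sup>+z. k z \<partial>lborel) * (\<integral>\<^sup>+y. g y \<partial>lborel)"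
    by (simp add: nn_integral_cmult)
  finally show "(\<integral>\<^sup>+p. k (fst p - snd p) * f (snd p) \<partial>lebesgue) = (\<integral>\<^sup>+z. k z \<partial>lborel) * (\<integral>\<^sup>+y. f y \<partial>lebesgue)"
    by (simp add: fg)
  have "(\<integral>\<^sup>+p. k (fst p - snd p) * f (fst p) \<partial>lebesgue) = (\<integral>\<^sup>+p. k (fst p - snd p) * g (fst p) \<partial>lebesgue)"
    by (rule nn_integral_cong_AE) (use null_preserving_AE[OF null_preserving_fst ae] in auto)
  also have "\<dots> = (\<integral>\<^sup>+(x, y). k (x - y) * g x \<partial>(lborel \<Otimes>\<^sub>M lborel))"
    by (simp add: nn_integral_completion lborel_prod case_prod_beta')
  also have "\<dots> = (\<integral>\<^sup>+x. \<integral>\<^sup>+y. k (x - y) * g x \<partial>lborel \<partial>lborel)"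
    by (subst lborel.nn_integral_fst[symmetric]) (auto simp: split_beta')
  also have "\<dots> = (\<integral>\<^sup>+x. (\<integral>\<^sup>+z. k z \<partial>lborel) * g x \<partial>lborel)"
    by (intro nn_integral_cong) (simp add: nn_integral_multc nn_integral_lborel_reflect)
  also have "\<dots> = (\<integral>\<^sup>+z. k z \<partial>lborel) * (\<integral>\<^sup>+y. g y \<partial>lborel)"
    by (simp add: nn_integral_cmult)
  finally show "(\<integral>\<^sup>+p. k (fst p - snd p) * f (fst p) \<partial>lebesgue) = (\<integral>\<^sup>+z. k z \<partial>lborel) * (\<integral>\<^sup>+y. f y \<partial>lebesgue)"
    by (simp add: fg)
qed

section \<open>The truncated kernel is integrable\<close>

text \<open>The kernel \<open>|z|\<^bsup>-n-2s\<^esup>\<close> with its singularity reduced by a factor \<open>|z|\<^sup>2\<close>. This factor comes from the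
  Lipschitz continuity of test functions, and from \<open>1 - cos \<theta> \<le> \<theta>\<^sup>2 / 2\<close> for the magnetic phase \<open>\<theta>\<close>.\<close>

definition trunc_kernel :: "real \<Rightarrow> real^'n \<Rightarrow> real" where
  "trunc_kernel s z = min 1 ((norm z)\<^sup>2) / norm z powr (real CARD('n) + 2 * s)"

lemma trunc_kernel_nonneg: "trunc_kernel s z \<ge> 0"
  by (simp add: trunc_kernel_def)

lemma trunc_kernel_measurable[measurable]: "trunc_kernel s \<in> borel_measurable borel"
  unfolding trunc_kernel_def by measurable

text \<open>Dyadic decomposition. The shell \<open>|z| \<approx> 2\<^bsup>-j\<^esup>\<close> contributes a multiple of \<open>2\<^bsup>-j(2-2s)\<^esup>\<close> and the shell
  \<open>|z| \<approx> 2\<^bsup>j\<^esup>\<close> a multiple of \<open>2\<^bsup>-2sj\<^esup>\<close>; both geometric series converge as \<open>0 < s < 1\<close>.\<close>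

lemma trunc_kernel_integrable:
  assumes s: "0 < s" "s < 1"
  shows "(\<integral>\<^sup>+z. ennreal (trunc_kernel s (z :: real^'n)) \<partial>lborel) < \<infinity>"
proof -
  define N where "N = real CARD('n)"
  define V where "V = unit_ball_vol N"
  \<comment> \<open>bounds for the kernel on the shells inside and outside the unit ball\<close>
  define c1 where "c1 j = (2::real) powr (N + 2 * s) * (1/2) powr (real j * (2 - N - 2 * s))" for j :: nat
  define c2 where "c2 j = (1/2::real) powr (real j * (N + 2 * s))" for j :: nat
  define F where "F j z = ennreal (c1 j) * indicator (cball (0::real^'n) ((1/2)^j)) z
      + ennreal (c2 j) * indicator (cball (0::real^'n) (2^Suc j)) z" for j z
  have [measurable]: "cball (0::real^'n) r \<in> sets borel" for r by simp
  have F[measurable]: "F j \<in> borel_measurable borel" for j unfolding F_def by measurable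
  have half: "(1/2::real) powr x = 2 powr (- x)" for x
    by (simp add: powr_divide powr_minus_divide)
  have bound: "ennreal (trunc_kernel s z) \<le> (\<Sum>j. F j z)" for z :: "real^'n"
  proof (cases "z = 0")
    case False
    define t where "t = norm z"
    have t: "t > 0" using False by (simp add: t_def)
    have "\<exists>j. ennreal (trunc_kernel s z) \<le> F j z"
    proof (cases "t \<le> 1")
      case True
      define j where "j = nat \<lfloor>log (1/2) t\<rfloor>"
      have lg: "log (1/2) t \<ge> 0" using t True by (simp add: log_def ln_div divide_nonpos_pos)
      have j: "real j \<le> log (1/2) t" "log (1/2) t < real j + 1"
        using lg by (auto simp: j_def)
      have tp: "t = (1/2) powr (log (1/2) t)" using t by simp
      have le: "t \<le> (1/2)^j" 
        using powr_mono'[OF j(1), of "1/2"] tp by (simp add: powr_realpow)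
      have ge: "t \<ge> (1/2)^Suc j"
        using powr_mono'[OF less_imp_le[OF j(2)], of "1/2"] tp by (simp add: powr_add powr_realpow)
      have "trunc_kernel s z = t\<^sup>2 / t powr (N + 2 * s)"
        using True t by (simp add: trunc_kernel_def t_def N_def min_absorb2 power_le_one)
      also have "\<dots> \<le> ((1/2)^j)\<^sup>2 / ((1/2)^Suc j) powr (N + 2 * s)"
        using t le ge s by (intro frac_le power_mono powr_mono2) (auto simp: N_def)
      also have "((1/2::real)^j)\<^sup>2 = (1/2) powr (real j * 2)"
        by (simp add: powr_realpow[symmetric] powr_powr flip: power_mult)
      also have "((1/2::real)^Suc j) powr (N + 2 * s) = (1/2) powr (real (Suc j) * (N + 2 * s))"
        by (subst powr_realpow[symmetric]) (auto simp: powr_powr)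
      also have "(1/2::real) powr (real j * 2) / (1/2) powr (real (Suc j) * (N + 2 * s)) = c1 j"
        unfolding c1_def half powr_diff[symmetric] powr_add[symmetric]
        by (rule arg_cong[where f="(powr) 2"]) (simp add: algebra_simps)
      finally have "trunc_kernel s z \<le> c1 j" .
      then have "ennreal (trunc_kernel s z) \<le> F j z"
        using le by (auto simp: F_def t_def indicator_def intro!: add_increasing2 ennreal_leI)
      then show ?thesis by blast
    next
      case False
      define j where "j = nat \<lfloor>log 2 t\<rfloor>"
      have lg: "log 2 t \<ge> 0" using False by simp
      have j: "real j \<le> log 2 t" "log 2 t < real j + 1"
        using lg by (auto simp: j_def)
      have tp: "t = 2 powr (log 2 t)" using t by simp
      have ge: "2^j \<le> t" 
        using powr_mono[OF j(1), of 2] tp by (simp add: powr_realpow)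
      have le: "t \<le> 2^Suc j"
        using powr_mono[OF less_imp_le[OF j(2)], of 2] tp by (simp add: powr_add powr_realpow)
      have "trunc_kernel s z \<le> 1 / t powr (N + 2 * s)"
        using t by (simp add: trunc_kernel_def t_def N_def divide_right_mono)
      also have "\<dots> \<le> 1 / (2^j) powr (N + 2 * s)"
        using t ge s by (intro frac_le powr_mono2) (auto simp: N_def)
      also have "(2^j::real) powr (N + 2 * s) = 2 powr (real j * (N + 2 * s))"
        by (subst powr_realpow[symmetric]) (auto simp: powr_powr)
      also have "1 / 2 powr (real j * (N + 2 * s)) = c2 j"
        by (simp add: c2_def powr_divide)
      finally have "trunc_kernel s z \<le> c2 j" .
      then have "ennreal (trunc_kernel s z) \<le> F j z"
        using le by (auto simp: F_def t_def indicator_def intro!: add_increasing ennreal_leI)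
      then show ?thesis by blast
    qed
    then obtain j where "ennreal (trunc_kernel s z) \<le> F j z" by blast
    also have "F j z \<le> (\<Sum>j. F j z)"
      using sum_le_suminf[of "\<lambda>j. F j z" "{j}"] by simp
    finally show ?thesis .
  qed (simp add: trunc_kernel_def)
  have cb: "emeasure lborel (cball (0::real^'n) r) = ennreal (V * r powr N)" if "r > 0" for r
    using that by (simp add: emeasure_cball V_def N_def powr_realpow)
  have V0: "V \<ge> 0" by (simp add: V_def N_def)
  define q1 where "q1 = (1/2::real) powr (2 - 2 * s)"
  define q2 where "q2 = (1/2::real) powr (2 * s)"
  have q: "0 \<le> q1" "q1 < 1" "0 \<le> q2" "q2 < 1"
    using s powr_less_mono'[of "1/2" 0 "2-2 * s"] powr_less_mono'[of "1/2" 0 "2 * s"] by (auto simp: q1_def q2_def)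
  have F_int: "(\<integral>\<^sup>+z. F j z \<partial>lborel) = ennreal (2 powr (N + 2 * s) * V * q1^j + V * 2 powr N * q2^j)" for j
  proof -
    have "(\<integral>\<^sup>+z. F j z \<partial>lborel) = ennreal (c1 j) * ennreal (V * ((1/2)^j) powr N) + ennreal (c2 j) * ennreal (V * (2^Suc j) powr N)"
      unfolding F_def by (subst nn_integral_add) (auto simp: nn_integral_cmult cb simp del: power_Suc)
    also have "\<dots> = ennreal (c1 j * (V * ((1/2)^j) powr N) + c2 j * (V * (2^Suc j) powr N))"
      using V0 by (simp add: c1_def c2_def ennreal_mult[symmetric] ennreal_plus[symmetric] del: ennreal_plus power_Suc)
    also have "c1 j * (V * ((1/2)^j) powr N) = 2 powr (N + 2 * s) * V * q1^j"
    proof -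
      have "(1/2::real) powr (real j * (2 - N - 2 * s)) * ((1/2)^j) powr N = q1 ^ j"
        unfolding q1_def
        by (simp add: powr_realpow[symmetric] powr_powr powr_add[symmetric] algebra_simps)
      then show ?thesis unfolding c1_def by (simp add: mult_ac)
    qed
    also have "c2 j * (V * (2^Suc j) powr N) = V * 2 powr N * q2^j"
    proof -
      have e: "(2^Suc j :: real) powr N = 2 powr N * (1/2) powr (- (real j * N))"
        by (simp add: powr_mult powr_realpow[symmetric] powr_powr powr_minus powr_divide)
      have "(1/2::real) powr (real j * (N + 2 * s)) * (1/2) powr (- (real j * N)) = q2 ^ j"
        unfolding q2_def
        by (simp add: powr_realpow[symmetric] powr_powr powr_add[symmetric] algebra_simps)
      then show ?thesis unfolding c2_def e by (simp add: mult_ac)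
    qed
    finally show ?thesis .
  qed
  have "(\<integral>\<^sup>+z. ennreal (trunc_kernel s (z :: real^'n)) \<partial>lborel) \<le> (\<integral>\<^sup>+z. (\<Sum>j. F j z) \<partial>lborel)"
    by (intro nn_integral_mono bound)
  also have "\<dots> = (\<Sum>j. ennreal (2 powr (N + 2 * s) * V * q1^j + V * 2 powr N * q2^j))"
    by (subst nn_integral_suminf) (auto simp: F_int)
  also have "\<dots> < \<infinity>"
  proof -
    have "summable (\<lambda>j. 2 powr (N + 2 * s) * V * q1^j + V * 2 powr N * q2^j)"
      using q by (intro summable_add summable_mult summable_geometric) auto
    then have "(\<Sum>j. ennreal (2 powr (N + 2 * s) * V * q1^j + V * 2 powr N * q2^j)) \<noteq> top"
      using V0 q by (intro ennreal_suminf_neq_top) auto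
    then show ?thesis by (simp add: top.not_eq_extremum)
  qed
  finally show ?thesis .
qed

lemma frac_const_pos: "0 < s \<Longrightarrow> s < 1 \<Longrightarrow> frac_const n s > 0"
proof -
  assume s: "0 < s" "s < 1"
  have "- s \<notin> \<int>\<^sub>\<le>\<^sub>0"
  proof
    assume "- s \<in> \<int>\<^sub>\<le>\<^sub>0"
    then obtain k :: nat where "- s = - of_nat k" by (auto elim!: nonpos_Ints_cases')
    then show False using s by auto
  qed
  then have "Gamma (- s) \<noteq> 0" by (simp add: Gamma_eq_zero_iff)
  moreover have "Gamma (real n / 2 + s) > 0" using s by (intro Gamma_real_pos) auto
  ultimately show ?thesis by (auto simp: frac_const_def)
qed

section \<open>Functions with vanishing integrals\<close>

text \<open>Open boxes are stable under intersection and generate the Borel sets, so the integral over every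
  Borel set vanishes.\<close>

lemma AE_zero_of_box_integrals:
  fixes h :: "'a::euclidean_space \<Rightarrow> real"
  assumes h: "integrable lborel h" and box: "\<And>a b. (LINT x:box a b|lborel. h x) = 0"
  shows "AE x in lborel. h x = 0"
proof (rule sigma_finite_measure.density_zero[OF sigma_finite_lborel h])
  have int: "integrable lborel (\<lambda>x. indicator A x *\<^sub>R h x)" if "A \<in> sets borel" for A
    using integrable_mult_indicator[OF _ h] that by simp
  have UNIV_0: "(LINT x|lborel. h x) = 0"
  proof -
    have "(\<lambda>m::nat. LINT x|lborel. indicator (box (- real m *\<^sub>R One) (real m *\<^sub>R One)) x *\<^sub>R h x) \<longlonglongrightarrow> (LINT x|lborel. h x)"
    proof (rule integral_dominated_convergence[where w="\<lambda>x. norm (h x)"])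
      show "AE x in lborel. (\<lambda>m. indicator (box (- real m *\<^sub>R One) (real m *\<^sub>R One)) x *\<^sub>R h x) \<longlonglongrightarrow> h x"
      proof (rule AE_I2)
        fix x :: 'a
        obtain m0 :: nat where m0: "real m0 > norm x" using reals_Archimedean2 by blast
        have "x \<in> box (- real m *\<^sub>R One) (real m *\<^sub>R One)" if "m \<ge> m0" for m
        proof -
          have "\<bar>x \<bullet> i\<bar> < real m" if "i \<in> Basis" for i
            using Basis_le_norm[OF that, of x] m0 \<open>m \<ge> m0\<close> by linarith
          then show ?thesis by (fastforce simp: mem_box abs_less_iff)
        qed
        then have "\<forall>\<^sub>F m in sequentially. indicator (box (- real m *\<^sub>R One) (real m *\<^sub>R One)) x *\<^sub>R h x = h x"
          by (auto simp: eventually_sequentially intro!: exI[of _ m0])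
        then show "(\<lambda>m. indicator (box (- real m *\<^sub>R One) (real m *\<^sub>R One)) x *\<^sub>R h x) \<longlonglongrightarrow> h x"
          by (rule tendsto_eventually)
      qed
    qed (use h in \<open>auto simp: indicator_def\<close>)
    moreover have "(LINT x|lborel. indicator (box (- real m *\<^sub>R One) (real m *\<^sub>R One)) x *\<^sub>R h x) = 0" for m :: nat
      using box[of "- real m *\<^sub>R One" "real m *\<^sub>R One"] by (simp add: set_lebesgue_integral_def)
    ultimately have "(\<lambda>m::nat. 0::real) \<longlonglongrightarrow> (LINT x|lborel. h x)" by simp
    then show ?thesis by (simp add: LIMSEQ_const_iff)
  qed
  fix A assume "A \<in> sets (lborel :: 'a measure)"
  then have A: "A \<in> sigma_sets UNIV (range (\<lambda>(a, b). box a b :: 'a set))"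
    using sets_lborel by (simp add: borel_eq_box)
  have IS: "Int_stable (range (\<lambda>(a, b). box a b :: 'a set))"
    by (auto simp: Int_stable_def box_Int_box)
  show "(LINT x:A|lborel. h x) = 0"
  proof (rule sigma_sets_induct_disjoint[OF IS _ A, where P="\<lambda>A. (LINT x:A|lborel. h x) = 0"])
    fix B assume "B \<in> range (\<lambda>(a, b). box a b :: 'a set)"
    then show "(LINT x:B|lborel. h x) = 0" using box by auto
  next
    show "(LINT x:{}|lborel. h x) = 0" by (simp add: set_lebesgue_integral_def)
  next
    fix B assume B: "B \<in> sigma_sets UNIV (range (\<lambda>(a, b). box a b :: 'a set))" "(LINT x:B|lborel. h x) = 0"
    have Bb: "B \<in> sets borel" using B by (simp add: borel_eq_box)
    have "(LINT x:UNIV - B|lborel. h x) = (LINT x|lborel. h x - indicator B x *\<^sub>R h x)"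
      unfolding set_lebesgue_integral_def by (intro Bochner_Integration.integral_cong) (auto simp: indicator_def)
    also have "\<dots> = 0" using B UNIV_0 h int[OF Bb] by (simp add: set_lebesgue_integral_def)
    finally show "(LINT x:UNIV - B|lborel. h x) = 0" .
  next
    fix B :: "nat \<Rightarrow> 'a set"
    assume *: "disjoint_family B" "range B \<subseteq> sigma_sets UNIV (range (\<lambda>(a, b). box a b :: 'a set))"
      "\<And>i. (LINT x:B i|lborel. h x) = 0"
    have B: "B i \<in> sets lborel" for i using * by (auto simp: borel_eq_box)
    have "set_integrable lborel (\<Union>i. B i) h"
      unfolding set_integrable_def by (rule int) (use B in auto)
    then have "(LINT x:(\<Union>i. B i)|lborel. h x) = (\<Sum>i. (LINT x:(B i)|lborel. h x))"
      using * B by (intro lebesgue_integral_countable_add) (auto simp: disjoint_family_on_def)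
    then show "(LINT x:(\<Union>i. B i)|lborel. h x) = 0" using * by simp
  qed auto
qed

text \<open>The fundamental lemma of the calculus of variations, with the plateau functions as test functions:
  by dominated convergence they reduce it to integrals over boxes.\<close>

lemma AE_zero_of_plateau_integrals:
  fixes h :: "real^'n \<Rightarrow> real"
  assumes h: "integrable lebesgue h"
    and 0: "\<And>a b m. cbox a b \<subseteq> cbox p q \<Longrightarrow> (LINT x|lebesgue. h x * plateau m a b x) = 0"
  shows "AE x in lebesgue. x \<in> box p q \<longrightarrow> h x = 0"
proof -
  note hm = borel_measurable_integrable[OF h]
  obtain g where g: "g \<in> borel_measurable lborel" "AE x in lborel. h x = g x"
    using completion_ex_borel_measurable_real[OF hm] by blast
  have gb[measurable]: "g \<in> borel_measurable borel" using g by simp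
  note [measurable] = plateau_measurable
  have ae: "AE x in lebesgue. h x = g x" using g by (simp add: AE_completion_iff)
  have "integrable lebesgue g"
    using h ae g by (subst integrable_cong_AE[of _ _ h]) (auto simp: measurable_completion)
  then have g_int: "integrable lborel g" using g by (simp add: integrable_completion)
  have sub: "(LINT x:box a b|lborel. g x) = 0" if ab: "box a b \<subseteq> box p q" for a b
  proof (cases "box a b = {}")
    case False
    have sub: "cbox a b \<subseteq> cbox p q"
      using closure_mono[OF ab] False ab by (metis closure_box subset_empty)
    have "(\<lambda>m. LINT x|lborel. g x * plateau m a b x) \<longlonglongrightarrow> (LINT x|lborel. g x * indicator (box a b) x)"
    proof (rule integral_dominated_convergence[where w="\<lambda>x. norm (g x)"])
      show "AE x in lborel. (\<lambda>m. g x * plateau m a b x) \<longlonglongrightarrow> g x * indicator (box a b) x"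
        by (intro AE_I2 tendsto_mult tendsto_const plateau_tendsto)
      show "AE x in lborel. norm (g x * plateau m a b x) \<le> norm (g x)" for m
        by (rule AE_I2) (simp add: abs_mult mult_left_le plateau_abs_le)
    qed (use g_int in auto)
    moreover have "(LINT x|lborel. g x * plateau m a b x) = 0" for m
    proof -
      have "(LINT x|lborel. g x * plateau m a b x) = (LINT x|lebesgue. g x * plateau m a b x)"
        by (rule integral_completion[symmetric]) simp
      also have "\<dots> = (LINT x|lebesgue. h x * plateau m a b x)"
        by (intro integral_cong_AE borel_measurable_times hm measurable_lebesgueI gb plateau_measurable)
           (use ae in eventually_elim, simp)
      finally show ?thesis using 0[OF sub] by simp
    qed
    ultimately have "(\<lambda>m::nat. 0::real) \<longlonglongrightarrow> (LINT x|lborel. g x * indicator (box a b) x)" by simp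
    then have "(LINT x|lborel. g x * indicator (box a b) x) = 0" by (simp add: LIMSEQ_const_iff)
    then show ?thesis by (simp add: set_lebesgue_integral_def mult.commute)
  qed (simp add: set_lebesgue_integral_def)
  have "AE x in lborel. indicator (box p q) x * g x = 0"
  proof (rule AE_zero_of_box_integrals)
    show "integrable lborel (\<lambda>x. indicator (box p q) x * g x)"
      using integrable_mult_indicator[OF _ g_int, of "box p q"] by simp
    fix a b :: "real^'n"
    obtain c d where cd: "box a b \<inter> box p q = box c d" using box_Int_box by blast
    have "(LINT x:box a b|lborel. indicator (box p q) x * g x) = (LINT x:box c d|lborel. g x)"
      unfolding set_lebesgue_integral_def cd[symmetric] by (simp add: indicator_inter_arith mult.assoc)
    also have "\<dots> = 0" using cd by (intro sub) auto
    finally show "(LINT x:box a b|lborel. indicator (box p q) x * g x) = 0" .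
  qed
  then have "AE x in lebesgue. indicator (box p q) x * g x = 0" by (simp add: AE_completion_iff)
  with ae show ?thesis by eventually_elim (auto simp: indicator_def split: if_splits)
qed

lemma continuous_AE_le:
  fixes f :: "'a::euclidean_space \<Rightarrow> real"
  assumes U: "open U" and f: "continuous_on U f" and ae: "AE x in lebesgue. x \<in> U \<longrightarrow> f x \<le> c" and x: "x \<in> U"
  shows "f x \<le> c"
proof (rule ccontr)
  assume "\<not> f x \<le> c"
  define V where "V = U \<inter> f -` {c<..}"
  have oV: "open V" unfolding V_def by (rule continuous_open_preimage[OF f U]) auto
  have "AE x in lebesgue. x \<notin> V" using ae by eventually_elim (auto simp: V_def)
  then have "negligible V"
    unfolding negligible_iff_null_sets using oV by (subst AE_iff_null_sets) auto
  moreover have "V \<noteq> {}" using x \<open>\<not> f x \<le> c\<close> by (auto simp: V_def)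
  ultimately show False using oV open_not_negligible by blast
qed

lemma norm_mult_le_on:
  fixes w f :: "'a \<Rightarrow> real"
  assumes "\<And>x. x \<notin> K \<Longrightarrow> w x = 0" "\<And>x. x \<in> K \<Longrightarrow> \<bar>f x\<bar> \<le> C"
  shows "norm (w x * f x) \<le> C * norm (w x)"
proof (cases "x \<in> K")
  case True
  have "\<bar>f x\<bar> * \<bar>w x\<bar> \<le> C * \<bar>w x\<bar>" by (intro mult_right_mono assms(2) True) simp
  then show ?thesis by (simp add: abs_mult mult.commute)
qed (simp add: assms(1))

lemma integrable_mult_bounded_on:
  fixes w f :: "'a \<Rightarrow> real"
  assumes w: "integrable M w" and f: "f \<in> borel_measurable M"
    and 0: "\<And>x. x \<notin> K \<Longrightarrow> w x = 0" and C: "\<And>x. x \<in> K \<Longrightarrow> \<bar>f x\<bar> \<le> C"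
  shows "integrable M (\<lambda>x. w x * f x)"
proof (rule Bochner_Integration.integrable_bound)
  show "integrable M (\<lambda>x. C * norm (w x))" using w by simp
  show "(\<lambda>x. w x * f x) \<in> borel_measurable M" using w f by measurable
  show "AE x in M. norm (w x * f x) \<le> norm (C * norm (w x))"
    by (intro AE_I2 order_trans[OF norm_mult_le_on[OF 0 C]]) auto
qed

section \<open>Almost everywhere limits\<close>

text \<open>For the differences \<open>d\<^sub>k\<close> of consecutive terms, the sum of \<open>2\<^sup>k d\<^sub>k\<^sup>2\<close> has a finite integral, hence is
  finite almost everywhere, and there \<open>2 |d\<^sub>k| \<le> 2\<^sup>k d\<^sub>k\<^sup>2 + 2\<^bsup>-k\<^esup>\<close> makes the differences summable.\<close>

lemma fast_Cauchy_AE_limit: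
  fixes f :: "nat \<Rightarrow> 'a \<Rightarrow> real"
  assumes f[measurable]: "\<And>k. f k \<in> borel_measurable M"
    and fast: "\<And>k. (\<integral>\<^sup>+x. ennreal ((f (Suc k) x - f k x)\<^sup>2) \<partial>M) \<le> ennreal ((1/4)^k)"
  obtains F where "F \<in> borel_measurable M" "AE x in M. (\<lambda>k. f k x) \<longlonglongrightarrow> F x"
proof -
  define d where "d k x = f (Suc k) x - f k x" for k x
  have [measurable]: "d k \<in> borel_measurable M" for k unfolding d_def by measurable
  have "(\<integral>\<^sup>+x. (\<Sum>k. ennreal (2^k * (d k x)\<^sup>2)) \<partial>M) = (\<Sum>k. \<integral>\<^sup>+x. ennreal (2^k * (d k x)\<^sup>2) \<partial>M)"
    by (rule nn_integral_suminf) measurable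
  also have "\<dots> \<le> (\<Sum>k. ennreal ((1/2)^k))"
  proof (rule suminf_le)
    fix k
    have "(\<integral>\<^sup>+x. ennreal (2^k * (d k x)\<^sup>2) \<partial>M) = ennreal (2^k) * (\<integral>\<^sup>+x. ennreal ((d k x)\<^sup>2) \<partial>M)"
      by (subst nn_integral_cmult[symmetric]) (auto simp: ennreal_mult)
    also have "\<dots> \<le> ennreal (2^k) * ennreal ((1/4)^k)"
      using fast[of k] by (intro mult_left_mono) (auto simp: d_def)
    also have "\<dots> = ennreal ((1/2)^k)"
      by (simp add: ennreal_mult[symmetric] power_mult_distrib[symmetric])
    finally show "(\<integral>\<^sup>+x. ennreal (2^k * (d k x)\<^sup>2) \<partial>M) \<le> ennreal ((1/2)^k)" .
  qed auto
  also have "\<dots> < top"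
    unfolding top.not_eq_extremum[symmetric]
    by (rule ennreal_suminf_neq_top[OF summable_geometric]) auto
  finally have "(\<integral>\<^sup>+x. (\<Sum>k. ennreal (2^k * (d k x)\<^sup>2)) \<partial>M) \<noteq> top"
    by simp
  then have fin: "AE x in M. (\<Sum>k. ennreal (2^k * (d k x)\<^sup>2)) \<noteq> top"
    by (intro nn_integral_PInf_AE[unfolded infinity_ennreal_def]) auto
  have conv: "convergent (\<lambda>k. f k x)" if "(\<Sum>k. ennreal (2^k * (d k x)\<^sup>2)) \<noteq> top" for x
  proof -
    have 1: "summable (\<lambda>k. 2^k * (d k x)\<^sup>2)"
      using that by (intro summable_suminf_not_top) auto
    have 2: "summable (\<lambda>k. (1/2::real)^k)" by (rule summable_geometric) auto
    have "summable (\<lambda>k. d k x)"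
    proof (rule summable_comparison_test[OF _ summable_mult[OF summable_add[OF 1 2], of "1/2"]])
      have "\<bar>d k x\<bar> \<le> 1/2 * (2^k * (d k x)\<^sup>2 + (1/2)^k)" for k
      proof -
        define r where "r = (2::real)^k"
        have r: "r > 0" by (simp add: r_def)
        have "0 \<le> (r * \<bar>d k x\<bar> - 1)\<^sup>2" by simp
        then have "2 * (r * \<bar>d k x\<bar>) \<le> r * (r * (d k x)\<^sup>2) + r * (1 / r)"
          using r by (simp add: power2_eq_square algebra_simps)
        then have "r * (2 * \<bar>d k x\<bar>) \<le> r * (r * (d k x)\<^sup>2 + 1 / r)" by (simp add: algebra_simps)
        then have "2 * \<bar>d k x\<bar> \<le> r * (d k x)\<^sup>2 + 1 / r" using r by (simp only: mult_le_cancel_left_pos)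
        then show ?thesis by (simp add: r_def power_one_over)
      qed
      then show "\<exists>N. \<forall>k\<ge>N. norm (d k x) \<le> 1/2 * (2^k * (d k x)\<^sup>2 + (1/2)^k)" by auto
    qed
    then have "convergent (\<lambda>m. \<Sum>k<m. d k x)" by (simp add: summable_iff_convergent)
    moreover have "(\<Sum>k<m. d k x) = f m x - f 0 x" for m
      unfolding d_def by (rule sum_lessThan_telescope)
    ultimately have "convergent (\<lambda>m. (f m x - f 0 x) + f 0 x)"
      by (intro convergent_add convergent_const) simp
    then show ?thesis by simp
  qed
  show ?thesis
  proof
    show "(\<lambda>x. lim (\<lambda>k. f k x)) \<in> borel_measurable M" by measurable
    show "AE x in M. (\<lambda>k. f k x) \<longlonglongrightarrow> lim (\<lambda>k. f k x)"
      using fin by eventually_elim (use conv in \<open>auto simp: convergent_LIMSEQ_iff\<close>)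
  qed
qed

lemma nn_integral_limit_le:
  fixes f :: "nat \<Rightarrow> 'a \<Rightarrow> real"
  assumes [measurable]: "\<And>k. f k \<in> borel_measurable M" "F \<in> borel_measurable M" "c \<in> borel_measurable M"
    and lim: "AE x in M. (\<lambda>k. f k x) \<longlonglongrightarrow> F x"
    and le: "\<And>k. k \<ge> N \<Longrightarrow> (\<integral>\<^sup>+x. ennreal ((f k x - c x)\<^sup>2) \<partial>M) \<le> B"
  shows "(\<integral>\<^sup>+x. ennreal ((F x - c x)\<^sup>2) \<partial>M) \<le> B"
proof -
  have "(\<integral>\<^sup>+x. ennreal ((F x - c x)\<^sup>2) \<partial>M) = (\<integral>\<^sup>+x. liminf (\<lambda>k. ennreal ((f k x - c x)\<^sup>2)) \<partial>M)"
  proof (rule nn_integral_cong_AE)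
    show "AE x in M. ennreal ((F x - c x)\<^sup>2) = liminf (\<lambda>k. ennreal ((f k x - c x)\<^sup>2))"
      using lim
    proof eventually_elim
      case (elim x)
      then have "(\<lambda>k. ennreal ((f k x - c x)\<^sup>2)) \<longlonglongrightarrow> ennreal ((F x - c x)\<^sup>2)"
        by (intro tendsto_ennrealI tendsto_intros)
      from lim_imp_Liminf[OF _ this] show ?case by simp
    qed
  qed
  also have "\<dots> \<le> liminf (\<lambda>k. \<integral>\<^sup>+x. ennreal ((f k x - c x)\<^sup>2) \<partial>M)"
    by (rule nn_integral_liminf) measurable
  also have "\<dots> \<le> B"
    by (rule order_trans[OF Liminf_le_Limsup Limsup_bounded])
       (auto simp: eventually_sequentially intro!: exI[of _ N] le)
  finally show ?thesis .
qed

section \<open>The fractional Sobolev space\<close>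

definition gagl :: "real \<Rightarrow> (real^'n \<Rightarrow> real) \<Rightarrow> (real^'n) \<times> (real^'n) \<Rightarrow> real" where
  "gagl s u p = (u (fst p) - u (snd p))\<^sup>2 / norm (fst p - snd p) powr (real CARD('n) + 2 * s)"

lemma gagl_nonneg: "gagl s u p \<ge> 0"
  by (simp add: gagl_def)

lemma measurable_pair_diff:
  "f \<in> borel_measurable borel \<Longrightarrow> (\<lambda>p. f (fst p - snd p)) \<in> borel_measurable (lebesgue :: ('a::euclidean_space \<times> 'a) measure)"
proof -
  assume f: "f \<in> borel_measurable borel"
  have "(\<lambda>p::'a \<times> 'a. fst p - snd p) \<in> borel_measurable borel"
    by (intro borel_measurable_continuous_onI continuous_intros)
  from measurable_compose[OF this f] show ?thesis by (rule measurable_lebesgueI)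
qed

lemma gagl_measurable:
  fixes u :: "real^'n \<Rightarrow> real"
  assumes "u \<in> borel_measurable lebesgue"
  shows "gagl s u \<in> borel_measurable lebesgue"
proof -
  have [measurable]: "(\<lambda>p :: (real^'n) \<times> (real^'n). norm (fst p - snd p) powr (real CARD('n) + 2 * s)) \<in> borel_measurable lebesgue"
    by (rule measurable_pair_diff) measurable
  note [measurable] = measurable_comp_fst_snd[OF assms]
  show ?thesis unfolding gagl_def by measurable
qed

lemma HsD:
  assumes "u \<in> Hs s"
  shows "u \<in> borel_measurable lebesgue" "integrable lebesgue (\<lambda>x. (u x)\<^sup>2)" "integrable lebesgue (gagl s u)"
  using assms unfolding Hs_def gagl_def by (auto simp: case_prod_beta')

lemma HsI:
  assumes "u \<in> borel_measurable lebesgue" "integrable lebesgue (\<lambda>x. (u x)\<^sup>2)" "integrable lebesgue (gagl s u)"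
  shows "u \<in> Hs s"
  using assms unfolding Hs_def gagl_def by (auto simp: case_prod_beta')

definition Hs_sq :: "real \<Rightarrow> (real^'n \<Rightarrow> real) \<Rightarrow> real" where
  "Hs_sq s u = (\<integral>x. (u x)\<^sup>2 \<partial>lebesgue) + (\<integral>p. gagl s u p \<partial>lebesgue)"

lemma Hs_sq_parts: "(\<integral>x. (u x)\<^sup>2 \<partial>lebesgue) \<ge> 0" "(\<integral>p. gagl s u p \<partial>lebesgue) \<ge> 0"
  by (auto intro!: Bochner_Integration.integral_nonneg gagl_nonneg)

lemma Hs_norm_eq: "Hs_norm s u = sqrt (Hs_sq s u)"
  unfolding Hs_norm_def Hs_sq_def gagl_def by (simp add: case_prod_beta')

lemma square_lincomb_le: "(\<alpha> * a + \<beta> * b)\<^sup>2 \<le> 2 * \<alpha>\<^sup>2 * a\<^sup>2 + 2 * \<beta>\<^sup>2 * (b::real)\<^sup>2"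
  using zero_le_power2[of "\<alpha> * a - \<beta> * b"] by (simp add: power2_eq_square algebra_simps)

lemma gagl_lincomb_le: "gagl s (\<lambda>x. \<alpha> * u x + \<beta> * v x) p \<le> 2 * \<alpha>\<^sup>2 * gagl s u p + 2 * \<beta>\<^sup>2 * gagl s v p"
proof -
  have e: "\<alpha> * u (fst p) + \<beta> * v (fst p) - (\<alpha> * u (snd p) + \<beta> * v (snd p))
    = \<alpha> * (u (fst p) - u (snd p)) + \<beta> * (v (fst p) - v (snd p))" by (simp add: algebra_simps)
  show ?thesis
    unfolding gagl_def e
    using divide_right_mono[OF square_lincomb_le[of \<alpha> "u (fst p) - u (snd p)" \<beta> "v (fst p) - v (snd p)"],
      of "norm (fst p - snd p) powr (real CARD('b) + 2 * s)"]
    by (simp add: add_divide_distrib)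
qed

lemma Hs_lincomb:
  assumes u: "u \<in> Hs s" and v: "v \<in> Hs s"
  shows "(\<lambda>x. \<alpha> * u x + \<beta> * v x) \<in> Hs s"
    and "Hs_sq s (\<lambda>x. \<alpha> * u x + \<beta> * v x) \<le> 2 * \<alpha>\<^sup>2 * Hs_sq s u + 2 * \<beta>\<^sup>2 * Hs_sq s v"
proof -
  note u' = HsD[OF u] and v' = HsD[OF v]
  note [measurable] = u'(1) v'(1)
  have m: "(\<lambda>x. \<alpha> * u x + \<beta> * v x) \<in> borel_measurable lebesgue" by measurable
  have i1: "integrable lebesgue (\<lambda>x. 2 * \<alpha>\<^sup>2 * (u x)\<^sup>2 + 2 * \<beta>\<^sup>2 * (v x)\<^sup>2)"
    using u' v' by (intro Bochner_Integration.integrable_add integrable_mult_right)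
  have i2: "integrable lebesgue (\<lambda>p. 2 * \<alpha>\<^sup>2 * gagl s u p + 2 * \<beta>\<^sup>2 * gagl s v p)"
    using u' v' by (intro Bochner_Integration.integrable_add integrable_mult_right)
  have j1: "integrable lebesgue (\<lambda>x. (\<alpha> * u x + \<beta> * v x)\<^sup>2)"
    by (rule Bochner_Integration.integrable_bound[OF i1])
       (auto intro!: AE_I2 order_trans[OF square_lincomb_le])
  have j2: "integrable lebesgue (gagl s (\<lambda>x. \<alpha> * u x + \<beta> * v x))"
  proof (rule Bochner_Integration.integrable_bound[OF i2 gagl_measurable[OF m]], rule AE_I2)
    fix p
    show "norm (gagl s (\<lambda>x. \<alpha> * u x + \<beta> * v x) p) \<le> norm (2 * \<alpha>\<^sup>2 * gagl s u p + 2 * \<beta>\<^sup>2 * gagl s v p)"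
      using gagl_lincomb_le[of s \<alpha> u \<beta> v p] gagl_nonneg[of s "\<lambda>x. \<alpha> * u x + \<beta> * v x" p]
      unfolding real_norm_def by linarith
  qed
  show "(\<lambda>x. \<alpha> * u x + \<beta> * v x) \<in> Hs s" by (rule HsI[OF m j1 j2])
  have "(\<integral>x. (\<alpha> * u x + \<beta> * v x)\<^sup>2 \<partial>lebesgue) \<le> (\<integral>x. 2 * \<alpha>\<^sup>2 * (u x)\<^sup>2 + 2 * \<beta>\<^sup>2 * (v x)\<^sup>2 \<partial>lebesgue)"
    by (rule integral_mono[OF j1 i1 square_lincomb_le])
  moreover have "(\<integral>p. gagl s (\<lambda>x. \<alpha> * u x + \<beta> * v x) p \<partial>lebesgue) \<le> (\<integral>p. 2 * \<alpha>\<^sup>2 * gagl s u p + 2 * \<beta>\<^sup>2 * gagl s v p \<partial>lebesgue)"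
    by (rule integral_mono[OF j2 i2 gagl_lincomb_le])
  ultimately show "Hs_sq s (\<lambda>x. \<alpha> * u x + \<beta> * v x) \<le> 2 * \<alpha>\<^sup>2 * Hs_sq s u + 2 * \<beta>\<^sup>2 * Hs_sq s v"
    using u' v' by (simp add: Hs_sq_def algebra_simps)
qed

lemma Hs_diff: "u \<in> Hs s \<Longrightarrow> v \<in> Hs s \<Longrightarrow> (\<lambda>x. u x - v x) \<in> Hs s"
  using Hs_lincomb(1)[of u s v 1 "-1"] by simp

lemma Hs_add: "u \<in> Hs s \<Longrightarrow> v \<in> Hs s \<Longrightarrow> (\<lambda>x. u x + v x) \<in> Hs s"
  using Hs_lincomb(1)[of u s v 1 1] by simp

text \<open>A test function is bounded and Lipschitz continuous, so the Gagliardo integrand is dominated by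
  the truncated kernel, and it vanishes unless one of the two points lies in the support.\<close>

lemma test_functions_Hs:
  fixes \<phi> :: "real^'n \<Rightarrow> real"
  assumes s: "0 < s" "s < 1" and \<phi>: "\<phi> \<in> test_functions U"
  shows "\<phi> \<in> Hs s"
proof -
  obtain K where K: "compact K" "K \<subseteq> U" "\<And>x. x \<notin> K \<Longrightarrow> \<phi> x = 0"
    using test_functions_compact[OF \<phi>] by blast
  obtain C where C: "\<And>x. \<bar>\<phi> x\<bar> \<le> C" using test_functions_bounded[OF \<phi>, of "[]"] by auto
  obtain L where L: "L \<ge> 0" "\<And>x y. \<bar>\<phi> x - \<phi> y\<bar> \<le> L * norm (x - y)"
    using test_functions_lipschitz[OF \<phi>] by blast
  have Kb[measurable]: "K \<in> sets borel" using K by (simp add: compact_imp_closed)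
  have Kfin: "emeasure lborel K < \<infinity>" using K emeasure_compact_finite by blast
  have m: "\<phi> \<in> borel_measurable lebesgue"
    by (intro measurable_lebesgueI borel_measurable_continuous_onI smooth_fun_continuous test_functions_smooth[OF \<phi>])
  have C2: "(\<phi> x)\<^sup>2 \<le> C\<^sup>2" for x using C[of x] by (metis abs_le_square_iff abs_of_nonneg abs_ge_zero order_trans)
  define D where "D = 4 * C\<^sup>2 + L\<^sup>2"
  have D0: "D \<ge> 0" by (simp add: D_def)
  have "(\<integral>\<^sup>+x. ennreal ((\<phi> x)\<^sup>2) \<partial>lebesgue) \<le> (\<integral>\<^sup>+x. ennreal (C\<^sup>2) * indicator K x \<partial>lebesgue)"
    by (rule nn_integral_mono) (use C2 K(3) in \<open>auto simp: indicator_def ennreal_leI\<close>)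
  also have "\<dots> = ennreal (C\<^sup>2) * emeasure lborel K"
    by (simp add: nn_integral_completion nn_integral_cmult_indicator)
  also have "\<dots> < \<infinity>" using Kfin by (simp add: ennreal_mult_less_top)
  finally have i1: "integrable lebesgue (\<lambda>x. (\<phi> x)\<^sup>2)"
    using m by (intro integrableI_nonneg) auto
  have pw: "gagl s \<phi> p \<le> D * (trunc_kernel s (fst p - snd p) * indicator K (fst p) + trunc_kernel s (fst p - snd p) * indicator K (snd p))" for p
  proof (cases "fst p \<in> K \<or> snd p \<in> K")
    case True
    define t where "t = norm (fst p - snd p)"
    have "(\<phi> (fst p) - \<phi> (snd p))\<^sup>2 \<le> D * min 1 (t\<^sup>2)"
    proof -
      have "(\<phi> (fst p) - \<phi> (snd p))\<^sup>2 \<le> 4 * C\<^sup>2"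
        using square_lincomb_le[of 1 "\<phi> (fst p)" "-1" "\<phi> (snd p)"] C2[of "fst p"] C2[of "snd p"] by simp
      moreover have "(\<phi> (fst p) - \<phi> (snd p))\<^sup>2 \<le> (L * t)\<^sup>2"
        using L(2)[of "fst p" "snd p"] unfolding t_def by (metis abs_ge_zero power2_abs power_mono)
      moreover have "4 * C\<^sup>2 \<le> D" "(L * t)\<^sup>2 \<le> D * t\<^sup>2"
        by (auto simp: D_def power_mult_distrib algebra_simps)
      ultimately show ?thesis by (auto simp: min_def)
    qed
    then have 1: "gagl s \<phi> p \<le> D * trunc_kernel s (fst p - snd p)"
      unfolding gagl_def trunc_kernel_def t_def by (simp add: divide_right_mono)
    also have "\<dots> \<le> D * (trunc_kernel s (fst p - snd p) * indicator K (fst p) + trunc_kernel s (fst p - snd p) * indicator K (snd p))"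
      using True D0 trunc_kernel_nonneg[of s "fst p - snd p"] by (intro mult_left_mono) (auto simp: indicator_def)
    finally show ?thesis .
  next
    case False
    then show ?thesis using K by (simp add: gagl_def)
  qed
  have "(indicator K :: real^'n \<Rightarrow> ennreal) \<in> borel_measurable lebesgue"
    by (rule measurable_lebesgueI) measurable
  note conv = nn_integral_convolution[OF _ this, of "\<lambda>z. ennreal (trunc_kernel s z)"]
  have fin: "(\<integral>\<^sup>+p. ennreal (trunc_kernel s (fst p - snd p)) * indicator K (fst p) \<partial>lebesgue) < \<infinity>"
    "(\<integral>\<^sup>+p. ennreal (trunc_kernel s (fst p - snd p)) * indicator K (snd p) \<partial>lebesgue) < \<infinity>"
    using conv trunc_kernel_integrable[OF s, where 'n='n] Kfin
    by (auto simp: nn_integral_completion ennreal_mult_less_top)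
  have km[measurable]: "(\<lambda>p. trunc_kernel s (fst p - snd p :: real^'n)) \<in> borel_measurable lebesgue"
    by (rule measurable_pair_diff) measurable
  have im[measurable]: "(\<lambda>p. indicator K (fst p) :: ennreal) \<in> borel_measurable (lebesgue :: ((real^'n) \<times> (real^'n)) measure)" "(\<lambda>p. indicator K (snd p) :: ennreal) \<in> borel_measurable (lebesgue :: ((real^'n) \<times> (real^'n)) measure)"
    by (rule measurable_comp_fst_snd; rule measurable_lebesgueI; measurable)+
  have "(\<integral>\<^sup>+p. ennreal (gagl s \<phi> p) \<partial>lebesgue) \<le> (\<integral>\<^sup>+p. ennreal D * (ennreal (trunc_kernel s (fst p - snd p)) * indicator K (fst p) + ennreal (trunc_kernel s (fst p - snd p)) * indicator K (snd p)) \<partial>lebesgue)"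
  proof (rule nn_integral_mono)
    fix p :: "(real^'n) \<times> (real^'n)"
    have "ennreal (gagl s \<phi> p) \<le> ennreal (D * (trunc_kernel s (fst p - snd p) * indicator K (fst p) + trunc_kernel s (fst p - snd p) * indicator K (snd p)))"
      by (rule ennreal_leI[OF pw])
    also have "\<dots> = ennreal D * (ennreal (trunc_kernel s (fst p - snd p)) * indicator K (fst p) + ennreal (trunc_kernel s (fst p - snd p)) * indicator K (snd p))"
      using D0 trunc_kernel_nonneg[of s "fst p - snd p"]
      by (auto simp: ennreal_mult indicator_def ennreal_plus[symmetric] simp del: ennreal_plus)
    finally show "ennreal (gagl s \<phi> p) \<le> \<dots>" .
  qed
  also have "\<dots> < \<infinity>"
    using fin by (subst nn_integral_cmult) (auto simp: nn_integral_add ennreal_mult_less_top)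
  finally have i2: "integrable lebesgue (gagl s \<phi>)"
    by (rule integrableI_nonneg[OF gagl_measurable[OF m] AE_I2[OF gagl_nonneg]])
  show ?thesis by (rule HsI[OF m i1 i2])
qed

text \<open>Both parts of the norm are \<open>L\<^sup>2\<close> norms, of \<open>u\<close> and of a multiple of \<open>u(x) - u(y)\<close>. Fatou's lemma along
  the almost everywhere limit bounds each of them.\<close>

lemma Hs_complete:
  fixes f :: "nat \<Rightarrow> real^'n \<Rightarrow> real"
  assumes f: "\<And>k. f k \<in> Hs s" and cauchy: "\<And>k l. k \<le> l \<Longrightarrow> Hs_sq s (\<lambda>x. f l x - f k x) \<le> (1/4)^k"
  obtains u where "u \<in> Hs s" "\<And>k. Hs_sq s (\<lambda>x. u x - f k x) \<le> 2 * (1/4)^k"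
proof -
  note fm = HsD(1)[OF f]
  have dH: "(\<lambda>x. f l x - f k x) \<in> Hs s" for k l using Hs_diff[OF f f] .
  have parts: "(\<integral>x. (f l x - f k x)\<^sup>2 \<partial>lebesgue) \<le> (1/4)^k"
    "(\<integral>p. gagl s (\<lambda>x. f l x - f k x) p \<partial>lebesgue) \<le> (1/4)^k" if "k \<le> l" for k l
    using cauchy[OF that] Hs_sq_parts(1)[of "\<lambda>x. f l x - f k x"] Hs_sq_parts(2)[of s "\<lambda>x. f l x - f k x"]
    unfolding Hs_sq_def by linarith+
  have nn1: "(\<integral>\<^sup>+x. ennreal ((f l x - f k x)\<^sup>2) \<partial>lebesgue) \<le> ennreal ((1/4)^k)" if "k \<le> l" for k l
    by (subst nn_integral_eq_integral[OF HsD(2)[OF dH]]) (auto intro!: ennreal_leI parts that)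
  have nn2: "(\<integral>\<^sup>+p. ennreal (gagl s (\<lambda>x. f l x - f k x) p) \<partial>lebesgue) \<le> ennreal ((1/4)^k)" if "k \<le> l" for k l
    by (subst nn_integral_eq_integral[OF HsD(3)[OF dH] AE_I2[OF gagl_nonneg]])
       (intro ennreal_leI parts that)
  obtain u where u: "u \<in> borel_measurable lebesgue" "AE x in lebesgue. (\<lambda>k. f k x) \<longlonglongrightarrow> u x"
    by (rule fast_Cauchy_AE_limit[of f lebesgue]) (use fm nn1 in auto)
  have le1: "(\<integral>\<^sup>+x. ennreal ((u x - f k x)\<^sup>2) \<partial>lebesgue) \<le> ennreal ((1/4)^k)" for k
    by (rule nn_integral_limit_le[of f lebesgue u "f k" k]) (use fm u nn1 in auto)
  \<comment> \<open>the weight that turns the Gagliardo integrand into a square\<close>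
  define W :: "(real^'n) \<times> (real^'n) \<Rightarrow> real" where "W p = sqrt (1 / norm (fst p - snd p) powr (real CARD('n) + 2 * s))" for p
  have Wm[measurable]: "W \<in> borel_measurable lebesgue"
    unfolding W_def by (rule measurable_pair_diff) measurable
  have gW: "gagl s (\<lambda>x. a x - b x) p = (((a (fst p) - a (snd p)) * W p) - ((b (fst p) - b (snd p)) * W p))\<^sup>2" for a b p
  proof -
    have "(((a (fst p) - a (snd p)) * W p) - ((b (fst p) - b (snd p)) * W p))\<^sup>2 = (a (fst p) - b (fst p) - (a (snd p) - b (snd p)))\<^sup>2 * (W p)\<^sup>2"
      by (simp add: power_mult_distrib[symmetric] algebra_simps)
    then show ?thesis by (simp add: gagl_def W_def)
  qed
  have pm: "(\<lambda>p. (a (fst p) - a (snd p)) * W p) \<in> borel_measurable lebesgue" if "a \<in> borel_measurable lebesgue" for a :: "real^'n \<Rightarrow> real"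
  proof -
    note [measurable] = measurable_comp_fst_snd[OF that]
    show ?thesis by measurable
  qed
  have le2: "(\<integral>\<^sup>+p. ennreal (gagl s (\<lambda>x. u x - f k x) p) \<partial>lebesgue) \<le> ennreal ((1/4)^k)" for k
    unfolding gW
  proof (rule nn_integral_limit_le[of "\<lambda>k p. (f k (fst p) - f k (snd p)) * W p" _ _ _ k])
    show "AE p in lebesgue. (\<lambda>k. (f k (fst p) - f k (snd p)) * W p) \<longlonglongrightarrow> (u (fst p) - u (snd p)) * W p"
      using null_preserving_AE[OF null_preserving_fst u(2)] null_preserving_AE[OF null_preserving_snd u(2)]
      by eventually_elim (intro tendsto_intros)
    show "(\<integral>\<^sup>+p. ennreal (((f l (fst p) - f l (snd p)) * W p - (f k (fst p) - f k (snd p)) * W p)\<^sup>2) \<partial>lebesgue) \<le> ennreal ((1/4)^k)" if "k \<le> l" for l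
      using nn2[OF that] unfolding gW .
  qed (use pm fm u in auto)
  have dm: "(\<lambda>x. u x - f k x) \<in> borel_measurable lebesgue" for k using u fm by auto
  have duH: "(\<lambda>x. u x - f k x) \<in> Hs s" for k
  proof (rule HsI[OF dm])
    show "integrable lebesgue (\<lambda>x. (u x - f k x)\<^sup>2)"
      using le1[of k] dm by (intro integrableI_nonneg) (auto intro: le_less_trans)
    show "integrable lebesgue (gagl s (\<lambda>x. u x - f k x))"
      by (rule integrableI_nonneg[OF gagl_measurable[OF dm] AE_I2[OF gagl_nonneg] le_less_trans[OF le2]]) simp
  qed
  show ?thesis
  proof
    show "u \<in> Hs s" using Hs_add[OF duH f, of 0 0] by simp
    fix k
    have "ennreal (\<integral>x. (u x - f k x)\<^sup>2 \<partial>lebesgue) \<le> ennreal ((1/4)^k)"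
      using le1[of k] HsD(2)[OF duH] by (subst nn_integral_eq_integral[symmetric]) auto
    moreover have "ennreal (\<integral>p. gagl s (\<lambda>x. u x - f k x) p \<partial>lebesgue) \<le> ennreal ((1/4)^k)"
      using le2[of k] by (subst nn_integral_eq_integral[OF HsD(3)[OF duH] AE_I2[OF gagl_nonneg], symmetric])
    ultimately show "Hs_sq s (\<lambda>x. u x - f k x) \<le> 2 * (1/4)^k"
      by (simp add: Hs_sq_def)
  qed
qed

lemma Hs_tilde_Hs: "u \<in> Hs_tilde s \<Omega> \<Longrightarrow> u \<in> Hs s"
  by (simp add: Hs_tilde_def)

lemma Hs_tilde_approx:
  assumes "u \<in> Hs_tilde s \<Omega>" "\<epsilon> > 0"
  obtains \<phi> where "\<phi> \<in> test_functions \<Omega>" "Hs_sq s (\<lambda>x. u x - \<phi> x) < \<epsilon>"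
proof -
  have "sqrt \<epsilon> > 0" using assms by simp
  then obtain \<phi> where "\<phi> \<in> test_functions \<Omega>" "Hs_norm s (\<lambda>x. u x - \<phi> x) < sqrt \<epsilon>"
    using assms unfolding Hs_tilde_def by blast
  then show ?thesis using that by (simp add: Hs_norm_eq)
qed

lemma Hs_tildeI:
  assumes "u \<in> Hs s" "\<And>\<epsilon>. \<epsilon> > 0 \<Longrightarrow> \<exists>\<phi>\<in>test_functions \<Omega>. Hs_sq s (\<lambda>x. u x - \<phi> x) < \<epsilon>"
  shows "u \<in> Hs_tilde s \<Omega>"
  unfolding Hs_tilde_def
proof safe
  fix \<epsilon> :: real assume "\<epsilon> > 0"
  then obtain \<phi> where "\<phi>\<in>test_functions \<Omega>" "Hs_sq s (\<lambda>x. u x - \<phi> x) < \<epsilon>\<^sup>2"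
    using assms(2)[of "\<epsilon>\<^sup>2"] by auto
  then show "\<exists>\<phi>\<in>test_functions \<Omega>. Hs_norm s (\<lambda>x. u x - \<phi> x) < \<epsilon>"
    using \<open>\<epsilon> > 0\<close> by (intro bexI[of _ \<phi>]) (auto simp: Hs_norm_eq intro: real_less_lsqrt)
qed fact

lemma test_functions_Hs_tilde:
  assumes "0 < s" "s < 1" "\<phi> \<in> test_functions \<Omega>"
  shows "\<phi> \<in> Hs_tilde s \<Omega>"
  by (rule Hs_tildeI[OF test_functions_Hs[OF assms]])
     (use assms(3) in \<open>auto simp: Hs_sq_def gagl_def intro!: bexI[of _ \<phi>]\<close>)

lemma Hs_tilde_lincomb:
  assumes s: "0 < s" "s < 1" and u: "u \<in> Hs_tilde s \<Omega>" and v: "v \<in> Hs_tilde s \<Omega>"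
  shows "(\<lambda>x. \<alpha> * u x + \<beta> * v x) \<in> Hs_tilde s \<Omega>"
proof (rule Hs_tildeI[OF Hs_lincomb(1)[OF Hs_tilde_Hs[OF u] Hs_tilde_Hs[OF v]]])
  fix \<epsilon> :: real assume e: "\<epsilon> > 0"
  define \<delta> where "\<delta> = \<epsilon> / (2 * \<alpha>\<^sup>2 + 2 * \<beta>\<^sup>2 + 1)"
  have pos: "2 * \<alpha>\<^sup>2 + 2 * \<beta>\<^sup>2 + 1 > 0" using zero_le_power2[of \<alpha>] zero_le_power2[of \<beta>] by linarith
  have d: "\<delta> > 0" using e pos by (simp add: \<delta>_def)
  obtain \<phi> where \<phi>: "\<phi> \<in> test_functions \<Omega>" "Hs_sq s (\<lambda>x. u x - \<phi> x) < \<delta>"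
    by (rule Hs_tilde_approx[OF u d])
  obtain \<psi> where \<psi>: "\<psi> \<in> test_functions \<Omega>" "Hs_sq s (\<lambda>x. v x - \<psi> x) < \<delta>"
    by (rule Hs_tilde_approx[OF v d])
  have H: "(\<lambda>x. u x - \<phi> x) \<in> Hs s" "(\<lambda>x. v x - \<psi> x) \<in> Hs s"
    using Hs_diff Hs_tilde_Hs u v test_functions_Hs[OF s] \<phi> \<psi> by blast+
  have e1: "(\<lambda>x. \<alpha> * u x + \<beta> * v x - (\<alpha> * \<phi> x + \<beta> * \<psi> x)) = (\<lambda>x. \<alpha> * (u x - \<phi> x) + \<beta> * (v x - \<psi> x))"
    by (auto simp: algebra_simps)
  have "Hs_sq s (\<lambda>x. \<alpha> * u x + \<beta> * v x - (\<alpha> * \<phi> x + \<beta> * \<psi> x)) \<le> 2 * \<alpha>\<^sup>2 * Hs_sq s (\<lambda>x. u x - \<phi> x) + 2 * \<beta>\<^sup>2 * Hs_sq s (\<lambda>x. v x - \<psi> x)"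
    unfolding e1 by (rule Hs_lincomb(2)[OF H])
  also have "\<dots> \<le> 2 * \<alpha>\<^sup>2 * \<delta> + 2 * \<beta>\<^sup>2 * \<delta>"
    using \<phi> \<psi> by (intro add_mono mult_left_mono) auto
  also have "\<dots> < (2 * \<alpha>\<^sup>2 + 2 * \<beta>\<^sup>2 + 1) * \<delta>" using d by (simp add: algebra_simps)
  also have "\<dots> = \<epsilon>" using pos by (simp add: \<delta>_def)
  finally have "Hs_sq s (\<lambda>x. \<alpha> * u x + \<beta> * v x - (\<alpha> * \<phi> x + \<beta> * \<psi> x)) < \<epsilon>" .
  then show "\<exists>\<phi>\<in>test_functions \<Omega>. Hs_sq s (\<lambda>x. \<alpha> * u x + \<beta> * v x - \<phi> x) < \<epsilon>"
    by (rule bexI[OF _ test_functions_lincomb[OF \<phi>(1) \<psi>(1)]])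
qed

lemma Hs_tilde_AE_zero:
  assumes s: "0 < s" "s < 1" and u: "u \<in> Hs_tilde s \<Omega>" and \<Omega>: "open \<Omega>"
  shows "AE x in lebesgue. x \<notin> \<Omega> \<longrightarrow> u x = 0"
proof -
  note uH = HsD[OF Hs_tilde_Hs[OF u]]
  have Om[measurable]: "- \<Omega> \<in> sets lebesgue" using \<Omega> by auto
  have i: "integrable lebesgue (\<lambda>x. (u x)\<^sup>2 * indicator (- \<Omega>) x)"
    using integrable_real_mult_indicator[OF Om uH(2)] .
  have "(\<integral>x. (u x)\<^sup>2 * indicator (- \<Omega>) x \<partial>lebesgue) \<le> 0"
  proof (rule field_le_epsilon)
    fix \<epsilon> :: real assume "\<epsilon> > 0"
    then obtain \<phi> where \<phi>: "\<phi> \<in> test_functions \<Omega>" "Hs_sq s (\<lambda>x. u x - \<phi> x) < \<epsilon>"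
      by (rule Hs_tilde_approx[OF u])
    have dH: "(\<lambda>x. u x - \<phi> x) \<in> Hs s" using Hs_diff Hs_tilde_Hs u test_functions_Hs[OF s] \<phi> by blast
    have "(\<integral>x. (u x)\<^sup>2 * indicator (- \<Omega>) x \<partial>lebesgue) \<le> (\<integral>x. (u x - \<phi> x)\<^sup>2 \<partial>lebesgue)"
      by (rule integral_mono[OF i HsD(2)[OF dH]])
         (use test_functions_off[OF \<phi>(1)] in \<open>auto simp: indicator_def\<close>)
    also have "\<dots> \<le> \<epsilon>" using \<phi>(2) Hs_sq_parts(2)[of s "\<lambda>x. u x - \<phi> x"] by (simp add: Hs_sq_def)
    finally show "(\<integral>x. (u x)\<^sup>2 * indicator (- \<Omega>) x \<partial>lebesgue) \<le> 0 + \<epsilon>" by simp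
  qed
  then have "(\<integral>x. (u x)\<^sup>2 * indicator (- \<Omega>) x \<partial>lebesgue) = 0"
    by (intro antisym Bochner_Integration.integral_nonneg) auto
  then have "AE x in lebesgue. (u x)\<^sup>2 * indicator (- \<Omega>) x = 0"
    using integral_nonneg_eq_0_iff_AE[OF i] by auto
  then show ?thesis by eventually_elim (auto simp: indicator_def)
qed

section \<open>The magnetic form\<close>

lemma one_minus_cos_le: "1 - cos t \<le> t\<^sup>2 / (2::real)"
proof -
  have "1 - cos t = 2 * (sin (t / 2))\<^sup>2" using cos_double_sin[of "t/2"] by simp
  also have "(sin (t / 2))\<^sup>2 \<le> (t / 2)\<^sup>2"
    using abs_sin_x_le_abs_x[of "t/2"] by (simp only: abs_le_square_iff)
  finally show ?thesis by (simp add: power2_eq_square)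
qed

lemma trunc_kernel_square_integrable:
  fixes u :: "real^'n \<Rightarrow> real"
  assumes s: "0 < s" "s < 1" and u: "u \<in> borel_measurable lebesgue" "integrable lebesgue (\<lambda>x. (u x)\<^sup>2)"
  shows "integrable lebesgue (\<lambda>p. trunc_kernel s (fst p - snd p) * (u (snd p))\<^sup>2)"
    and "(\<integral>p. trunc_kernel s (fst p - snd p) * (u (snd p))\<^sup>2 \<partial>lebesgue)
      = enn2real (\<integral>\<^sup>+z. ennreal (trunc_kernel s (z :: real^'n)) \<partial>lborel) * (\<integral>x. (u x)\<^sup>2 \<partial>lebesgue)"
proof -
  let ?k = "\<integral>\<^sup>+z. ennreal (trunc_kernel s (z :: real^'n)) \<partial>lborel"
  let ?f = "\<lambda>p. trunc_kernel s (fst p - snd p) * (u (snd p))\<^sup>2"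
  have [measurable]: "(\<lambda>p. trunc_kernel s (fst p - snd p :: real^'n)) \<in> borel_measurable lebesgue"
    by (rule measurable_pair_diff) measurable
  note [measurable] = u(1) measurable_comp_fst_snd[OF u(1)]
  have m: "?f \<in> borel_measurable lebesgue" by measurable
  have um: "(\<lambda>x. ennreal ((u x)\<^sup>2)) \<in> borel_measurable lebesgue" by measurable
  have "(\<integral>\<^sup>+p. ennreal (?f p) \<partial>lebesgue) = (\<integral>\<^sup>+p. ennreal (trunc_kernel s (fst p - snd p)) * ennreal ((u (snd p))\<^sup>2) \<partial>lebesgue)"
    by (intro nn_integral_cong) (simp add: ennreal_mult trunc_kernel_nonneg)
  also have "\<dots> = ?k * (\<integral>\<^sup>+x. ennreal ((u x)\<^sup>2) \<partial>lebesgue)"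
    by (rule nn_integral_convolution(1)[OF _ um]) measurable
  also have "(\<integral>\<^sup>+x. ennreal ((u x)\<^sup>2) \<partial>lebesgue) = ennreal (\<integral>x. (u x)\<^sup>2 \<partial>lebesgue)"
    by (rule nn_integral_eq_integral[OF u(2)]) auto
  also have "?k = ennreal (enn2real ?k)"
    using trunc_kernel_integrable[OF s, where 'n='n] by (simp add: less_top)
  also have "ennreal (enn2real ?k) * ennreal (\<integral>x. (u x)\<^sup>2 \<partial>lebesgue) = ennreal (enn2real ?k * (\<integral>x. (u x)\<^sup>2 \<partial>lebesgue))"
    by (simp add: ennreal_mult)
  finally have nn: "(\<integral>\<^sup>+p. ennreal (?f p) \<partial>lebesgue) = ennreal (enn2real ?k * (\<integral>x. (u x)\<^sup>2 \<partial>lebesgue))" .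
  have f0: "?f p \<ge> 0" for p by (simp add: trunc_kernel_nonneg)
  show i: "integrable lebesgue ?f"
    by (rule integrableI_nonneg[OF m AE_I2[OF f0]]) (simp add: nn)
  show "(\<integral>p. ?f p \<partial>lebesgue) = enn2real ?k * (\<integral>x. (u x)\<^sup>2 \<partial>lebesgue)"
    using nn unfolding nn_integral_eq_integral[OF i AE_I2[OF f0]]
    by (subst (asm) ennreal_inj) (auto intro!: Bochner_Integration.integral_nonneg f0)
qed

text \<open>The bound \<open>\<pi> / (8 r)\<close> for the length of the potential is what a bound \<open>\<pi> / (8 \<surd>n r)\<close> for each of its
  \<open>n\<close> components amounts to.\<close>

locale magnetic =
  fixes s r :: real and \<Omega> :: "(real^'n) set" and A :: "real^'n \<Rightarrow> real^'n"
  assumes s: "0 < s" "s < 1" and r: "r > 0" and \<Omega>: "open \<Omega>" "\<Omega> \<subseteq> ball 0 r"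
    and A_meas: "A \<in> borel_measurable lebesgue"
    and A_bound: "AE x in lebesgue. norm (A x) \<le> pi / (8 * r)"
    and A_supp: "AE x in lebesgue. x \<notin> ball 0 r \<longrightarrow> A x = 0"
begin

text \<open>A representative of the potential that is bounded, and supported in the ball, at every point.\<close>

definition A0 :: "real^'n \<Rightarrow> real^'n" where
  "A0 x = (if x \<in> ball 0 r \<and> norm (A x) \<le> pi / (8 * r) then A x else 0)"

definition phase :: "(real^'n) \<times> (real^'n) \<Rightarrow> real" where
  "phase p = (fst p - snd p) \<bullet> A0 (midpt p)"

definition kern :: "(real^'n) \<times> (real^'n) \<Rightarrow> real" where
  "kern p = frac_kernel s (fst p) (snd p)"

text \<open>The real part of the integrand of the magnetic form, see \<open>mag_form_eq\<close>.\<close>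

definition mag_density :: "(real^'n \<Rightarrow> real) \<Rightarrow> (real^'n \<Rightarrow> real) \<Rightarrow> (real^'n) \<times> (real^'n) \<Rightarrow> real" where
  "mag_density u v p = (u (fst p) * v (fst p) + u (snd p) * v (snd p)
     - cos (phase p) * (u (snd p) * v (fst p) + u (fst p) * v (snd p))) * kern p"

lemma A0_bound: "norm (A0 x) \<le> pi / (8 * r)"
  using r by (simp add: A0_def)

lemma A0_off: "x \<notin> ball 0 r \<Longrightarrow> A0 x = 0"
  by (simp add: A0_def)

lemma A0_meas: "A0 \<in> borel_measurable lebesgue"
proof -
  note [measurable] = A_meas
  have [measurable]: "ball (0::real^'n) r \<in> sets lebesgue" by auto
  show ?thesis unfolding A0_def by measurable
qed

lemma A0_AE: "AE x in lebesgue. A x = A0 x"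
  using A_bound A_supp by eventually_elim (auto simp: A0_def)

lemma phase_AE: "AE p in lebesgue. mag_phase A (fst p) (snd p) = phase p"
  using null_preserving_AE[OF null_preserving_midpt A0_AE]
  by eventually_elim (simp add: mag_phase_def phase_def midpt_def)

lemma phase_measurable: "phase \<in> borel_measurable lebesgue"
proof -
  note [measurable] = measurable_comp_fst_snd(3)[OF A0_meas]
  have [measurable]: "(\<lambda>p::(real^'n) \<times> (real^'n). fst p - snd p) \<in> borel_measurable lebesgue"
    by (rule measurable_pair_diff) simp
  show ?thesis unfolding phase_def by measurable
qed

lemma kern_measurable: "kern \<in> borel_measurable lebesgue"
  unfolding kern_def frac_kernel_def by (rule measurable_pair_diff) measurable

lemma kern_nonneg: "kern p \<ge> 0"
  using frac_const_pos[OF s, of "CARD('n)"] by (simp add: kern_def frac_kernel_def)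

lemma kern_pos: "fst p \<noteq> snd p \<Longrightarrow> kern p > 0"
  using frac_const_pos[OF s, of "CARD('n)"] by (simp add: kern_def frac_kernel_def)

lemma abs_phase_le: "\<bar>phase p\<bar> \<le> norm (fst p - snd p) * (pi / (8 * r))"
  unfolding phase_def using Cauchy_Schwarz_ineq2 A0_bound
  by (meson mult_left_mono norm_ge_zero order_trans)

text \<open>The phase vanishes unless the midpoint lies in the ball of radius \<open>r\<close>. In that case the two points
  have distance less than \<open>4 r\<close>, and the bound for the potential gives \<open>|\<theta>| \<le> 4 r \<pi> / (8 r) = \<pi> / 2\<close>.
  All positivity arguments rest on this.\<close>

lemma cos_phase_nonneg:
  assumes "fst p \<in> \<Omega> \<or> snd p \<in> \<Omega>"
  shows "cos (phase p) \<ge> 0"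
proof (cases "midpt p \<in> ball 0 r")
  case True
  have 1: "norm (fst p + snd p) < 2 * r" using True by (simp add: midpt_def)
  have 2: "norm (fst p) < r \<or> norm (snd p) < r" using assms \<Omega>(2) by auto
  have 3: "norm (fst p - snd p) \<le> norm (fst p + snd p) + 2 * norm (snd p)"
    using norm_triangle_ineq4[of "fst p + snd p" "snd p + snd p"] norm_triangle_ineq[of "snd p" "snd p"] by simp
  have 4: "norm (fst p - snd p) \<le> norm (fst p + snd p) + 2 * norm (fst p)"
    using norm_triangle_ineq4[of "fst p + fst p" "fst p + snd p"] norm_triangle_ineq[of "fst p" "fst p"] by simp
  have "norm (fst p - snd p) \<le> 4 * r" using 1 2 3 4 by linarith
  then have "norm (fst p - snd p) * (pi / (8 * r)) \<le> (4 * r) * (pi / (8 * r))"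
    using r by (intro mult_right_mono) auto
  also have "\<dots> = pi / 2" using r by simp
  finally have "\<bar>phase p\<bar> \<le> pi / 2" using abs_phase_le[of p] by linarith
  then show ?thesis by (intro cos_ge_zero) auto
qed (simp add: phase_def A0_off)

text \<open>The midpoint has norm at least \<open>(3 r - r) / 2 = r\<close>, so it lies outside the support of the potential.\<close>

lemma cos_phase_far:
  assumes "fst p \<in> \<Omega> \<and> snd p \<notin> ball 0 (3 * r) \<or> snd p \<in> \<Omega> \<and> fst p \<notin> ball 0 (3 * r)"
  shows "cos (phase p) = 1"
proof -
  have "norm (fst p) < r \<and> norm (snd p) \<ge> 3 * r \<or> norm (snd p) < r \<and> norm (fst p) \<ge> 3 * r"
    using assms \<Omega>(2) by auto
  moreover have "norm (snd p) \<le> norm (fst p + snd p) + norm (fst p)" "norm (fst p) \<le> norm (fst p + snd p) + norm (snd p)"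
    using norm_triangle_ineq4[of "fst p + snd p" "fst p"] norm_triangle_ineq4[of "fst p + snd p" "snd p"] by auto
  ultimately have "norm (fst p + snd p) \<ge> 2 * r" by linarith
  then have "midpt p \<notin> ball 0 r" by (simp add: midpt_def)
  then show ?thesis by (simp add: phase_def A0_off)
qed

definition CL :: real where "CL = 2 + (pi / (8 * r))\<^sup>2"

lemma CL_pos: "CL > 0"
  unfolding CL_def using zero_le_power2[of "pi / (8 * r)"] by linarith

lemma one_minus_cos_phase: "(1 - cos (phase p)) \<le> CL * min 1 ((norm (fst p - snd p))\<^sup>2)"
proof -
  have a: "1 - cos (phase p) \<le> 2" using cos_ge_minus_one[of "phase p"] by linarith
  have "(phase p)\<^sup>2 \<le> (norm (fst p - snd p) * (pi / (8 * r)))\<^sup>2"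
    using abs_phase_le[of p] by (metis abs_ge_zero power2_abs power_mono)
  then have b: "1 - cos (phase p) \<le> (norm (fst p - snd p))\<^sup>2 * (pi / (8 * r))\<^sup>2"
    using one_minus_cos_le[of "phase p"] unfolding power_mult_distrib by (smt (verit) field_sum_of_halves zero_le_power2)
  have c: "CL * (norm (fst p - snd p))\<^sup>2 = 2 * (norm (fst p - snd p))\<^sup>2 + (norm (fst p - snd p))\<^sup>2 * (pi / (8 * r))\<^sup>2"
    by (simp add: CL_def algebra_simps)
  have d: "CL \<ge> 2" by (simp add: CL_def)
  show ?thesis
  proof (cases "1 \<le> (norm (fst p - snd p))\<^sup>2")
    case True
    then have "min 1 ((norm (fst p - snd p))\<^sup>2) = 1" by simp
    then show ?thesis using a d by (metis mult.right_neutral order_trans)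
  next
    case False
    then have m: "min 1 ((norm (fst p - snd p))\<^sup>2) = (norm (fst p - snd p))\<^sup>2" by simp
    show ?thesis unfolding m using b c zero_le_power2[of "norm (fst p - snd p)"] by linarith
  qed
qed

definition fc :: real where "fc = frac_const CARD('n) s"

lemma fc_pos: "fc > 0"
  unfolding fc_def by (rule frac_const_pos[OF s])

lemma kern_gagl: "(u (fst p) - u (snd p))\<^sup>2 * kern p = fc * gagl s u p"
  by (simp add: kern_def frac_kernel_def gagl_def fc_def)

lemma kern_trunc: "(1 - cos (phase p)) * kern p \<le> CL * fc * trunc_kernel s (fst p - snd p)"
proof -
  have "(1 - cos (phase p)) * kern p \<le> (CL * min 1 ((norm (fst p - snd p))\<^sup>2)) * kern p"
    by (rule mult_right_mono[OF one_minus_cos_phase kern_nonneg])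
  then show ?thesis by (simp add: kern_def frac_kernel_def trunc_kernel_def fc_def mult_ac)
qed

lemma density_self: "mag_density u u p = ((u (fst p) - u (snd p))\<^sup>2 + 2 * (1 - cos (phase p)) * u (fst p) * u (snd p)) * kern p"
  by (simp add: mag_density_def power2_eq_square algebra_simps)

lemma quad_nonneg: "\<bar>c\<bar> \<le> 1 \<Longrightarrow> a * a + b * b - c * (b * a + a * b) \<ge> (0::real)"
proof -
  assume c: "\<bar>c\<bar> \<le> 1"
  have "c * (a * b) \<le> \<bar>c\<bar> * \<bar>a * b\<bar>" by (metis abs_ge_self abs_mult)
  also have "\<dots> \<le> \<bar>a * b\<bar>" using c by (simp add: mult_left_le_one_le)
  finally have "2 * (c * (a * b)) \<le> 2 * (\<bar>a\<bar> * \<bar>b\<bar>)" by (simp add: abs_mult)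
  also have "\<dots> \<le> a * a + b * b"
    using zero_le_power2[of "\<bar>a\<bar> - \<bar>b\<bar>"] by (simp add: power2_eq_square algebra_simps flip: abs_mult)
  finally show ?thesis by (simp add: algebra_simps)
qed

lemma density_self_nonneg: "mag_density u u p \<ge> 0"
  unfolding mag_density_def by (intro mult_nonneg_nonneg kern_nonneg quad_nonneg) auto

lemma density_upper:
  "mag_density u u p \<le> 3 * fc * gagl s u p + 3 * CL * fc * (trunc_kernel s (fst p - snd p) * (u (snd p))\<^sup>2)"
proof -
  define a where "a = u (fst p) - u (snd p)"
  define b where "b = u (snd p)"
  define k where "k = 1 - cos (phase p)"
  have k: "0 \<le> k" "k \<le> 2" using cos_ge_minus_one[of "phase p"] by (auto simp: k_def)
  have "2 * (a * b) \<le> a\<^sup>2 + b\<^sup>2" using zero_le_power2[of "a - b"] by (simp add: power2_eq_square algebra_simps)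
  then have "k * (2 * (a * b)) \<le> k * (a\<^sup>2 + b\<^sup>2)" using k by (intro mult_left_mono)
  moreover have "k * a\<^sup>2 \<le> 2 * a\<^sup>2" using k by (intro mult_right_mono) auto
  ultimately have "a\<^sup>2 + 2 * k * (a + b) * b \<le> 3 * a\<^sup>2 + 3 * (k * b\<^sup>2)"
    by (simp add: power2_eq_square algebra_simps)
  then have "mag_density u u p \<le> (3 * a\<^sup>2 + 3 * (k * b\<^sup>2)) * kern p"
    unfolding density_self by (intro mult_right_mono kern_nonneg) (simp add: a_def b_def k_def)
  also have "\<dots> = 3 * (a\<^sup>2 * kern p) + 3 * (k * kern p) * b\<^sup>2" by (simp add: algebra_simps)
  also have "\<dots> \<le> 3 * (fc * gagl s u p) + 3 * (CL * fc * trunc_kernel s (fst p - snd p)) * b\<^sup>2"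
    using kern_gagl[of u p] kern_trunc[of p] by (intro add_mono mult_right_mono mult_left_mono) (auto simp: a_def k_def)
  finally show ?thesis by (simp add: b_def mult_ac)
qed

text \<open>Up to an \<open>L\<^sup>2\<close> term, the magnetic form controls the Gagliardo seminorm. With \<open>a = u(x) - u(y)\<close>, \<open>b = u(y)\<close>
  and \<open>k = 1 - cos \<theta>\<close>, the mixed term \<open>4 k a b\<close> is absorbed using \<open>(a + 2 k b)\<^sup>2 \<ge> 0\<close>.\<close>

lemma gagl_upper:
  "gagl s u p \<le> 2 / fc * mag_density u u p + 8 * CL * (trunc_kernel s (fst p - snd p) * (u (snd p))\<^sup>2)"
proof -
  define a where "a = u (fst p) - u (snd p)"
  define b where "b = u (snd p)"
  define k where "k = 1 - cos (phase p)"
  have k: "0 \<le> k" "k \<le> 2" using cos_ge_minus_one[of "phase p"] by (auto simp: k_def)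
  have "0 \<le> (a + 2 * k * b)\<^sup>2" by simp
  then have 1: "- 4 * k * a * b \<le> a\<^sup>2 + 4 * (k\<^sup>2 * b\<^sup>2)" by (simp add: power2_eq_square algebra_simps)
  have "k\<^sup>2 * b\<^sup>2 \<le> (2 * k) * b\<^sup>2" using k mult_right_mono[of k 2 k] by (intro mult_right_mono) (auto simp: power2_eq_square)
  moreover have "0 \<le> k * b\<^sup>2" using k by simp
  ultimately have "a\<^sup>2 \<le> 2 * (a\<^sup>2 + 2 * k * (a + b) * b) + 8 * (k * b\<^sup>2)"
    using 1 by (simp add: power2_eq_square algebra_simps)
  then have "a\<^sup>2 * kern p \<le> (2 * (a\<^sup>2 + 2 * k * (a + b) * b) + 8 * (k * b\<^sup>2)) * kern p"
    by (intro mult_right_mono kern_nonneg)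
  also have "\<dots> = 2 * mag_density u u p + 8 * (k * kern p) * b\<^sup>2"
    unfolding density_self by (simp add: a_def b_def k_def algebra_simps)
  also have "\<dots> \<le> 2 * mag_density u u p + 8 * (CL * fc * trunc_kernel s (fst p - snd p)) * b\<^sup>2"
    using kern_trunc[of p] by (intro add_mono mult_right_mono mult_left_mono) (auto simp: k_def)
  finally have "fc * gagl s u p \<le> fc * (2 / fc * mag_density u u p + 8 * CL * (trunc_kernel s (fst p - snd p) * (u (snd p))\<^sup>2))"
    using fc_pos kern_gagl[of u p] by (simp add: a_def b_def algebra_simps)
  then show ?thesis using fc_pos by (simp only: mult_le_cancel_left_pos)
qed

lemma density_measurable:
  assumes "u \<in> borel_measurable lebesgue" "v \<in> borel_measurable lebesgue"
  shows "mag_density u v \<in> borel_measurable lebesgue"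
proof -
  note [measurable] = measurable_comp_fst_snd[OF assms(1)] measurable_comp_fst_snd[OF assms(2)]
    phase_measurable kern_measurable
  show ?thesis unfolding mag_density_def by measurable
qed

lemma density_self_integrable:
  assumes u: "u \<in> Hs s"
  shows "integrable lebesgue (mag_density u u)"
proof (rule Bochner_Integration.integrable_bound[OF _ density_measurable[OF HsD(1)[OF u] HsD(1)[OF u]]])
  show "integrable lebesgue (\<lambda>p. 3 * fc * gagl s u p + 3 * CL * fc * (trunc_kernel s (fst p - snd p) * (u (snd p))\<^sup>2))"
    by (intro Bochner_Integration.integrable_add integrable_mult_right HsD(3)[OF u] trunc_kernel_square_integrable(1)[OF s] HsD(1,2)[OF u])
  show "AE p in lebesgue. norm (mag_density u u p) \<le> norm (3 * fc * gagl s u p + 3 * CL * fc * (trunc_kernel s (fst p - snd p) * (u (snd p))\<^sup>2))"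
  proof (rule AE_I2)
    fix p
    show "norm (mag_density u u p) \<le> norm (3 * fc * gagl s u p + 3 * CL * fc * (trunc_kernel s (fst p - snd p) * (u (snd p))\<^sup>2))"
      using density_upper[of u p] density_self_nonneg[of u p] unfolding real_norm_def by linarith
  qed
qed

text \<open>The constants in the comparison of the magnetic form with the norm of \<open>Hs\<close>, in the two directions.\<close>

definition C1 :: real where
  "C1 = 3 * fc + 3 * CL * fc * enn2real (\<integral>\<^sup>+z. ennreal (trunc_kernel s (z :: real^'n)) \<partial>lborel)"

definition C2 :: real where
  "C2 = 8 * CL * enn2real (\<integral>\<^sup>+z. ennreal (trunc_kernel s (z :: real^'n)) \<partial>lborel)"

lemma C1_C2_nonneg: "C1 \<ge> 0" "C2 \<ge> 0"
  using fc_pos CL_pos by (auto simp: C1_def C2_def)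

lemma integral_density_le:
  assumes u: "u \<in> Hs s"
  shows "(\<integral>p. mag_density u u p \<partial>lebesgue) \<le> C1 * Hs_sq s u"
proof -
  note i = HsD(3)[OF u] trunc_kernel_square_integrable[OF s HsD(1,2)[OF u]]
  have "(\<integral>p. mag_density u u p \<partial>lebesgue) \<le> (\<integral>p. 3 * fc * gagl s u p + 3 * CL * fc * (trunc_kernel s (fst p - snd p) * (u (snd p))\<^sup>2) \<partial>lebesgue)"
    by (intro integral_mono density_self_integrable u density_upper Bochner_Integration.integrable_add integrable_mult_right i)
  also have "\<dots> = 3 * fc * (\<integral>p. gagl s u p \<partial>lebesgue) + (C1 - 3 * fc) * (\<integral>x. (u x)\<^sup>2 \<partial>lebesgue)"
    using i by (simp add: C1_def)
  also have "\<dots> \<le> C1 * Hs_sq s u"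
  proof -
    have "3 * fc \<le> C1" using fc_pos CL_pos by (simp add: C1_def)
    then have "3 * fc * (\<integral>p. gagl s u p \<partial>lebesgue) \<le> C1 * (\<integral>p. gagl s u p \<partial>lebesgue)"
      "(C1 - 3 * fc) * (\<integral>x. (u x)\<^sup>2 \<partial>lebesgue) \<le> C1 * (\<integral>x. (u x)\<^sup>2 \<partial>lebesgue)"
      using Hs_sq_parts(1)[of u] Hs_sq_parts(2)[of s u] fc_pos by (auto intro!: mult_right_mono)
    then show ?thesis by (simp add: Hs_sq_def algebra_simps)
  qed
  finally show ?thesis .
qed

lemma integral_gagl_le:
  assumes u: "u \<in> Hs s"
  shows "(\<integral>p. gagl s u p \<partial>lebesgue) \<le> 2 / fc * (\<integral>p. mag_density u u p \<partial>lebesgue) + C2 * (\<integral>x. (u x)\<^sup>2 \<partial>lebesgue)"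
proof -
  note i = density_self_integrable[OF u] trunc_kernel_square_integrable[OF s HsD(1,2)[OF u]]
  have "(\<integral>p. gagl s u p \<partial>lebesgue) \<le> (\<integral>p. 2 / fc * mag_density u u p + 8 * CL * (trunc_kernel s (fst p - snd p) * (u (snd p))\<^sup>2) \<partial>lebesgue)"
    by (intro integral_mono HsD(3) u gagl_upper Bochner_Integration.integrable_add integrable_mult_right i)
  also have "\<dots> = 2 / fc * (\<integral>p. mag_density u u p \<partial>lebesgue) + C2 * (\<integral>x. (u x)\<^sup>2 \<partial>lebesgue)"
    using i by (simp add: C2_def)
  finally show ?thesis .
qed

lemma abs_density_le: "\<bar>mag_density u v p\<bar> \<le> (mag_density u u p + mag_density v v p) / 2"
proof -
  have "0 \<le> mag_density (\<lambda>x. u x + v x) (\<lambda>x. u x + v x) p" "0 \<le> mag_density (\<lambda>x. u x - v x) (\<lambda>x. u x - v x) p"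
    by (rule density_self_nonneg)+
  moreover have "mag_density (\<lambda>x. u x + v x) (\<lambda>x. u x + v x) p = mag_density u u p + mag_density v v p + 2 * mag_density u v p"
    "mag_density (\<lambda>x. u x - v x) (\<lambda>x. u x - v x) p = mag_density u u p + mag_density v v p - 2 * mag_density u v p"
    by (simp_all add: mag_density_def algebra_simps)
  ultimately show ?thesis by (simp add: abs_le_iff)
qed

lemma density_integrable:
  assumes u: "u \<in> Hs s" and v: "v \<in> Hs s"
  shows "integrable lebesgue (mag_density u v)"
proof (rule Bochner_Integration.integrable_bound[OF _ density_measurable[OF HsD(1)[OF u] HsD(1)[OF v]]])
  show "integrable lebesgue (\<lambda>p. (mag_density u u p + mag_density v v p) / 2)"
    using density_self_integrable[OF u] density_self_integrable[OF v] by simp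
  show "AE p in lebesgue. norm (mag_density u v p) \<le> norm ((mag_density u u p + mag_density v v p) / 2)"
  proof (rule AE_I2)
    fix p show "norm (mag_density u v p) \<le> norm ((mag_density u u p + mag_density v v p) / 2)"
      using abs_density_le[of u v p] by simp
  qed
qed

text \<open>The two factors in the integrand are \<open>u(x) - e\<^bsup>i\<theta>\<^esup> u(y)\<close> and the complex conjugate of
  \<open>v(x) - e\<^bsup>i\<theta>\<^esup> v(y)\<close>. Their squared moduli, times the kernel, are the densities of \<open>(u, u)\<close> and \<open>(v, v)\<close>;
  this gives integrability, so the real part may be taken inside the integral.\<close>

lemma mag_form_eq:
  assumes u: "u \<in> Hs s" and v: "v \<in> Hs s"
  shows "mag_form s A u v = (\<integral>p. mag_density u v p \<partial>lebesgue)"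
proof -
  define F :: "real \<Rightarrow> (real^'n) \<times> (real^'n) \<Rightarrow> complex" where
    "F t p = (complex_of_real (u (fst p)) - exp (\<i> * complex_of_real t) * complex_of_real (u (snd p))) *
       (complex_of_real (v (fst p)) - exp (- \<i> * complex_of_real t) * complex_of_real (v (snd p))) *
       complex_of_real (kern p)" for t p
  note [measurable] = measurable_comp_fst_snd[OF HsD(1)[OF u]] measurable_comp_fst_snd[OF HsD(1)[OF v]]
    phase_measurable kern_measurable
  have [measurable]: "(\<lambda>p. mag_phase A (fst p) (snd p)) \<in> borel_measurable lebesgue"
  proof -
    note [measurable] = measurable_comp_fst_snd(3)[OF A_meas, unfolded midpt_def]
    have [measurable]: "(\<lambda>p::(real^'n) \<times> (real^'n). fst p - snd p) \<in> borel_measurable lebesgue"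
      by (rule measurable_pair_diff) simp
    show ?thesis unfolding mag_phase_def by measurable
  qed
  have Re: "Re (F (phase p) p) = mag_density u v p" for p
  proof -
    define c where "c = cos (phase p)"
    define d where "d = sin (phase p)"
    have cd: "c * c + d * d = 1" using sin_cos_squared_add[of "phase p"] by (simp add: c_def d_def power2_eq_square)
    have "Re (F (phase p) p) = ((u (fst p) - c * u (snd p)) * (v (fst p) - c * v (snd p)) - (- (d * u (snd p))) * (d * v (snd p))) * kern p"
      unfolding F_def c_def d_def by (simp add: exp_Euler cos_of_real sin_of_real exp_minus_Euler) 
    also have "\<dots> = (u (fst p) * v (fst p) + (c * c + d * d) * (u (snd p) * v (snd p)) - c * (u (snd p) * v (fst p) + u (fst p) * v (snd p))) * kern p"
      by (simp add: algebra_simps)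
    finally have "Re (F (phase p) p) = (u (fst p) * v (fst p) + 1 * (u (snd p) * v (snd p)) - c * (u (snd p) * v (fst p) + u (fst p) * v (snd p))) * kern p"
      unfolding cd .
    then show ?thesis by (simp add: mag_density_def c_def)
  qed
  have nrm: "norm (F (phase p) p) \<le> (mag_density u u p + mag_density v v p) / 2" for p
  proof -
    define U where "U = complex_of_real (u (fst p)) - exp (\<i> * complex_of_real (phase p)) * complex_of_real (u (snd p))"
    define V where "V = complex_of_real (v (fst p)) - exp (- \<i> * complex_of_real (phase p)) * complex_of_real (v (snd p))"
    define c where "c = cos (phase p)"
    define d where "d = sin (phase p)"
    have sq: "c\<^sup>2 + d\<^sup>2 = 1" by (simp add: c_def d_def)
    have "(cmod U)\<^sup>2 = (u (fst p) - c * u (snd p))\<^sup>2 + (d * u (snd p))\<^sup>2"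
      unfolding U_def cmod_power2 c_def d_def by (simp add: exp_Euler cos_of_real sin_of_real)
    also have "\<dots> = (u (fst p))\<^sup>2 + (c\<^sup>2 + d\<^sup>2) * (u (snd p))\<^sup>2 - c * (u (snd p) * u (fst p) + u (fst p) * u (snd p))"
      by (simp add: power2_eq_square algebra_simps)
    finally have U: "(cmod U)\<^sup>2 * kern p = mag_density u u p"
      unfolding sq by (simp add: mag_density_def power2_eq_square c_def)
    have "(cmod V)\<^sup>2 = (v (fst p) - c * v (snd p))\<^sup>2 + (d * v (snd p))\<^sup>2"
      unfolding V_def cmod_power2 c_def d_def by (simp add: exp_minus_Euler cos_of_real sin_of_real)
    also have "\<dots> = (v (fst p))\<^sup>2 + (c\<^sup>2 + d\<^sup>2) * (v (snd p))\<^sup>2 - c * (v (snd p) * v (fst p) + v (fst p) * v (snd p))"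
      by (simp add: power2_eq_square algebra_simps)
    finally have V: "(cmod V)\<^sup>2 * kern p = mag_density v v p"
      unfolding sq by (simp add: mag_density_def power2_eq_square c_def)
    have "cmod U * cmod V \<le> ((cmod U)\<^sup>2 + (cmod V)\<^sup>2) / 2"
      using zero_le_power2[of "cmod U - cmod V"] by (simp add: power2_eq_square algebra_simps)
    then have "cmod U * cmod V * kern p \<le> ((cmod U)\<^sup>2 + (cmod V)\<^sup>2) / 2 * kern p"
      by (intro mult_right_mono kern_nonneg)
    also have "\<dots> = (mag_density u u p + mag_density v v p) / 2" by (simp add: U[symmetric] V[symmetric] algebra_simps)
    finally show ?thesis by (simp add: F_def U_def V_def norm_mult kern_nonneg)
  qed
  have m: "(\<lambda>p. F (phase p) p) \<in> borel_measurable lebesgue" "(\<lambda>p. F (mag_phase A (fst p) (snd p)) p) \<in> borel_measurable lebesgue"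
    unfolding F_def by measurable
  have i: "integrable lebesgue (\<lambda>p. F (phase p) p)"
  proof (rule Bochner_Integration.integrable_bound[OF _ m(1)])
    show "integrable lebesgue (\<lambda>p. (mag_density u u p + mag_density v v p) / 2)"
      using density_self_integrable[OF u] density_self_integrable[OF v] by simp
    show "AE p in lebesgue. norm (F (phase p) p) \<le> norm ((mag_density u u p + mag_density v v p) / 2)"
    proof (rule AE_I2)
      fix p show "norm (F (phase p) p) \<le> norm ((mag_density u u p + mag_density v v p) / 2)"
        using nrm[of p] abs_ge_self[of "(mag_density u u p + mag_density v v p) / 2"] unfolding real_norm_def by linarith
    qed
  qed
  have "mag_form s A u v = Re (\<integral>p. F (mag_phase A (fst p) (snd p)) p \<partial>lebesgue)"
    unfolding mag_form_def F_def kern_def by (simp add: case_prod_beta')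
  also have "(\<integral>p. F (mag_phase A (fst p) (snd p)) p \<partial>lebesgue) = (\<integral>p. F (phase p) p \<partial>lebesgue)"
    by (rule integral_cong_AE[OF m(2) m(1)]) (use phase_AE in eventually_elim, simp)
  also have "Re \<dots> = (\<integral>p. Re (F (phase p) p) \<partial>lebesgue)"
    using integral_Re[OF i] by simp
  finally show ?thesis by (simp add: Re)
qed

lemma mag_op_eq: "u \<in> Hs s \<Longrightarrow> v \<in> Hs s \<Longrightarrow> mag_op s A u v = (\<integral>p. mag_density u v p \<partial>lebesgue)"
  by (simp add: mag_op_def mag_form_eq)

lemma mag_op_cong_AE:
  assumes "u \<in> Hs s" "u' \<in> Hs s" "v \<in> Hs s" "AE x in lebesgue. u x = u' x"
  shows "mag_op s A u v = mag_op s A u' v"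
  unfolding mag_op_eq[OF assms(1,3)] mag_op_eq[OF assms(2,3)]
proof (rule integral_cong_AE)
  show "AE p in lebesgue. mag_density u v p = mag_density u' v p"
    using null_preserving_AE[OF null_preserving_fst assms(4)] null_preserving_AE[OF null_preserving_snd assms(4)]
    by eventually_elim (simp add: mag_density_def)
qed (use assms HsD(1) density_measurable in blast)+

end

section \<open>The linear problem\<close>

text \<open>A quadratic polynomial in \<open>t\<close> without sign change has nonpositive discriminant. This yields the
  Cauchy-Schwarz inequality, and the Euler-Lagrange equation for near minimisers.\<close>

lemma discriminant_le:
  fixes a b c :: real
  assumes "\<And>t. 0 \<le> a + 2 * t * b + t\<^sup>2 * c" "c \<ge> 0"
  shows "b\<^sup>2 \<le> a * c"
proof (cases "c = 0")
  case True
  have "b = 0"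
  proof (rule ccontr)
    assume "b \<noteq> 0"
    then have "a + 2 * (- (a + 1) / (2 * b)) * b = - 1" by (simp add: field_simps)
    then show False using assms(1)[of "- (a + 1) / (2 * b)"] True by simp
  qed
  then show ?thesis using True by simp
next
  case False
  then have c: "c > 0" using assms(2) by simp
  have "0 \<le> (a + 2 * (- b / c) * b + (- b / c)\<^sup>2 * c) * c"
    using assms(1)[of "- b / c"] c by (intro mult_nonneg_nonneg) auto
  also have "\<dots> = a * c - b\<^sup>2" using c by (simp add: field_simps power2_eq_square)
  finally show ?thesis by simp
qed

lemma squeeze_geometric: "(\<And>k. (x::real) \<le> C * (1/4)^k) \<Longrightarrow> x \<le> 0"
proof -
  assume a: "\<And>k. x \<le> C * (1/4)^k"
  have "(\<lambda>k. C * (1/4::real)^k) \<longlonglongrightarrow> C * 0"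
    by (intro tendsto_mult tendsto_const LIMSEQ_realpow_zero) auto
  then show "x \<le> 0" using a LIMSEQ_le_const[of "\<lambda>k. C * (1/4::real)^k" "C * 0" x] by auto
qed

locale magnetic_potential = magnetic s r \<Omega> A
  for s r :: real and \<Omega> :: "(real^'n) set" and A :: "real^'n \<Rightarrow> real^'n" +
  fixes q :: "real^'n \<Rightarrow> real" and q0 q1 :: real
  assumes q_meas: "(\<lambda>x. indicator \<Omega> x * q x) \<in> borel_measurable lebesgue"
    and q0: "q0 > 0" and q_bounds: "\<And>x. x \<in> \<Omega> \<Longrightarrow> q0 \<le> q x" "\<And>x. x \<in> \<Omega> \<Longrightarrow> q x \<le> q1"
begin

definition pot :: "real^'n \<Rightarrow> real" where "pot x = indicator \<Omega> x * q x"

lemma pot_bounds: "0 \<le> pot x" "\<bar>pot x\<bar> \<le> \<bar>q1\<bar>"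
  using q_bounds[of x] q0 by (auto simp: pot_def indicator_def)

definition energy :: "(real^'n \<Rightarrow> real) \<Rightarrow> (real^'n \<Rightarrow> real) \<Rightarrow> real" where
  "energy u v = (\<integral>p. mag_density u v p \<partial>lebesgue) + (\<integral>x. pot x * u x * v x \<partial>lebesgue)"

lemma energy_eq:
  "u \<in> Hs s \<Longrightarrow> v \<in> Hs s \<Longrightarrow> energy u v = mag_op s A u v + (LINT x:\<Omega>|lebesgue. q x * u x * v x)"
  by (simp add: energy_def mag_op_eq pot_def set_lebesgue_integral_def mult.assoc)

lemma pot_integrable:
  assumes u: "u \<in> Hs s" and v: "v \<in> Hs s"
  shows "integrable lebesgue (\<lambda>x. pot x * u x * v x)"
proof (rule Bochner_Integration.integrable_bound)
  show "integrable lebesgue (\<lambda>x. \<bar>q1\<bar> * ((u x)\<^sup>2 + (v x)\<^sup>2))"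
    using HsD(2)[OF u] HsD(2)[OF v] by simp
  note [measurable] = HsD(1)[OF u] HsD(1)[OF v]
  have [measurable]: "pot \<in> borel_measurable lebesgue" using q_meas by (simp add: pot_def[abs_def])
  show "(\<lambda>x. pot x * u x * v x) \<in> borel_measurable lebesgue" by measurable
  show "AE x in lebesgue. norm (pot x * u x * v x) \<le> norm (\<bar>q1\<bar> * ((u x)\<^sup>2 + (v x)\<^sup>2))"
  proof (rule AE_I2)
    fix x
    have "2 * (\<bar>u x\<bar> * \<bar>v x\<bar>) \<le> (u x)\<^sup>2 + (v x)\<^sup>2"
      using zero_le_power2[of "\<bar>u x\<bar> - \<bar>v x\<bar>"] by (simp add: power2_eq_square algebra_simps flip: abs_mult)
    then have 1: "\<bar>u x\<bar> * \<bar>v x\<bar> \<le> (u x)\<^sup>2 + (v x)\<^sup>2"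
      by (smt (verit) abs_ge_zero mult_nonneg_nonneg)
    have "\<bar>pot x\<bar> * (\<bar>u x\<bar> * \<bar>v x\<bar>) \<le> \<bar>q1\<bar> * ((u x)\<^sup>2 + (v x)\<^sup>2)"
      by (intro mult_mono pot_bounds 1) auto
    then show "norm (pot x * u x * v x) \<le> norm (\<bar>q1\<bar> * ((u x)\<^sup>2 + (v x)\<^sup>2))"
      by (simp add: abs_mult mult.assoc)
  qed
qed

lemma energy_sym: "energy u v = energy v u"
  unfolding energy_def mag_density_def by (simp add: mult_ac add_ac)

lemma energy_lincomb:
  assumes u: "u \<in> Hs s" and v: "v \<in> Hs s" and w: "w \<in> Hs s"
  shows "energy (\<lambda>x. \<alpha> * u x + \<beta> * v x) w = \<alpha> * energy u w + \<beta> * energy v w"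
proof -
  have "mag_density (\<lambda>x. \<alpha> * u x + \<beta> * v x) w p = \<alpha> * mag_density u w p + \<beta> * mag_density v w p" for p
    by (simp add: mag_density_def algebra_simps)
  moreover have "pot x * (\<alpha> * u x + \<beta> * v x) * w x = \<alpha> * (pot x * u x * w x) + \<beta> * (pot x * v x * w x)" for x
    by (simp add: algebra_simps)
  ultimately show ?thesis
    using density_integrable[OF u w] density_integrable[OF v w] pot_integrable[OF u w] pot_integrable[OF v w]
    by (simp add: energy_def algebra_simps)
qed

lemma energy_diff:
  assumes "u \<in> Hs s" "v \<in> Hs s" "w \<in> Hs s"
  shows "energy (\<lambda>x. u x - v x) w = energy u w - energy v w"
  using energy_lincomb[OF assms, of 1 "-1"] by simp

lemma energy_square_lincomb:
  assumes u: "u \<in> Hs s" and v: "v \<in> Hs s"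
  shows "energy (\<lambda>x. \<alpha> * u x + \<beta> * v x) (\<lambda>x. \<alpha> * u x + \<beta> * v x)
    = \<alpha>\<^sup>2 * energy u u + 2 * \<alpha> * \<beta> * energy u v + \<beta>\<^sup>2 * energy v v"
proof -
  have H: "(\<lambda>x. \<alpha> * u x + \<beta> * v x) \<in> Hs s" by (rule Hs_lincomb(1)[OF u v])
  show ?thesis
    unfolding energy_lincomb[OF u v H] energy_sym[of _ "\<lambda>x. \<alpha> * u x + \<beta> * v x"]
      energy_lincomb[OF u v u] energy_lincomb[OF u v v] energy_sym[of v u]
    by (simp add: power2_eq_square algebra_simps)
qed

lemma energy_nonneg: "energy u u \<ge> 0"
  unfolding energy_def using pot_bounds
  by (intro add_nonneg_nonneg Bochner_Integration.integral_nonneg density_self_nonneg) (simp add: mult.assoc)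

lemma energy_le: "u \<in> Hs s \<Longrightarrow> energy u u \<le> (C1 + \<bar>q1\<bar>) * Hs_sq s u"
proof -
  assume u: "u \<in> Hs s"
  have "(\<integral>x. pot x * u x * u x \<partial>lebesgue) \<le> (\<integral>x. \<bar>q1\<bar> * (u x)\<^sup>2 \<partial>lebesgue)"
  proof (intro integral_mono pot_integrable u integrable_mult_right HsD(2)[OF u])
    fix x
    have "pot x * (u x)\<^sup>2 \<le> \<bar>q1\<bar> * (u x)\<^sup>2"
      using pot_bounds[of x] by (intro mult_right_mono) auto
    then show "pot x * u x * u x \<le> \<bar>q1\<bar> * (u x)\<^sup>2" by (simp add: power2_eq_square mult.assoc)
  qed
  also have "\<dots> \<le> \<bar>q1\<bar> * Hs_sq s u"
    using Hs_sq_parts(2)[of s u] by (simp add: Hs_sq_def mult_left_mono)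
  finally show ?thesis using integral_density_le[OF u] by (simp add: energy_def algebra_simps)
qed

definition C3 :: real where "C3 = 2 / fc + (C2 + 1) / q0"

lemma C3_pos: "C3 > 0"
proof -
  have "2 / fc > 0" "(C2 + 1) / q0 > 0" using fc_pos C1_C2_nonneg q0 by (simp_all add: add_nonneg_pos)
  then show ?thesis unfolding C3_def by linarith
qed

text \<open>Coercivity: the lower bound for the potential controls the \<open>L\<^sup>2\<close> norm of a function that vanishes
  outside \<open>\<Omega>\<close>, and \<open>integral_gagl_le\<close> then controls the Gagliardo seminorm.\<close>

lemma Hs_sq_le_energy:
  assumes u: "u \<in> Hs s" and off: "AE x in lebesgue. x \<notin> \<Omega> \<longrightarrow> u x = 0"
  shows "Hs_sq s u \<le> C3 * energy u u"
proof -
  define D where "D = (\<integral>p. mag_density u u p \<partial>lebesgue)"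
  define P where "P = (\<integral>x. pot x * u x * u x \<partial>lebesgue)"
  have D0: "D \<ge> 0" unfolding D_def by (intro Bochner_Integration.integral_nonneg density_self_nonneg)
  have P0: "P \<ge> 0" unfolding P_def using pot_bounds by (intro Bochner_Integration.integral_nonneg) (simp add: mult.assoc)
  have "(\<integral>x. q0 * (u x)\<^sup>2 \<partial>lebesgue) \<le> P"
    unfolding P_def
  proof (rule integral_mono_AE[OF integrable_mult_right[OF HsD(2)[OF u]] pot_integrable[OF u u]])
    show "AE x in lebesgue. q0 * (u x)\<^sup>2 \<le> pot x * u x * u x"
      using off
    proof eventually_elim
      case (elim x)
      show ?case
      proof (cases "x \<in> \<Omega>")
        case True
        then have "q0 * (u x)\<^sup>2 \<le> q x * (u x)\<^sup>2" using q_bounds by (intro mult_right_mono) auto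
        then show ?thesis using True by (simp add: pot_def power2_eq_square mult.assoc)
      qed (use elim in simp)
    qed
  qed
  then have 1: "(\<integral>x. (u x)\<^sup>2 \<partial>lebesgue) \<le> P / q0" using q0 by (simp add: field_simps)
  have "Hs_sq s u \<le> 2 / fc * D + (C2 + 1) * (\<integral>x. (u x)\<^sup>2 \<partial>lebesgue)"
    using integral_gagl_le[OF u] by (simp add: Hs_sq_def D_def algebra_simps)
  also have "\<dots> \<le> 2 / fc * D + (C2 + 1) * (P / q0)"
    using C1_C2_nonneg by (intro add_left_mono mult_left_mono 1) auto
  also have "\<dots> \<le> C3 * (D + P)"
  proof -
    have "0 \<le> (C2 + 1) / q0 * D" "0 \<le> 2 / fc * P"
      using C1_C2_nonneg q0 D0 P0 fc_pos by auto
    moreover have "C3 * (D + P) = (2 / fc * D + (C2 + 1) / q0 * D) + (2 / fc * P + (C2 + 1) / q0 * P)"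
      unfolding C3_def by (simp only: distrib_left distrib_right)
    moreover have "(C2 + 1) * (P / q0) = (C2 + 1) / q0 * P" by simp
    ultimately show ?thesis by linarith
  qed
  finally show ?thesis by (simp add: energy_def D_def P_def)
qed

lemma energy_CS:
  assumes u: "u \<in> Hs s" and v: "v \<in> Hs s"
  shows "(energy u v)\<^sup>2 \<le> energy u u * energy v v"
proof (rule discriminant_le[OF _ energy_nonneg])
  fix t
  show "0 \<le> energy u u + 2 * t * energy u v + t\<^sup>2 * energy v v"
    using energy_nonneg[of "\<lambda>x. 1 * u x + t * v x"] unfolding energy_square_lincomb[OF u v] by simp
qed

text \<open>If one of the two points lies in \<open>\<Omega>\<close>, then \<open>c = cos \<theta>\<close> lies between 0 and 1, and the density is the
  kernel times \<open>c (u(x) - u(y))\<^sup>2 + (1 - c) (u(x)\<^sup>2 + u(y)\<^sup>2)\<close>. A contraction that fixes 0 decreases both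
  squares. At points outside \<open>\<Omega>\<close> the clamp leaves \<open>u = g\<close> unchanged.\<close>

lemma energy_clamp_le:
  assumes M: "M \<ge> 0" and g: "\<And>x. 0 \<le> g x \<and> g x \<le> M"
    and u: "u \<in> Hs s" and cu: "(\<lambda>x. soft_clamp M (u x)) \<in> Hs s"
    and off: "\<And>x. x \<notin> \<Omega> \<Longrightarrow> u x = g x"
  shows "energy (\<lambda>x. soft_clamp M (u x)) (\<lambda>x. soft_clamp M (u x)) \<le> energy u u"
proof -
  have sq: "(soft_clamp M z)\<^sup>2 \<le> z\<^sup>2" for z
    using soft_clamp_abs_le[OF M, of z] by (simp add: abs_le_square_iff)
  have dsq: "(soft_clamp M y - soft_clamp M z)\<^sup>2 \<le> (y - z)\<^sup>2" for y z
    using soft_clamp_lipschitz[of M y z] by (simp add: abs_le_square_iff)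
  have "mag_density (\<lambda>x. soft_clamp M (u x)) (\<lambda>x. soft_clamp M (u x)) p \<le> mag_density u u p" for p
  proof (cases "fst p \<in> \<Omega> \<or> snd p \<in> \<Omega>")
    case True
    define c where "c = cos (phase p)"
    have c: "0 \<le> c" "c \<le> 1" using cos_phase_nonneg[OF True] by (auto simp: c_def)
    have e: "mag_density w w p = (c * (w (fst p) - w (snd p))\<^sup>2 + (1 - c) * ((w (fst p))\<^sup>2 + (w (snd p))\<^sup>2)) * kern p" for w
      by (simp add: mag_density_def c_def power2_eq_square algebra_simps)
    show ?thesis unfolding e
      using c by (intro mult_right_mono add_mono mult_left_mono dsq sq kern_nonneg) auto
  next
    case False
    then have "soft_clamp M (u (fst p)) = u (fst p)" "soft_clamp M (u (snd p)) = u (snd p)"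
      using off g soft_clamp_fixed_iff[OF M] by auto
    then show ?thesis by (simp add: mag_density_def)
  qed
  then have "(\<integral>p. mag_density (\<lambda>x. soft_clamp M (u x)) (\<lambda>x. soft_clamp M (u x)) p \<partial>lebesgue) \<le> (\<integral>p. mag_density u u p \<partial>lebesgue)"
    by (intro integral_mono density_integrable u cu)
  moreover have "(\<integral>x. pot x * soft_clamp M (u x) * soft_clamp M (u x) \<partial>lebesgue) \<le> (\<integral>x. pot x * u x * u x \<partial>lebesgue)"
  proof (intro integral_mono pot_integrable u cu)
    fix x
    have "pot x * (soft_clamp M (u x))\<^sup>2 \<le> pot x * (u x)\<^sup>2"
      by (intro mult_left_mono sq pot_bounds)
    then show "pot x * soft_clamp M (u x) * soft_clamp M (u x) \<le> pot x * u x * u x"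
      by (simp add: power2_eq_square mult.assoc)
  qed
  ultimately show ?thesis by (simp add: energy_def)
qed

lemma lin_solution_iff:
  "g \<in> Hs s \<Longrightarrow> lin_solution s \<Omega> A q g u \<longleftrightarrow>
    u \<in> Hs s \<and> (\<lambda>x. u x - g x) \<in> Hs_tilde s \<Omega> \<and> (\<forall>v\<in>Hs_tilde s \<Omega>. energy u v = 0)"
  unfolding lin_solution_def using energy_eq Hs_tilde_Hs by metis

lemma lin_solution_unique:
  assumes u: "lin_solution s \<Omega> A q g u" and v: "lin_solution s \<Omega> A q g v" and g: "g \<in> Hs s"
  shows "AE x in lebesgue. u x = v x"
proof -
  note u' = u[unfolded lin_solution_iff[OF g]] and v' = v[unfolded lin_solution_iff[OF g]]
  have "(\<lambda>x. 1 * (u x - g x) + (-1) * (v x - g x)) \<in> Hs_tilde s \<Omega>"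
    by (rule Hs_tilde_lincomb[OF s]) (use u' v' in auto)
  then have w: "(\<lambda>x. u x - v x) \<in> Hs_tilde s \<Omega>" by simp
  have "energy (\<lambda>x. u x - v x) (\<lambda>x. u x - v x) = 0"
    using energy_diff[of u v "\<lambda>x. u x - v x"] u' v' w Hs_tilde_Hs by auto
  then have "Hs_sq s (\<lambda>x. u x - v x) \<le> 0"
    using Hs_sq_le_energy[OF Hs_tilde_Hs[OF w] Hs_tilde_AE_zero[OF s w \<Omega>(1)]] by simp
  then have "(\<integral>x. (u x - v x)\<^sup>2 \<partial>lebesgue) = 0"
    using Hs_sq_parts(1)[of "\<lambda>x. u x - v x"] Hs_sq_parts(2)[of s "\<lambda>x. u x - v x"] unfolding Hs_sq_def by linarith
  then have "AE x in lebesgue. (u x - v x)\<^sup>2 = 0"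
    using integral_nonneg_eq_0_iff_AE[OF HsD(2)[OF Hs_tilde_Hs[OF w]]] by auto
  then show ?thesis by eventually_elim simp
qed

text \<open>The direct method. By the parallelogram law, a minimising sequence of the energy over \<open>g\<close> plus the
  test functions is a Cauchy sequence, and its limit \<open>u\<close> solves the equation. Clamping the values does
  not increase the energy, so the clamped sequence is minimising as well and has the same limit.
  Hence \<open>u\<close> is fixed by the clamp, which means that its values lie between 0 and \<open>M\<close>.\<close>

lemma lin_solution_exists_bounded:
  assumes g: "g \<in> test_functions W" and M: "\<And>x. 0 \<le> g x \<and> g x \<le> M"
  obtains u where "lin_solution s \<Omega> A q g u" "AE x in lebesgue. 0 \<le> u x \<and> u x \<le> M"
proof -
  have M0: "M \<ge> 0" using M[of 0] by linarith
  have gH: "g \<in> Hs s" by (rule test_functions_Hs[OF s g])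
  define T where "T u = (\<lambda>x. soft_clamp M (u x))" for u :: "real^'n \<Rightarrow> real"
  define V where "V = {u. (\<lambda>x. u x - g x) \<in> test_functions \<Omega>}"
  have VH: "u \<in> Hs s" if "u \<in> V" for u
    using Hs_add[OF test_functions_Hs[OF s, of "\<lambda>x. u x - g x" \<Omega>] gH] that by (simp add: V_def)
  have Voff: "u x = g x" if "u \<in> V" "x \<notin> \<Omega>" for u x
    using test_functions_off[of "\<lambda>x. u x - g x" \<Omega> x] that by (simp add: V_def)
  have Vaff: "(\<lambda>x. u x + t * \<phi> x) \<in> V" if "u \<in> V" "\<phi> \<in> test_functions \<Omega>" for u \<phi> t
    using test_functions_lincomb[of "\<lambda>x. u x - g x" \<Omega> \<phi> 1 t] that by (simp add: V_def algebra_simps)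
  have Vmid: "(\<lambda>x. (1/2) * u x + (1/2) * v x) \<in> V" if "u \<in> V" "v \<in> V" for u v
  proof -
    have "(\<lambda>x. (1/2) * (u x - g x) + (1/2) * (v x - g x)) \<in> test_functions \<Omega>"
      using that by (intro test_functions_lincomb) (auto simp: V_def)
    moreover have "(\<lambda>x. (1/2) * (u x - g x) + (1/2) * (v x - g x)) = (\<lambda>x. (1/2) * u x + (1/2) * v x - g x)"
      by (auto simp: field_simps)
    ultimately show ?thesis by (simp add: V_def)
  qed
  have VT: "T u \<in> V" if u: "u \<in> V" for u
  proof -
    have ug: "(\<lambda>x. u x - g x) \<in> test_functions \<Omega>" using u by (simp add: V_def)
    obtain K where K: "compact K" "K \<subseteq> \<Omega>" "\<And>x. x \<notin> K \<Longrightarrow> u x - g x = 0"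
      using test_functions_compact[OF ug] by blast
    have "smooth_fun u"
      using smooth_fun_add[OF test_functions_smooth[OF ug] test_functions_smooth[OF g]] by simp
    then have sm: "smooth_fun (\<lambda>x. T u x - g x)"
      unfolding T_def by (intro smooth_fun_diff smooth_fun_soft_clamp test_functions_smooth[OF g])
    have "(\<lambda>x. T u x - g x) \<in> test_functions \<Omega>"
    proof (rule test_functionsI[OF sm K(1,2)])
      fix x assume "x \<notin> K"
      then have "u x = g x" using K(3) by fastforce
      then show "T u x - g x = 0" using soft_clamp_fixed_iff[OF M0] M by (simp add: T_def)
    qed
    then show ?thesis by (simp add: V_def)
  qed
  have gV: "g \<in> V" using test_functions_zero by (simp add: V_def)
  define m where "m = (INF u\<in>V. energy u u)"
  have bdd: "bdd_below ((\<lambda>u. energy u u) ` V)" using energy_nonneg by (intro bdd_belowI[of _ 0]) auto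
  have m_le: "m \<le> energy u u" if "u \<in> V" for u
    unfolding m_def by (rule cINF_lower[OF bdd that])
  \<comment> \<open>The parallelogram law turns an excess \<open>\<delta> k\<close> over the infimum into an energy distance \<open>4 * \<delta> k\<close>,
    and coercivity costs a factor \<open>C3\<close>; the choice of \<open>\<delta>\<close> makes the result the rate \<open>(1/4)^k\<close>.\<close>
  define \<delta> where "\<delta> k = (1/4)^k / (4 * C3)" for k :: nat
  have \<delta>: "\<delta> k > 0" for k using C3_pos by (simp add: \<delta>_def)
  have \<delta>_mono: "\<delta> l \<le> \<delta> k" if "k \<le> l" for k l
    using C3_pos that by (auto simp: \<delta>_def intro!: divide_right_mono power_decreasing)
  have \<delta>C3: "C3 * (4 * \<delta> k) = (1/4)^k" for k using C3_pos by (simp add: \<delta>_def)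
  have "\<exists>u\<in>V. energy u u < m + \<delta> k" for k
    using cINF_less_iff[OF _ bdd, of "m + \<delta> k"] gV \<delta>[of k] unfolding m_def by auto
  then obtain U where U: "\<And>k. U k \<in> V" "\<And>k. energy (U k) (U k) < m + \<delta> k" by metis
  have near: "Hs_sq s (\<lambda>x. u x - v x) \<le> (1/4)^k"
    if uv: "u \<in> V" "v \<in> V" and e: "energy u u \<le> m + \<delta> k" "energy v v \<le> m + \<delta> k" for u v k
  proof -
    note H = VH[OF uv(1)] VH[OF uv(2)]
    have "energy (\<lambda>x. 1 * u x + (-1) * v x) (\<lambda>x. 1 * u x + (-1) * v x) + 4 * energy (\<lambda>x. (1/2) * u x + (1/2) * v x) (\<lambda>x. (1/2) * u x + (1/2) * v x)
      = 2 * energy u u + 2 * energy v v"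
      unfolding energy_square_lincomb[OF H] by (simp add: power2_eq_square)
    moreover have "m \<le> energy (\<lambda>x. (1/2) * u x + (1/2) * v x) (\<lambda>x. (1/2) * u x + (1/2) * v x)"
      by (rule m_le[OF Vmid[OF uv]])
    ultimately have "energy (\<lambda>x. u x - v x) (\<lambda>x. u x - v x) \<le> 4 * \<delta> k" using e by simp
    then have "C3 * energy (\<lambda>x. u x - v x) (\<lambda>x. u x - v x) \<le> C3 * (4 * \<delta> k)"
      using C3_pos by (intro mult_left_mono) auto
    moreover have "Hs_sq s (\<lambda>x. u x - v x) \<le> C3 * energy (\<lambda>x. u x - v x) (\<lambda>x. u x - v x)"
      by (rule Hs_sq_le_energy[OF Hs_diff[OF H] AE_I2]) (use Voff[OF uv(1)] Voff[OF uv(2)] in auto)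
    ultimately show ?thesis by (simp add: \<delta>C3)
  qed
  have cauchy: "Hs_sq s (\<lambda>x. U l x - U k x) \<le> (1/4)^k" if "k \<le> l" for k l
    using U(2)[of l] U(2)[of k] \<delta>_mono[OF that] by (intro near U) auto
  obtain u where u: "u \<in> Hs s" "\<And>k. Hs_sq s (\<lambda>x. u x - U k x) \<le> 2 * (1/4)^k"
    by (rule Hs_complete[of U s]) (use VH U cauchy in auto)
  have UH: "U k \<in> Hs s" for k by (rule VH[OF U(1)])
  have tilde: "(\<lambda>x. u x - g x) \<in> Hs_tilde s \<Omega>"
  proof (rule Hs_tildeI[OF Hs_diff[OF u(1) gH]])
    fix \<epsilon> :: real assume e: "\<epsilon> > 0"
    obtain k where k: "(1/4::real)^k < \<epsilon> / 2" using real_arch_pow_inv[of "\<epsilon>/2" "1/4"] e by auto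
    have "Hs_sq s (\<lambda>x. u x - g x - (U k x - g x)) < \<epsilon>" using u(2)[of k] k by simp
    then show "\<exists>\<phi>\<in>test_functions \<Omega>. Hs_sq s (\<lambda>x. u x - g x - \<phi> x) < \<epsilon>"
      using U(1)[of k] by (intro bexI[where x="\<lambda>x. U k x - g x"]) (simp_all add: V_def)
  qed
  \<comment> \<open>The Euler-Lagrange equation: \<open>energy (U k) \<phi>\<close> is small since \<open>U k + t \<phi>\<close> cannot lower the energy
    below the infimum for any \<open>t\<close>.\<close>
  have EL_test: "energy u \<phi> = 0" if \<phi>: "\<phi> \<in> test_functions \<Omega>" for \<phi>
  proof -
    have \<phi>H: "\<phi> \<in> Hs s" by (rule test_functions_Hs[OF s \<phi>])
    have approx: "(energy (U k) \<phi>)\<^sup>2 \<le> \<delta> k * energy \<phi> \<phi>" for k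
    proof (rule discriminant_le[OF _ energy_nonneg])
      fix t
      have "m \<le> energy (\<lambda>x. 1 * U k x + t * \<phi> x) (\<lambda>x. 1 * U k x + t * \<phi> x)"
        using m_le[OF Vaff[OF U(1) \<phi>, of k t]] by simp
      then show "0 \<le> \<delta> k + 2 * t * energy (U k) \<phi> + t\<^sup>2 * energy \<phi> \<phi>"
        unfolding energy_square_lincomb[OF UH \<phi>H] using U(2)[of k] by simp
    qed
    have "(energy u \<phi>)\<^sup>2 \<le> 0"
    proof (rule squeeze_geometric)
      fix k
      have dH: "(\<lambda>x. u x - U k x) \<in> Hs s" by (rule Hs_diff[OF u(1) UH])
      have "(energy (\<lambda>x. u x - U k x) \<phi>)\<^sup>2 \<le> energy (\<lambda>x. u x - U k x) (\<lambda>x. u x - U k x) * energy \<phi> \<phi>"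
        by (rule energy_CS[OF dH \<phi>H])
      also have "\<dots> \<le> ((C1 + \<bar>q1\<bar>) * (2 * (1/4)^k)) * energy \<phi> \<phi>"
      proof (intro mult_right_mono energy_nonneg)
        have "energy (\<lambda>x. u x - U k x) (\<lambda>x. u x - U k x) \<le> (C1 + \<bar>q1\<bar>) * Hs_sq s (\<lambda>x. u x - U k x)"
          by (rule energy_le[OF dH])
        also have "\<dots> \<le> (C1 + \<bar>q1\<bar>) * (2 * (1/4)^k)"
          using C1_C2_nonneg by (intro mult_left_mono u(2)) auto
        finally show "energy (\<lambda>x. u x - U k x) (\<lambda>x. u x - U k x) \<le> (C1 + \<bar>q1\<bar>) * (2 * (1/4)^k)" .
      qed
      finally have 1: "(energy (\<lambda>x. u x - U k x) \<phi>)\<^sup>2 \<le> ((C1 + \<bar>q1\<bar>) * (2 * (1/4)^k)) * energy \<phi> \<phi>" .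
      have "energy u \<phi> = 1 * energy (\<lambda>x. u x - U k x) \<phi> + 1 * energy (U k) \<phi>"
        using energy_diff[OF u(1) UH \<phi>H] by simp
      then have "(energy u \<phi>)\<^sup>2 \<le> 2 * (energy (\<lambda>x. u x - U k x) \<phi>)\<^sup>2 + 2 * (energy (U k) \<phi>)\<^sup>2"
        using square_lincomb_le[of 1 "energy (\<lambda>x. u x - U k x) \<phi>" 1 "energy (U k) \<phi>"] by simp
      also have "\<dots> \<le> 2 * (((C1 + \<bar>q1\<bar>) * (2 * (1/4)^k)) * energy \<phi> \<phi>) + 2 * (\<delta> k * energy \<phi> \<phi>)"
        using 1 approx[of k] by linarith
      also have "\<dots> = ((4 * (C1 + \<bar>q1\<bar>) + 2 / (4 * C3)) * energy \<phi> \<phi>) * (1/4)^k"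
        using C3_pos by (simp add: \<delta>_def field_simps)
      finally show "(energy u \<phi>)\<^sup>2 \<le> ((4 * (C1 + \<bar>q1\<bar>) + 2 / (4 * C3)) * energy \<phi> \<phi>) * (1/4)^k" .
    qed
    then show ?thesis by simp
  qed
  have EL: "energy u v = 0" if v: "v \<in> Hs_tilde s \<Omega>" for v
  proof -
    have vH: "v \<in> Hs s" by (rule Hs_tilde_Hs[OF v])
    have "(energy u v)\<^sup>2 \<le> 0"
    proof (rule squeeze_geometric)
      fix k
      obtain \<phi> where \<phi>: "\<phi> \<in> test_functions \<Omega>" "Hs_sq s (\<lambda>x. v x - \<phi> x) < (1/4)^k"
        by (rule Hs_tilde_approx[OF v, of "(1/4)^k"]) auto
      have \<phi>H: "\<phi> \<in> Hs s" by (rule test_functions_Hs[OF s \<phi>(1)])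
      have dH: "(\<lambda>x. v x - \<phi> x) \<in> Hs s" by (rule Hs_diff[OF vH \<phi>H])
      have "energy u v = energy u (\<lambda>x. v x - \<phi> x)"
        using energy_diff[OF vH \<phi>H u(1)] EL_test[OF \<phi>(1)] by (simp add: energy_sym[of _ u])
      then have "(energy u v)\<^sup>2 \<le> energy u u * energy (\<lambda>x. v x - \<phi> x) (\<lambda>x. v x - \<phi> x)"
        using energy_CS[OF u(1) dH] by simp
      also have "\<dots> \<le> energy u u * ((C1 + \<bar>q1\<bar>) * (1/4)^k)"
      proof (intro mult_left_mono energy_nonneg)
        have "energy (\<lambda>x. v x - \<phi> x) (\<lambda>x. v x - \<phi> x) \<le> (C1 + \<bar>q1\<bar>) * Hs_sq s (\<lambda>x. v x - \<phi> x)"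
          by (rule energy_le[OF dH])
        also have "\<dots> \<le> (C1 + \<bar>q1\<bar>) * (1/4)^k"
          using C1_C2_nonneg \<phi>(2) by (intro mult_left_mono) auto
        finally show "energy (\<lambda>x. v x - \<phi> x) (\<lambda>x. v x - \<phi> x) \<le> (C1 + \<bar>q1\<bar>) * (1/4)^k" .
      qed
      finally show "(energy u v)\<^sup>2 \<le> (energy u u * (C1 + \<bar>q1\<bar>)) * (1/4)^k" by (simp add: mult.assoc)
    qed
    then show ?thesis by simp
  qed
  have sol: "lin_solution s \<Omega> A q g u"
    unfolding lin_solution_iff[OF gH] using u(1) tilde EL by blast
  have um: "u \<in> borel_measurable lebesgue" by (rule HsD(1)[OF u(1)])
  have "AE x in lebesgue. T u x = u x"
  proof -
    note [measurable] = um
    have Tm: "T w \<in> borel_measurable lebesgue" if "w \<in> borel_measurable lebesgue" for w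
    proof -
      have "continuous_on UNIV (soft_clamp M)"
        by (rule continuous_on_subset[OF lipschitz_on_continuous_on[of 1 UNIV]])
           (auto intro!: lipschitz_onI simp: dist_real_def soft_clamp_lipschitz)
      then have "soft_clamp M \<in> borel_measurable borel" by (rule borel_measurable_continuous_onI)
      from measurable_compose[OF that this] show ?thesis by (simp add: T_def)
    qed
    have bound: "(T u x - u x)\<^sup>2 \<le> 6 * (u x - U k x)\<^sup>2 + 3 * (T (U k) x - U k x)\<^sup>2" for x k
    proof -
      have 3: "(a + b + c)\<^sup>2 \<le> 3 * a\<^sup>2 + 3 * b\<^sup>2 + 3 * c\<^sup>2" for a b c :: real
        using zero_le_power2[of "a - b"] zero_le_power2[of "b - c"] zero_le_power2[of "a - c"]
        by (simp add: power2_eq_square algebra_simps)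
      have "(T u x - T (U k) x)\<^sup>2 \<le> (u x - U k x)\<^sup>2"
        using soft_clamp_lipschitz[of M "u x" "U k x"] by (simp add: T_def abs_le_square_iff)
      moreover have "(U k x - u x)\<^sup>2 = (u x - U k x)\<^sup>2" by (rule power2_commute)
      moreover have "T u x - u x = (T u x - T (U k) x) + (T (U k) x - U k x) + (U k x - u x)" by simp
      ultimately show ?thesis
        using 3[of "T u x - T (U k) x" "T (U k) x - U k x" "U k x - u x"] by simp
    qed
    have near_T: "Hs_sq s (\<lambda>x. T (U k) x - U k x) \<le> (1/4)^k" for k
    proof (rule near[OF VT[OF U(1)] U(1)])
      have "energy (T (U k)) (T (U k)) \<le> energy (U k) (U k)"
        unfolding T_def
        by (rule energy_clamp_le[OF M0 M UH]) (use VH[OF VT[OF U(1)], of k] Voff[OF U(1)] in \<open>auto simp: T_def\<close>)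
      then show "energy (T (U k)) (T (U k)) \<le> m + \<delta> k" using U(2)[of k] by simp
      show "energy (U k) (U k) \<le> m + \<delta> k" using U(2)[of k] by simp
    qed
    have i2: "integrable lebesgue (\<lambda>x. 6 * (u x - U k x)\<^sup>2 + 3 * (T (U k) x - U k x)\<^sup>2)" for k
      using HsD(2)[OF Hs_diff[OF u(1) UH[of k]]] HsD(2)[OF Hs_diff[OF VH[OF VT[OF U(1)]] UH], of k k]
      by (intro Bochner_Integration.integrable_add integrable_mult_right)
    have i1: "integrable lebesgue (\<lambda>x. (T u x - u x)\<^sup>2)"
    proof (rule Bochner_Integration.integrable_bound[OF i2[of 0]])
      show "(\<lambda>x. (T u x - u x)\<^sup>2) \<in> borel_measurable lebesgue"
        using Tm[OF um] by measurable
      show "AE x in lebesgue. norm ((T u x - u x)\<^sup>2) \<le> norm (6 * (u x - U 0 x)\<^sup>2 + 3 * (T (U 0) x - U 0 x)\<^sup>2)"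
        using bound[of _ 0] by (intro AE_I2) simp
    qed
    have "(\<integral>x. (T u x - u x)\<^sup>2 \<partial>lebesgue) \<le> 0"
    proof (rule squeeze_geometric)
      fix k
      have "(\<integral>x. (T u x - u x)\<^sup>2 \<partial>lebesgue) \<le> (\<integral>x. 6 * (u x - U k x)\<^sup>2 + 3 * (T (U k) x - U k x)\<^sup>2 \<partial>lebesgue)"
        by (rule integral_mono[OF i1 i2 bound])
      also have "\<dots> = 6 * (\<integral>x. (u x - U k x)\<^sup>2 \<partial>lebesgue) + 3 * (\<integral>x. (T (U k) x - U k x)\<^sup>2 \<partial>lebesgue)"
        using HsD(2)[OF Hs_diff[OF u(1) UH[of k]]] HsD(2)[OF Hs_diff[OF VH[OF VT[OF U(1)]] UH], of k k] by simp
      also have "\<dots> \<le> 6 * (2 * (1/4)^k) + 3 * (1/4)^k"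
        using u(2)[of k] near_T[of k] Hs_sq_parts(2)[of s "\<lambda>x. u x - U k x"] Hs_sq_parts(2)[of s "\<lambda>x. T (U k) x - U k x"]
        unfolding Hs_sq_def by linarith
      finally show "(\<integral>x. (T u x - u x)\<^sup>2 \<partial>lebesgue) \<le> 15 * (1/4)^k" by simp
    qed
    then have "(\<integral>x. (T u x - u x)\<^sup>2 \<partial>lebesgue) = 0"
      by (intro antisym Bochner_Integration.integral_nonneg) auto
    then have "AE x in lebesgue. (T u x - u x)\<^sup>2 = 0"
      using integral_nonneg_eq_0_iff_AE[OF i1] by auto
    then show ?thesis by eventually_elim simp
  qed
  then have "AE x in lebesgue. 0 \<le> u x \<and> u x \<le> M"
    by eventually_elim (use soft_clamp_fixed_iff[OF M0] in \<open>auto simp: T_def\<close>)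
  then show ?thesis using that sol by blast
qed

lemma lin_solution_bounded:
  assumes g: "g \<in> test_functions W" "\<And>x. 0 \<le> g x \<and> g x \<le> M" and u: "lin_solution s \<Omega> A q g u"
  shows "AE x in lebesgue. 0 \<le> u x \<and> u x \<le> M"
proof -
  obtain v where v: "lin_solution s \<Omega> A q g v" "AE x in lebesgue. 0 \<le> v x \<and> v x \<le> M"
    using lin_solution_exists_bounded[OF g] by blast
  show ?thesis
    using lin_solution_unique[OF u v(1) test_functions_Hs[OF s g(1)]] v(2)
    by eventually_elim simp
qed

lemma lin_solve_bounded:
  assumes g: "g \<in> test_functions W" "\<And>x. 0 \<le> g x \<and> g x \<le> M"
  shows "AE x in lebesgue. 0 \<le> lin_solve s \<Omega> A q g x \<and> lin_solve s \<Omega> A q g x \<le> M"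
proof -
  obtain v where "lin_solution s \<Omega> A q g v"
    using lin_solution_exists_bounded[OF g] by blast
  then have "lin_solution s \<Omega> A q g (lin_solve s \<Omega> A q g)"
    unfolding lin_solve_def by (rule someI[where P="lin_solution s \<Omega> A q g"])
  then show ?thesis by (rule lin_solution_bounded[OF g])
qed

end

section \<open>Unique continuation\<close>

text \<open>The functions \<open>(\<xi> \<bullet> z)\<^sup>m |z|\<^bsup>-2\<beta>\<^esup>\<close>. The derivative in direction \<open>\<xi>\<close> of such a function is a combination of two
  functions of this kind, see \<open>riesz_deriv\<close>; this is why powers of one linear functional are used
  instead of general monomials.\<close>

definition riesz :: "real^'n \<Rightarrow> nat \<Rightarrow> real \<Rightarrow> real^'n \<Rightarrow> real" where
  "riesz \<xi> m \<beta> z = (\<xi> \<bullet> z) ^ m * (z \<bullet> z) powr (- \<beta>)"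

lemma riesz_bound:
  assumes "d > 0" "d \<le> norm z" "norm z \<le> R" "\<beta> \<ge> 0"
  shows "\<bar>riesz \<xi> m \<beta> z\<bar> \<le> (norm \<xi> * R) ^ m * (d\<^sup>2) powr (- \<beta>)"
proof -
  have "\<bar>\<xi> \<bullet> z\<bar> \<le> norm \<xi> * R"
    using Cauchy_Schwarz_ineq2[of \<xi> z] assms by (meson mult_left_mono norm_ge_zero order_trans)
  then have 1: "\<bar>\<xi> \<bullet> z\<bar> ^ m \<le> (norm \<xi> * R) ^ m" by (intro power_mono) auto
  have "d\<^sup>2 \<le> z \<bullet> z" using assms by (simp add: dot_square_norm power_mono)
  then have 2: "(z \<bullet> z) powr (- \<beta>) \<le> (d\<^sup>2) powr (- \<beta>)"
    using assms by (intro powr_mono2') auto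
  show ?thesis unfolding riesz_def abs_mult power_abs
    using 1 2 order_trans[OF norm_ge_zero assms(3)] by (intro mult_mono) auto
qed

lemma riesz_deriv:
  assumes "x + t *\<^sub>R \<xi> - y \<noteq> 0"
  shows "((\<lambda>t. riesz \<xi> m \<beta> (x + t *\<^sub>R \<xi> - y)) has_real_derivative
     (real m * (\<xi> \<bullet> \<xi>) * riesz \<xi> (m - 1) \<beta> (x + t *\<^sub>R \<xi> - y) - 2 * \<beta> * riesz \<xi> (Suc m) (\<beta> + 1) (x + t *\<^sub>R \<xi> - y))) (at t)"
proof -
  define z where "z t = x + t *\<^sub>R \<xi> - y" for t
  have z1: "((\<lambda>t. \<xi> \<bullet> z t) has_real_derivative \<xi> \<bullet> \<xi>) (at t)"
    unfolding z_def has_field_derivative_def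
    by (auto intro!: derivative_eq_intros simp: inner_right_distrib inner_diff_right)
  have z2: "((\<lambda>t. z t \<bullet> z t) has_real_derivative 2 * (\<xi> \<bullet> z t)) (at t)"
    unfolding z_def has_field_derivative_def
    by (auto intro!: derivative_eq_intros simp: algebra_simps inner_commute)
  have pos: "z t \<bullet> z t > 0" using assms by (simp add: z_def)
  have "((\<lambda>t. (\<xi> \<bullet> z t) ^ m * (z t \<bullet> z t) powr (- \<beta>)) has_real_derivative
     (\<xi> \<bullet> z t) ^ m * ((- \<beta>) * (z t \<bullet> z t) powr (- \<beta> - 1) * (2 * (\<xi> \<bullet> z t))) + (real m * (\<xi> \<bullet> z t) ^ (m - 1) * (\<xi> \<bullet> \<xi>)) * (z t \<bullet> z t) powr (- \<beta>)) (at t)"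
    by (rule derivative_eq_intros DERIV_fun_powr[OF z2 pos] z1 refl | simp)+
  moreover have "- \<beta> - 1 = - (\<beta> + 1)" by simp
  ultimately have "((\<lambda>t. (\<xi> \<bullet> z t) ^ m * (z t \<bullet> z t) powr (- \<beta>)) has_real_derivative
     (\<xi> \<bullet> z t) ^ m * ((- \<beta>) * (z t \<bullet> z t) powr (- (\<beta> + 1)) * (2 * (\<xi> \<bullet> z t))) + (real m * (\<xi> \<bullet> z t) ^ (m - 1) * (\<xi> \<bullet> \<xi>)) * (z t \<bullet> z t) powr (- \<beta>)) (at t)"
    by (simp only:)
  then show ?thesis
    unfolding riesz_def z_def[symmetric] by (rule DERIV_cong) (simp add: algebra_simps)
qed

lemma riesz_measurable: "(\<lambda>y. riesz \<xi> m \<beta> (x - y)) \<in> borel_measurable lebesgue"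
  unfolding riesz_def by (rule measurable_lebesgueI) measurable

text \<open>Differentiation under the integral sign: the difference quotients integrate to zero, and by the
  mean value theorem they are dominated.\<close>

lemma integral_zero_directional_deriv:
  fixes G G' :: "real^'n \<Rightarrow> real^'n \<Rightarrow> real"
  assumes w: "integrable lebesgue w" and w0: "\<And>y. y \<notin> K \<Longrightarrow> w y = 0"
    and B: "open B"
    and meas: "\<And>x. G x \<in> borel_measurable lebesgue" "\<And>x. G' x \<in> borel_measurable lebesgue"
    and deriv: "\<And>x y t. x + t *\<^sub>R \<xi> \<in> B \<Longrightarrow> y \<in> K \<Longrightarrow> ((\<lambda>t. G (x + t *\<^sub>R \<xi>) y) has_real_derivative G' (x + t *\<^sub>R \<xi>) y) (at t)"
    and bnd: "\<And>x y. x \<in> B \<Longrightarrow> y \<in> K \<Longrightarrow> \<bar>G x y\<bar> \<le> C" "\<And>x y. x \<in> B \<Longrightarrow> y \<in> K \<Longrightarrow> \<bar>G' x y\<bar> \<le> C'"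
    and zero: "\<And>x. x \<in> B \<Longrightarrow> (\<integral>y. w y * G x y \<partial>lebesgue) = 0"
    and x: "x \<in> B"
  shows "(\<integral>y. w y * G' x y \<partial>lebesgue) = 0"
proof -
  note wm = borel_measurable_integrable[OF w]
  obtain e where e: "e > 0" "ball x e \<subseteq> B" using B x openE by blast
  define \<delta> where "\<delta> = e / (norm \<xi> + 1)"
  have \<delta>: "\<delta> > 0" using e by (simp add: \<delta>_def add_nonneg_pos)
  have inB: "x + t *\<^sub>R \<xi> \<in> B" if "\<bar>t\<bar> < \<delta>" for t
  proof -
    have "\<bar>t\<bar> * norm \<xi> \<le> \<bar>t\<bar> * (norm \<xi> + 1)" by (intro mult_left_mono) auto
    also have "\<dots> < \<delta> * (norm \<xi> + 1)" using that by (intro mult_strict_right_mono) (auto simp: add_nonneg_pos)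
    also have "\<dots> = e" by (simp add: \<delta>_def add_nonneg_eq_0_iff)
    finally show ?thesis using e by (auto simp: dist_norm)
  qed
  define t where "t m = \<delta> / real (m + 2)" for m :: nat
  have t: "0 < t m" "t m < \<delta>" for m
    using \<delta> by (auto simp: t_def field_simps add_strict_increasing)
  have t_lim: "t \<longlonglongrightarrow> 0" unfolding t_def by real_asymp
  define Q where "Q m y = (G (x + t m *\<^sub>R \<xi>) y - G x y) / t m" for m y
  have G_int: "integrable lebesgue (\<lambda>y. w y * G x' y)" if "x' \<in> B" for x'
    by (rule integrable_mult_bounded_on[OF w meas(1) w0 bnd(1)[OF that]])
  have "(\<lambda>m. \<integral>y. w y * Q m y \<partial>lebesgue) \<longlonglongrightarrow> (\<integral>y. w y * G' x y \<partial>lebesgue)"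
  proof (rule integral_dominated_convergence[where w="\<lambda>y. C' * norm (w y)"])
    show "(\<lambda>y. w y * G' x y) \<in> borel_measurable lebesgue" using wm meas by measurable
    show "(\<lambda>y. w y * Q m y) \<in> borel_measurable lebesgue" for m
      unfolding Q_def using wm meas by measurable
    show "integrable lebesgue (\<lambda>y. C' * norm (w y))" using w by simp
    show "AE y in lebesgue. (\<lambda>m. w y * Q m y) \<longlonglongrightarrow> w y * G' x y"
    proof (rule AE_I2)
      fix y
      show "(\<lambda>m. w y * Q m y) \<longlonglongrightarrow> w y * G' x y"
      proof (cases "y \<in> K")
        case True
        have "((\<lambda>h. (G (x + (0 + h) *\<^sub>R \<xi>) y - G (x + 0 *\<^sub>R \<xi>) y) / h) \<longlongrightarrow> G' (x + 0 *\<^sub>R \<xi>) y) (at 0)"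
          using deriv[of x 0 y] x True unfolding DERIV_def by simp
        then have "((\<lambda>h. (G (x + h *\<^sub>R \<xi>) y - G x y) / h) \<longlongrightarrow> G' x y) (at 0)" by simp
        moreover have "filterlim t (at 0) sequentially"
          using t_lim t by (auto simp: filterlim_at intro!: always_eventually) (metis less_irrefl)
        ultimately have "(\<lambda>m. Q m y) \<longlonglongrightarrow> G' x y"
          unfolding Q_def by (rule filterlim_compose)
        then show ?thesis by (intro tendsto_intros)
      qed (simp add: w0)
    qed
    have "\<bar>Q m y\<bar> \<le> C'" if y: "y \<in> K" for m y
    proof -
      have "\<exists>z>0. z < t m \<and> G (x + t m *\<^sub>R \<xi>) y - G (x + 0 *\<^sub>R \<xi>) y = (t m - 0) * G' (x + z *\<^sub>R \<xi>) y"
        by (rule MVT2[OF t(1)]) (use t[of m] inB y in \<open>auto intro!: deriv\<close>)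
      then obtain z where z: "0 < z" "z < t m" "G (x + t m *\<^sub>R \<xi>) y - G x y = t m * G' (x + z *\<^sub>R \<xi>) y" by auto
      then have "Q m y = G' (x + z *\<^sub>R \<xi>) y" using t[of m] by (simp add: Q_def)
      moreover have "\<bar>G' (x + z *\<^sub>R \<xi>) y\<bar> \<le> C'"
        using z t[of m] by (intro bnd(2)[OF inB y]) auto
      ultimately show ?thesis by simp
    qed
    then show "AE y in lebesgue. norm (w y * Q m y) \<le> C' * norm (w y)" for m
      by (intro AE_I2 norm_mult_le_on[OF w0]) auto
  qed
  moreover have "(\<integral>y. w y * Q m y \<partial>lebesgue) = 0" for m
  proof -
    have b: "x + t m *\<^sub>R \<xi> \<in> B" using t[of m] by (intro inB) auto
    have "(\<integral>y. w y * Q m y \<partial>lebesgue) = (\<integral>y. (w y * G (x + t m *\<^sub>R \<xi>) y - w y * G x y) / t m \<partial>lebesgue)"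
      by (intro Bochner_Integration.integral_cong) (auto simp: Q_def right_diff_distrib)
    also have "\<dots> = 0" using G_int[OF b] G_int[OF x] zero[OF b] zero[OF x] by simp
    finally show ?thesis .
  qed
  ultimately have "(\<lambda>m::nat. 0::real) \<longlonglongrightarrow> (\<integral>y. w y * G' x y \<partial>lebesgue)" by simp
  then show ?thesis by (simp add: LIMSEQ_const_iff)
qed

text \<open>The span of the functions \<open>exp (\<xi> \<bullet> \<zeta> y)\<close>. It is an algebra since a product of two exponentials is an
  exponential again.\<close>

inductive exp_span :: "(real^'n \<Rightarrow> real^'n) \<Rightarrow> (real^'n \<Rightarrow> real) \<Rightarrow> bool" for \<zeta> where
  gen: "exp_span \<zeta> (\<lambda>y. c * exp (\<xi> \<bullet> \<zeta> y))"
| add: "exp_span \<zeta> f \<Longrightarrow> exp_span \<zeta> g \<Longrightarrow> exp_span \<zeta> (\<lambda>y. f y + g y)"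

lemma exp_span_mult_gen: "exp_span \<zeta> g \<Longrightarrow> exp_span \<zeta> (\<lambda>y. (c * exp (\<xi> \<bullet> \<zeta> y)) * g y)"
proof (induction rule: exp_span.induct)
  case (gen d \<eta>)
  have "(\<lambda>y. (c * exp (\<xi> \<bullet> \<zeta> y)) * (d * exp (\<eta> \<bullet> \<zeta> y))) = (\<lambda>y. (c * d) * exp ((\<xi> + \<eta>) \<bullet> \<zeta> y))"
    by (auto simp: inner_add_left exp_add)
  then show ?case using exp_span.gen[of \<zeta> "c * d" "\<xi> + \<eta>"] by simp
next
  case (add f g)
  then show ?case using exp_span.add[OF add.IH] by (simp add: distrib_left)
qed

lemma exp_span_mult: "exp_span \<zeta> f \<Longrightarrow> exp_span \<zeta> g \<Longrightarrow> exp_span \<zeta> (\<lambda>y. f y * g y)"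
proof (induction rule: exp_span.induct)
  case (gen c \<xi>)
  then show ?case by (rule exp_span_mult_gen)
next
  case (add f1 f2)
  then show ?case using exp_span.add[OF add.IH(1)[OF add.prems] add.IH(2)[OF add.prems]] by (simp add: distrib_right)
qed

lemma exp_span_const: "exp_span \<zeta> (\<lambda>y. c)"
  using exp_span.gen[of \<zeta> c 0] by simp

lemma exp_span_continuous: "exp_span \<zeta> f \<Longrightarrow> continuous_on S \<zeta> \<Longrightarrow> continuous_on S f"
  by (induction rule: exp_span.induct) (auto intro!: continuous_intros)

lemma exp_span_dense:
  assumes "compact S" "continuous_on S \<zeta>" "inj_on \<zeta> S" "continuous_on S f" "e > 0"
  shows "\<exists>g. exp_span \<zeta> g \<and> (\<forall>y\<in>S. \<bar>f y - g y\<bar> < e)"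
proof -
  interpret function_ring_on "{f. exp_span \<zeta> f}" S
  proof
    fix x y assume xy: "x \<in> S" "y \<in> S" "x \<noteq> y"
    then have "\<zeta> x \<noteq> \<zeta> y" using assms(3) by (auto simp: inj_on_def)
    then have "(\<zeta> x - \<zeta> y) \<bullet> (\<zeta> x - \<zeta> y) \<noteq> 0" by simp
    then have "(\<zeta> x - \<zeta> y) \<bullet> \<zeta> x \<noteq> (\<zeta> x - \<zeta> y) \<bullet> \<zeta> y" by (simp add: inner_diff_right)
    then show "\<exists>f\<in>{f. exp_span \<zeta> f}. f x \<noteq> f y"
      using exp_span.gen[of \<zeta> 1 "\<zeta> x - \<zeta> y"] by (intro bexI[where x="\<lambda>y'. 1 * exp ((\<zeta> x - \<zeta> y) \<bullet> \<zeta> y')"]) auto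
  qed (use assms exp_span_continuous exp_span_mult exp_span_const exp_span.add in auto)
  show ?thesis using Stone_Weierstrass_basic[OF assms(4,5)] by auto
qed

lemma inversion_inj:
  assumes "(y::'a::real_inner) \<noteq> x" "y' \<noteq> x" "(1 / ((x - y) \<bullet> (x - y))) *\<^sub>R (x - y) = (1 / ((x - y') \<bullet> (x - y'))) *\<^sub>R (x - y')"
  shows "y = y'"
proof -
  define a where "a = x - y"
  define b where "b = x - y'"
  have ab: "a \<noteq> 0" "b \<noteq> 0" using assms by (auto simp: a_def b_def)
  have e: "(1 / (a \<bullet> a)) *\<^sub>R a = (1 / (b \<bullet> b)) *\<^sub>R b" using assms(3) by (simp add: a_def b_def)
  have "((1 / (a \<bullet> a)) *\<^sub>R a) \<bullet> ((1 / (a \<bullet> a)) *\<^sub>R a) = ((1 / (b \<bullet> b)) *\<^sub>R b) \<bullet> ((1 / (b \<bullet> b)) *\<^sub>R b)"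
    by (simp only: e)
  then have "1 / (a \<bullet> a) = 1 / (b \<bullet> b)" using ab by simp
  then have "a = b" using e ab by (metis divide_eq_0_iff inner_eq_zero_iff real_vector.scale_cancel_left zero_neq_one)
  then show ?thesis by (simp add: a_def b_def)
qed

text \<open>Let \<open>z = x - y\<close> and \<open>2 \<beta>\<^sub>0 = n + 2 s\<close>. Repeated differentiation of the hypothesis shows that
  \<open>\<integral> w(y) (\<xi> \<bullet> z)\<^sup>m |z|\<^bsup>-2(\<beta>\<^sub>0+k)\<^esup> dy = 0\<close> for all \<open>m \<le> k\<close>: a derivative in direction \<open>\<xi>\<close> raises \<open>m\<close> and \<open>k\<close> by one, up to
  a multiple of a term that is already known to vanish. For \<open>m = 0\<close> the exponent is raised by
  differentiating the case \<open>m = 1\<close> once more and summing over an orthonormal basis, which gives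
  \<open>(n - 2 \<beta>) \<integral> w(y) |z|\<^bsup>-2\<beta>\<^esup> dy = 0\<close> with \<open>2 \<beta> > n\<close>.

  Now fix \<open>x\<close> and let \<open>\<zeta> = z / |z|\<^sup>2\<close> be the inverted variable. The case \<open>m = k\<close> says that \<open>w |z|\<^bsup>-n-2s\<^esup>\<close> is
  orthogonal to all powers \<open>(\<xi> \<bullet> \<zeta>)\<^sup>m\<close>, and so to all exponentials \<open>exp (\<xi> \<bullet> \<zeta>)\<close>. As the inversion is
  injective, these span a dense set of continuous functions by the Stone-Weierstrass theorem.\<close>

lemma riesz_potential_injective:
  fixes w :: "real^'n \<Rightarrow> real"
  assumes s: "s > 0" and w: "integrable lebesgue w" and K: "compact K" and w0: "\<And>y. y \<notin> K \<Longrightarrow> w y = 0"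
    and e: "e > 0" and d: "d > 0" "\<And>x y. x \<in> ball x0 e \<Longrightarrow> y \<in> K \<Longrightarrow> d \<le> norm (x - y)"
    and zero: "\<And>x. x \<in> ball x0 e \<Longrightarrow> (\<integral>y. w y * ((x - y) \<bullet> (x - y)) powr (- (real CARD('n) / 2 + s)) \<partial>lebesgue) = 0"
  shows "AE y in lebesgue. w y = 0"
proof -
  note wm = borel_measurable_integrable[OF w]
  define \<beta>0 where "\<beta>0 = real CARD('n) / 2 + s"
  have \<beta>0: "\<beta>0 > 0" using s by (simp add: \<beta>0_def)
  obtain R0 where R0: "\<And>y. y \<in> K \<Longrightarrow> norm y \<le> R0" using compact_imp_bounded[OF K] by (auto simp: bounded_iff)
  define R where "R = norm x0 + e + R0"
  have far: "norm (x - y) \<le> R" if "x \<in> ball x0 e" "y \<in> K" for x y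
  proof -
    have "norm (x - x0) < e" using that by (simp add: dist_norm norm_minus_commute)
    moreover have "norm x \<le> norm x0 + norm (x - x0)" by (metis add_diff_cancel_left' diff_add_cancel norm_triangle_ineq add.commute)
    moreover have "norm (x - y) \<le> norm x + norm y" by (rule norm_triangle_ineq4)
    ultimately show ?thesis using R0[OF that(2)] by (simp add: R_def)
  qed
  define J where "J m \<beta> \<xi> x = (\<integral>y. w y * riesz \<xi> m \<beta> (x - y) \<partial>lebesgue)" for m \<beta> \<xi> x
  have bnd: "\<bar>riesz \<xi> m \<beta> (x - y)\<bar> \<le> (norm \<xi> * R) ^ m * (d\<^sup>2) powr (- \<beta>)" if "x \<in> ball x0 e" "y \<in> K" "\<beta> \<ge> 0" for x y \<xi> m \<beta>
    by (rule riesz_bound[OF d(1) d(2)[OF that(1,2)] far[OF that(1,2)] that(3)])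
  have int: "integrable lebesgue (\<lambda>y. w y * riesz \<xi> m \<beta> (x - y))" if "x \<in> ball x0 e" "\<beta> \<ge> 0" for x \<xi> m \<beta>
    by (rule integrable_mult_bounded_on[OF w riesz_measurable w0 bnd[OF that(1) _ that(2)]])
  have step: "real m * (\<xi> \<bullet> \<xi>) * J (m - 1) \<beta> \<xi> x - 2 * \<beta> * J (Suc m) (\<beta> + 1) \<xi> x = 0"
    if J0: "\<And>x. x \<in> ball x0 e \<Longrightarrow> J m \<beta> \<xi> x = 0" and \<beta>: "\<beta> \<ge> 0" and x: "x \<in> ball x0 e" for m \<beta> \<xi> x
  proof -
    define G' where "G' x y = real m * (\<xi> \<bullet> \<xi>) * riesz \<xi> (m - 1) \<beta> (x - y) - 2 * \<beta> * riesz \<xi> (Suc m) (\<beta> + 1) (x - y)" for x y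
    have "(\<integral>y. w y * G' x y \<partial>lebesgue) = 0"
    proof (rule integral_zero_directional_deriv[where G="\<lambda>x y. riesz \<xi> m \<beta> (x - y)" and B="ball x0 e" and K=K and \<xi>=\<xi>, OF w w0])
      show "open (ball x0 e)" by simp
      show "(\<lambda>y. riesz \<xi> m \<beta> (x - y)) \<in> borel_measurable lebesgue" for x by (rule riesz_measurable)
      show "G' x \<in> borel_measurable lebesgue" for x
        unfolding G'_def using riesz_measurable by measurable
      show "((\<lambda>t. riesz \<xi> m \<beta> (x + t *\<^sub>R \<xi> - y)) has_real_derivative G' (x + t *\<^sub>R \<xi>) y) (at t)"
        if "x + t *\<^sub>R \<xi> \<in> ball x0 e" "y \<in> K" for x y t
        unfolding G'_def by (rule riesz_deriv) (use d(2)[OF that] d(1) in auto)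
      show "\<bar>riesz \<xi> m \<beta> (x - y)\<bar> \<le> (norm \<xi> * R) ^ m * (d\<^sup>2) powr (- \<beta>)" if "x \<in> ball x0 e" "y \<in> K" for x y
        by (rule bnd[OF that \<beta>])
      show "\<bar>G' x y\<bar> \<le> real m * (\<xi> \<bullet> \<xi>) * ((norm \<xi> * R) ^ (m - 1) * (d\<^sup>2) powr (- \<beta>)) + 2 * \<beta> * ((norm \<xi> * R) ^ Suc m * (d\<^sup>2) powr (- (\<beta> + 1)))"
        if "x \<in> ball x0 e" "y \<in> K" for x y
      proof -
        have "\<bar>real m * (\<xi> \<bullet> \<xi>) * riesz \<xi> (m - 1) \<beta> (x - y)\<bar> \<le> real m * (\<xi> \<bullet> \<xi>) * ((norm \<xi> * R) ^ (m - 1) * (d\<^sup>2) powr (- \<beta>))"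
          unfolding abs_mult[of "real m * (\<xi> \<bullet> \<xi>)"] using bnd[OF that \<beta>, of \<xi> "m - 1"] by (simp add: mult_left_mono)
        moreover have "\<bar>2 * \<beta> * riesz \<xi> (Suc m) (\<beta> + 1) (x - y)\<bar> \<le> 2 * \<beta> * ((norm \<xi> * R) ^ Suc m * (d\<^sup>2) powr (- (\<beta> + 1)))"
          unfolding abs_mult[of "2 * \<beta>"] using bnd[OF that, of "\<beta> + 1" \<xi> "Suc m"] \<beta>
          by (simp add: mult_left_mono del: power_Suc)
        ultimately show ?thesis unfolding G'_def by linarith
      qed
      show "(\<integral>y. w y * riesz \<xi> m \<beta> (x - y) \<partial>lebesgue) = 0" if "x \<in> ball x0 e" for x
        using J0[OF that] by (simp add: J_def)
    qed (use x in auto)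
    also have "(\<integral>y. w y * G' x y \<partial>lebesgue) = (\<integral>y. real m * (\<xi> \<bullet> \<xi>) * (w y * riesz \<xi> (m - 1) \<beta> (x - y)) - 2 * \<beta> * (w y * riesz \<xi> (Suc m) (\<beta> + 1) (x - y)) \<partial>lebesgue)"
      by (intro Bochner_Integration.integral_cong) (auto simp: G'_def algebra_simps)
    also have "\<dots> = real m * (\<xi> \<bullet> \<xi>) * J (m - 1) \<beta> \<xi> x - 2 * \<beta> * J (Suc m) (\<beta> + 1) \<xi> x"
      using int[OF x \<beta>, of \<xi> "m - 1"] int[OF x, of "\<beta> + 1" \<xi> "Suc m"] \<beta> by (simp add: J_def)
    finally show ?thesis by simp
  qed
  have vanish: "\<forall>m\<le>k. \<forall>\<xi>. \<forall>x\<in>ball x0 e. J m (\<beta>0 + real k) \<xi> x = 0" for k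
  proof (induction k)
    case 0
    then show ?case using zero by (simp add: J_def riesz_def \<beta>0_def)
  next
    case (Suc k)
    define \<beta> where "\<beta> = \<beta>0 + real k"
    have \<beta>: "\<beta> > 0" using \<beta>0 by (simp add: \<beta>_def)
    have \<beta>S: "\<beta>0 + real (Suc k) = \<beta> + 1" by (simp add: \<beta>_def)
    have IH: "J m \<beta> \<xi> x = 0" if "m \<le> k" "x \<in> ball x0 e" for m \<xi> x using Suc that by (simp add: \<beta>_def)
    have up: "J (Suc j) (\<beta> + 1) \<xi> x = 0" if j: "j \<le> k" and x: "x \<in> ball x0 e" for j \<xi> x
    proof -
      have "real j * (\<xi> \<bullet> \<xi>) * J (j - 1) \<beta> \<xi> x - 2 * \<beta> * J (Suc j) (\<beta> + 1) \<xi> x = 0"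
        by (rule step) (use IH j x \<beta> in auto)
      moreover have "J (j - 1) \<beta> \<xi> x = 0" using IH j x by auto
      ultimately show ?thesis using \<beta> by simp
    qed
    have base: "J 0 (\<beta> + 1) \<xi> x = 0" if x: "x \<in> ball x0 e" for \<xi> x
    proof -
      have J0: "J 0 (\<beta> + 1) \<eta> x = J 0 (\<beta> + 1) \<xi> x" for \<eta> by (simp add: J_def riesz_def)
      \<comment> \<open>the derivative of the vanishing integral with \<open>m = 1\<close>\<close>
      have 2: "(\<eta> \<bullet> \<eta>) * J 0 (\<beta> + 1) \<xi> x = 2 * (\<beta> + 1) * J 2 (\<beta> + 2) \<eta> x" for \<eta>
      proof -
        have "real 1 * (\<eta> \<bullet> \<eta>) * J (1 - 1) (\<beta> + 1) \<eta> x - 2 * (\<beta> + 1) * J (Suc 1) (\<beta> + 1 + 1) \<eta> x = 0"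
          by (rule step) (use up[of 0] x \<beta> in auto)
        then show ?thesis using J0[of \<eta>] by (simp add: numeral_2_eq_2 add.assoc)
      qed
      have "real CARD('n) * J 0 (\<beta> + 1) \<xi> x = (\<Sum>i\<in>UNIV. (axis i 1 \<bullet> (axis i 1 :: real^'n)) * J 0 (\<beta> + 1) \<xi> x)"
        by (simp add: inner_axis_axis)
      also have "\<dots> = 2 * (\<beta> + 1) * (\<Sum>i\<in>UNIV. J 2 (\<beta> + 2) (axis i 1) x)"
        unfolding 2 by (simp add: sum_distrib_left)
      also have "(\<Sum>i\<in>UNIV. J 2 (\<beta> + 2) (axis i 1) x) = (\<integral>y. (\<Sum>i\<in>UNIV. w y * riesz (axis i 1) 2 (\<beta> + 2) (x - y)) \<partial>lebesgue)"
        unfolding J_def by (rule Bochner_Integration.integral_sum[symmetric]) (use int[OF x] \<beta> in auto)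
      also have "\<dots> = J 0 (\<beta> + 1) \<xi> x"
        unfolding J_def
      proof (intro Bochner_Integration.integral_cong refl)
        fix y
        define z where "z = x - y"
        show "(\<Sum>i\<in>UNIV. w y * riesz (axis i 1) 2 (\<beta> + 2) (x - y)) = w y * riesz \<xi> 0 (\<beta> + 1) (x - y)"
        proof (cases "y \<in> K")
          case True
          have "z \<noteq> 0" using d(2)[OF x True] d(1) by (auto simp: z_def)
          have "(\<Sum>i\<in>UNIV. w y * riesz (axis i 1) 2 (\<beta> + 2) z) = w y * ((\<Sum>i\<in>UNIV. (z $ i)\<^sup>2) * (z \<bullet> z) powr (- (\<beta> + 2)))"
            by (simp add: riesz_def inner_axis' sum_distrib_left sum_distrib_right mult_ac)
          also have "(\<Sum>i\<in>UNIV. (z $ i)\<^sup>2) = z \<bullet> z" by (simp add: inner_vec_def power2_eq_square)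
          also have "z \<bullet> z * (z \<bullet> z) powr (- (\<beta> + 2)) = (z \<bullet> z) powr 1 * (z \<bullet> z) powr (- (\<beta> + 2))" by simp
          also have "\<dots> = (z \<bullet> z) powr (1 + - (\<beta> + 2))" by (rule powr_add[symmetric])
          also have "1 + - (\<beta> + 2) = - (\<beta> + 1)" by simp
          finally show ?thesis by (simp add: z_def riesz_def)
        qed (simp add: w0)
      qed
      finally have "(real CARD('n) - 2 * (\<beta> + 1)) * J 0 (\<beta> + 1) \<xi> x = 0" by (simp add: algebra_simps)
      moreover have "real CARD('n) - 2 * (\<beta> + 1) < 0" using s by (simp add: \<beta>_def \<beta>0_def)
      ultimately show ?thesis by simp
    qed
    show ?case
    proof (intro allI impI ballI)
      fix m \<xi> x assume "m \<le> Suc k" "x \<in> ball x0 e"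
      then show "J m (\<beta>0 + real (Suc k)) \<xi> x = 0"
        unfolding \<beta>S using base up by (cases m) auto
    qed
  qed
  define z where "z y = x0 - y" for y
  define \<zeta> where "\<zeta> y = (1 / (z y \<bullet> z y)) *\<^sub>R z y" for y
  define h where "h y = w y * (z y \<bullet> z y) powr (- \<beta>0)" for y
  have x0: "x0 \<in> ball x0 e" using e by simp
  have zK: "z y \<noteq> 0" "norm (\<zeta> y) \<le> 1 / d" if "y \<in> K" for y
  proof -
    have dz: "d \<le> norm (z y)" using d(2)[OF x0 that] by (simp add: z_def)
    then show "z y \<noteq> 0" using d(1) by auto
    have "norm (\<zeta> y) = 1 / norm (z y)" using dz d(1) by (simp add: \<zeta>_def dot_square_norm power2_eq_square)
    also have "\<dots> \<le> 1 / d" using dz d(1) by (intro divide_left_mono mult_pos_pos) auto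
    finally show "norm (\<zeta> y) \<le> 1 / d" .
  qed
  have h_int: "integrable lebesgue h"
    using int[OF x0, of \<beta>0 0 0] \<beta>0 by (simp add: h_def[abs_def] riesz_def z_def)
  note hm = borel_measurable_integrable[OF h_int]
  have \<zeta>m: "(\<lambda>y. f (\<xi> \<bullet> \<zeta> y)) \<in> borel_measurable lebesgue" if "f \<in> borel_measurable borel" for f :: "real \<Rightarrow> real" and \<xi>
  proof (rule measurable_lebesgueI)
    note [measurable] = that
    show "(\<lambda>y. f (\<xi> \<bullet> \<zeta> y)) \<in> borel_measurable borel" unfolding \<zeta>_def z_def by measurable
  qed
  have power_zero: "(\<integral>y. h y * (\<xi> \<bullet> \<zeta> y) ^ m \<partial>lebesgue) = 0" for \<xi> m
  proof -
    have "(\<integral>y. h y * (\<xi> \<bullet> \<zeta> y) ^ m \<partial>lebesgue) = J m (\<beta>0 + real m) \<xi> x0"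
      unfolding J_def
    proof (intro Bochner_Integration.integral_cong refl)
      fix y
      show "h y * (\<xi> \<bullet> \<zeta> y) ^ m = w y * riesz \<xi> m (\<beta>0 + real m) (x0 - y)"
      proof (cases "y \<in> K")
        case True
        have pos: "z y \<bullet> z y > 0" using zK(1)[OF True] by simp
        have "(z y \<bullet> z y) powr (- (\<beta>0 + real m)) = (z y \<bullet> z y) powr (- \<beta>0) * (z y \<bullet> z y) powr (- real m)"
          unfolding powr_add[symmetric] by simp
        also have "(z y \<bullet> z y) powr (- real m) = (1 / (z y \<bullet> z y)) ^ m"
          using pos by (simp add: powr_minus powr_realpow divide_inverse power_inverse)
        finally show ?thesis by (simp add: h_def riesz_def \<zeta>_def z_def[symmetric] power_mult_distrib power_divide)
      qed (simp add: h_def w0)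
    qed
    also have "\<dots> = 0" using vanish[of m] x0 by simp
    finally show ?thesis .
  qed
  have h0: "h y = 0" if "y \<notin> K" for y using w0[OF that] by (simp add: h_def)
  have \<zeta>_le: "\<bar>\<xi> \<bullet> \<zeta> y\<bar> \<le> norm \<xi> / d" if "y \<in> K" for y \<xi>
  proof -
    have "\<bar>\<xi> \<bullet> \<zeta> y\<bar> \<le> norm \<xi> * (1 / d)"
      using Cauchy_Schwarz_ineq2[of \<xi> "\<zeta> y"] zK(2)[OF that] by (meson mult_left_mono norm_ge_zero order_trans)
    then show ?thesis by simp
  qed
  have h_poly_int: "integrable lebesgue (\<lambda>y. h y * f (\<xi> \<bullet> \<zeta> y))"
    if f: "f \<in> borel_measurable borel" "\<And>t. \<bar>t\<bar> \<le> norm \<xi> / d \<Longrightarrow> \<bar>f t\<bar> \<le> C" for f C and \<xi> :: "real^'n"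
    by (rule integrable_mult_bounded_on[OF h_int \<zeta>m[OF f(1)] h0 f(2)[OF \<zeta>_le]])
  have exp_zero: "(\<integral>y. h y * exp (\<xi> \<bullet> \<zeta> y) \<partial>lebesgue) = 0" for \<xi>
  proof -
    define S where "S M t = (\<Sum>m<M. t ^ m /\<^sub>R fact m)" for M and t :: real
    have Sm: "S M \<in> borel_measurable borel" for M unfolding S_def by measurable
    have Sb: "\<bar>S M t\<bar> \<le> exp (norm \<xi> / d)" if t: "\<bar>t\<bar> \<le> norm \<xi> / d" for M t
    proof -
      have "\<bar>S M t\<bar> \<le> (\<Sum>m<M. \<bar>t\<bar> ^ m /\<^sub>R fact m)"
        unfolding S_def by (rule order_trans[OF sum_abs]) (simp add: abs_mult power_abs)
      also have "\<dots> \<le> (\<Sum>m. \<bar>t\<bar> ^ m /\<^sub>R fact m)"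
        by (rule sum_le_suminf[OF summable_exp_generic]) auto
      also have "\<dots> = exp \<bar>t\<bar>" by (simp add: exp_def)
      also have "\<dots> \<le> exp (norm \<xi> / d)" using t by simp
      finally show ?thesis .
    qed
    have "(\<lambda>M. \<integral>y. h y * S M (\<xi> \<bullet> \<zeta> y) \<partial>lebesgue) \<longlonglongrightarrow> (\<integral>y. h y * exp (\<xi> \<bullet> \<zeta> y) \<partial>lebesgue)"
    proof (rule integral_dominated_convergence[where w="\<lambda>y. exp (norm \<xi> / d) * norm (h y)"])
      show "(\<lambda>y. h y * exp (\<xi> \<bullet> \<zeta> y)) \<in> borel_measurable lebesgue"
        by (rule borel_measurable_times[OF hm \<zeta>m]) measurable
      show "(\<lambda>y. h y * S M (\<xi> \<bullet> \<zeta> y)) \<in> borel_measurable lebesgue" for M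
        by (rule borel_measurable_times[OF hm \<zeta>m[OF Sm]])
      show "integrable lebesgue (\<lambda>y. exp (norm \<xi> / d) * norm (h y))" using h_int by simp
      show "AE y in lebesgue. (\<lambda>M. h y * S M (\<xi> \<bullet> \<zeta> y)) \<longlonglongrightarrow> h y * exp (\<xi> \<bullet> \<zeta> y)"
        unfolding S_def by (intro AE_I2 tendsto_mult tendsto_const exp_converges[unfolded sums_def])
      show "AE y in lebesgue. norm (h y * S M (\<xi> \<bullet> \<zeta> y)) \<le> exp (norm \<xi> / d) * norm (h y)" for M
        by (intro AE_I2 norm_mult_le_on[OF h0] Sb \<zeta>_le)
    qed
    moreover have "(\<integral>y. h y * S M (\<xi> \<bullet> \<zeta> y) \<partial>lebesgue) = 0" for M
    proof -
      have pint: "integrable lebesgue (\<lambda>y. h y * (\<xi> \<bullet> \<zeta> y) ^ m)" for m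
        by (rule h_poly_int[of _ _ "(norm \<xi> / d) ^ m"]) (auto simp: power_abs intro!: power_mono)
      have "(\<integral>y. h y * S M (\<xi> \<bullet> \<zeta> y) \<partial>lebesgue) = (\<integral>y. (\<Sum>m<M. (1 / fact m) * (h y * (\<xi> \<bullet> \<zeta> y) ^ m)) \<partial>lebesgue)"
        by (intro Bochner_Integration.integral_cong) (auto simp: S_def sum_distrib_left divide_inverse mult_ac)
      also have "\<dots> = (\<Sum>m<M. (1 / fact m) * (\<integral>y. h y * (\<xi> \<bullet> \<zeta> y) ^ m \<partial>lebesgue))"
        using pint by (subst Bochner_Integration.integral_sum) auto
      also have "\<dots> = 0" by (simp add: power_zero)
      finally show ?thesis .
    qed
    ultimately have "(\<lambda>M::nat. 0::real) \<longlonglongrightarrow> (\<integral>y. h y * exp (\<xi> \<bullet> \<zeta> y) \<partial>lebesgue)" by simp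
    then show ?thesis by (simp add: LIMSEQ_const_iff)
  qed
  have span_zero: "integrable lebesgue (\<lambda>y. h y * g y) \<and> (\<integral>y. h y * g y \<partial>lebesgue) = 0" if "exp_span \<zeta> g" for g
    using that
  proof (induction rule: exp_span.induct)
    case (gen c \<xi>)
    have i: "integrable lebesgue (\<lambda>y. h y * exp (\<xi> \<bullet> \<zeta> y))"
      by (rule h_poly_int[of _ _ "exp (norm \<xi> / d)"]) auto
    have e: "(\<lambda>y. h y * (c * exp (\<xi> \<bullet> \<zeta> y))) = (\<lambda>y. c * (h y * exp (\<xi> \<bullet> \<zeta> y)))" by auto
    show ?case unfolding e using i exp_zero by simp
  next
    case (add f g)
    then show ?case by (simp add: distrib_left)
  qed
  have zc: "continuous_on K z" unfolding z_def by (intro continuous_intros)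
  have \<zeta>c: "continuous_on K \<zeta>" unfolding \<zeta>_def using zK(1)
    by (intro continuous_intros zc) auto
  have \<zeta>i: "inj_on \<zeta> K"
  proof (rule inj_onI)
    fix y y' assume y: "y \<in> K" "y' \<in> K" "\<zeta> y = \<zeta> y'"
    show "y = y'"
      by (rule inversion_inj[of y x0 y']) (use zK(1)[OF y(1)] zK(1)[OF y(2)] y(3) in \<open>auto simp: \<zeta>_def z_def\<close>)
  qed
  have cont_zero: "(\<integral>y. h y * f y \<partial>lebesgue) = 0"
    if f: "continuous_on UNIV f" and fi: "integrable lebesgue (\<lambda>y. h y * f y)" for f :: "real^'n \<Rightarrow> real"
  proof -
    define H where "H = (\<integral>y. \<bar>h y\<bar> \<partial>lebesgue)"
    have H0: "H \<ge> 0" unfolding H_def by simp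
    have "\<bar>\<integral>y. h y * f y \<partial>lebesgue\<bar> \<le> 0 + \<epsilon>" if "\<epsilon> > 0" for \<epsilon>
    proof -
      have "\<epsilon> / (H + 1) > 0" using that H0 by simp
      then obtain g where g: "exp_span \<zeta> g" "\<forall>y\<in>K. \<bar>f y - g y\<bar> < \<epsilon> / (H + 1)"
        using exp_span_dense[OF K \<zeta>c \<zeta>i continuous_on_subset[OF f]] by blast
      have gi: "integrable lebesgue (\<lambda>y. h y * g y)" "(\<integral>y. h y * g y \<partial>lebesgue) = 0" using span_zero[OF g(1)] by auto
      have "\<bar>\<integral>y. h y * f y \<partial>lebesgue\<bar> = \<bar>\<integral>y. h y * f y - h y * g y \<partial>lebesgue\<bar>" using fi gi by simp
      also have "\<dots> \<le> (\<integral>y. \<bar>h y * f y - h y * g y\<bar> \<partial>lebesgue)" by (rule integral_abs_bound)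
      also have "\<dots> \<le> (\<integral>y. (\<epsilon> / (H + 1)) * \<bar>h y\<bar> \<partial>lebesgue)"
      proof (rule integral_mono)
        show "integrable lebesgue (\<lambda>y. \<bar>h y * f y - h y * g y\<bar>)" using fi gi by simp
        show "integrable lebesgue (\<lambda>y. (\<epsilon> / (H + 1)) * \<bar>h y\<bar>)" using h_int by simp
        fix y
        show "\<bar>h y * f y - h y * g y\<bar> \<le> (\<epsilon> / (H + 1)) * \<bar>h y\<bar>"
        proof (cases "y \<in> K")
          case True
          then have "\<bar>f y - g y\<bar> * \<bar>h y\<bar> \<le> (\<epsilon> / (H + 1)) * \<bar>h y\<bar>" using g(2) by (intro mult_right_mono) (auto intro: less_imp_le)
          moreover have "h y * f y - h y * g y = (f y - g y) * h y" by (simp add: algebra_simps)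
          ultimately show ?thesis by (simp only: abs_mult)
        qed (simp add: h0)
      qed
      also have "\<dots> = (\<epsilon> / (H + 1)) * H" by (simp add: H_def)
      also have "\<dots> \<le> \<epsilon>" using H0 that by (simp add: field_simps)
      finally show ?thesis by simp
    qed
    then have "\<bar>\<integral>y. h y * f y \<partial>lebesgue\<bar> \<le> 0" by (rule field_le_epsilon)
    then show ?thesis by simp
  qed
  have "AE y in lebesgue. y \<in> box (- (R0 + 1) *\<^sub>R 1) ((R0 + 1) *\<^sub>R 1) \<longrightarrow> h y = 0"
  proof (rule AE_zero_of_plateau_integrals[OF h_int])
    fix a b :: "real^'n" and m :: nat
    show "(\<integral>x. h x * plateau m a b x \<partial>lebesgue) = 0"
    proof (rule cont_zero)
      show "continuous_on UNIV (plateau m a b)" by (intro smooth_fun_continuous smooth_fun_plateau)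
      show "integrable lebesgue (\<lambda>x. h x * plateau m a b x)"
        by (rule integrable_mult_bounded_on[OF h_int measurable_lebesgueI[OF plateau_measurable] h0 plateau_abs_le])
    qed
  qed
  then show ?thesis
  proof eventually_elim
    case (elim y)
    show ?case
    proof (cases "y \<in> K")
      case True
      have "\<bar>y $ i\<bar> < R0 + 1" for i
        using component_le_norm_cart[of y i] R0[OF True] by linarith
      then have "y \<in> box (- (R0 + 1) *\<^sub>R 1) ((R0 + 1) *\<^sub>R 1)" by (auto simp: mem_box_cart abs_less_iff) (smt (verit))+
      then have "h y = 0" using elim by simp
      then show ?thesis using zK(1)[OF True] by (simp add: h_def)
    qed (rule w0)
  qed
qed

lemma cbox_inside_open:
  fixes x :: "real^'n"
  assumes "open U" "x \<in> U"
  obtains p q where "x \<in> box p q" "cbox p q \<subseteq> U"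
proof -
  obtain e where e: "e > 0" "ball x e \<subseteq> U" using assms openE by blast
  define t where "t = e / (2 * real CARD('n))"
  have t: "t > 0" using e by (simp add: t_def)
  show ?thesis
  proof
    show "x \<in> box (x - (\<chi> i. t)) (x + (\<chi> i. t))" using t by (simp add: mem_box_cart)
    show "cbox (x - (\<chi> i. t)) (x + (\<chi> i. t)) \<subseteq> U"
    proof
      fix y assume y: "y \<in> cbox (x - (\<chi> i. t)) (x + (\<chi> i. t))"
      have "norm (x - y) \<le> (\<Sum>i\<in>UNIV. \<bar>(x - y) $ i\<bar>)" by (rule norm_le_l1_cart)
      also have "\<dots> \<le> (\<Sum>i\<in>(UNIV::'n set). t)"
      proof (rule sum_mono)
        fix i
        have "x $ i - t \<le> y $ i \<and> y $ i \<le> x $ i + t" using y by (simp add: mem_box_cart)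
        then show "\<bar>(x - y) $ i\<bar> \<le> t" by (simp add: abs_le_iff)
      qed
      also have "\<dots> < e" using e by (simp add: t_def)
      finally show "y \<in> U" using e by (auto simp: dist_norm)
    qed
  qed
qed

context magnetic
begin

text \<open>For a test function \<open>\<phi>\<close> supported in \<open>W\<close> the product \<open>w \<phi>\<close> vanishes, and so does the phase between
  points of \<open>\<Omega>\<close> and of \<open>W\<close>. The form therefore reduces to \<open>-2 \<integral> \<phi>(x) \<integral> w(y) K(x,y) dy dx\<close>. So the Riesz
  potential of \<open>w\<close> vanishes almost everywhere near a point of \<open>W\<close>, by continuity at all points near it,
  and \<open>riesz_potential_injective\<close> applies.\<close>

lemma unique_continuation:
  assumes w: "w \<in> Hs s" and off: "AE x in lebesgue. x \<notin> \<Omega> \<longrightarrow> w x = 0"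
    and W: "open W" "W \<noteq> {}" "W \<inter> ball 0 (3 * r) = {}"
    and zero: "\<And>\<phi>. \<phi> \<in> test_functions W \<Longrightarrow> (\<integral>p. mag_density w \<phi> p \<partial>lebesgue) = 0"
  shows "AE x in lebesgue. w x = 0"
proof -
  obtain x0 where "x0 \<in> W" using W by blast
  obtain p q where pq: "x0 \<in> box p q" "cbox p q \<subseteq> W" by (rule cbox_inside_open[OF W(1) \<open>x0 \<in> W\<close>])
  define K :: "(real^'n) set" where "K = cball 0 r"
  have [measurable]: "K \<in> sets borel" "box p q \<in> sets borel" by (auto simp: K_def)
  have OmK: "\<Omega> \<subseteq> K" using \<Omega>(2) by (auto simp: K_def)
  have far: "norm (x - y) \<ge> 2 * r" if "x \<in> W" "y \<in> K" for x y
  proof -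
    have "norm x \<ge> 3 * r" using that(1) W(3) by (auto simp: disjoint_iff not_less)
    moreover have "norm y \<le> r" using that(2) by (simp add: K_def)
    moreover have "norm x \<le> norm (x - y) + norm y" using norm_triangle_sub[of x y] by simp
    ultimately show ?thesis by linarith
  qed
  note wm = HsD(1)[OF w]
  obtain g where g: "g \<in> borel_measurable lborel" "AE x in lborel. w x = g x"
    using completion_ex_borel_measurable_real[OF wm] by blast
  have gb[measurable]: "g \<in> borel_measurable borel" using g by simp
  have aeg: "AE x in lebesgue. w x = g x" using g by (simp add: AE_completion_iff)
  \<comment> \<open>a Borel representative of \<open>w\<close> that vanishes off the compact set \<open>K\<close> at every point\<close>
  define v where "v y = indicator K y * g y" for y
  have vb[measurable]: "v \<in> borel_measurable borel" unfolding v_def by measurable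
  have v0: "v y = 0" if "y \<notin> K" for y using that by (simp add: v_def)
  have wv: "AE x in lebesgue. w x = v x"
    using aeg off by eventually_elim (use OmK in \<open>auto simp: v_def indicator_def\<close>)
  have voff: "AE x in lebesgue. x \<notin> \<Omega> \<longrightarrow> v x = 0" using wv off by eventually_elim auto
  have v_int: "integrable lborel v"
  proof (rule Bochner_Integration.integrable_bound)
    have "integrable lebesgue (\<lambda>x. (g x)\<^sup>2)"
    proof (rule integrable_cong_AE_imp[OF HsD(2)[OF w]])
      show "(\<lambda>x. (g x)\<^sup>2) \<in> borel_measurable lebesgue" by (rule measurable_lebesgueI) measurable
      show "AE x in lebesgue. (w x)\<^sup>2 = (g x)\<^sup>2" using aeg by eventually_elim simp
    qed
    then have "integrable lborel (\<lambda>x. (g x)\<^sup>2)" by (subst (asm) integrable_completion) auto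
    moreover have "integrable lborel (\<lambda>x. indicator K x :: real)"
      by (rule integrable_real_indicator) (use emeasure_lborel_cball_finite[of 0 r] in \<open>auto simp: K_def\<close>)
    ultimately show "integrable lborel (\<lambda>x. indicator K x + (g x)\<^sup>2)" by (intro Bochner_Integration.integrable_add)
    show "AE x in lborel. norm (v x) \<le> norm (indicator K x + (g x)\<^sup>2)"
    proof (rule AE_I2)
      fix x
      have "2 * \<bar>g x\<bar> \<le> 1 + (g x)\<^sup>2" using zero_le_power2[of "\<bar>g x\<bar> - 1"] by (simp add: power2_diff)
      then have "\<bar>g x\<bar> \<le> 1 + (g x)\<^sup>2" by linarith
      then show "norm (v x) \<le> norm (indicator K x + (g x)\<^sup>2)" by (simp add: v_def indicator_def)
    qed
  qed simp
  have kb[measurable]: "(\<lambda>p. kern p) \<in> borel_measurable (borel :: ((real^'n) \<times> (real^'n)) measure)"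
  proof -
    have "(\<lambda>z. fc / norm z powr (real CARD('n) + 2 * s)) \<in> borel_measurable (borel :: (real^'n) measure)" by measurable
    moreover have "(\<lambda>p. fst p - snd p :: real^'n) \<in> borel_measurable borel"
      by (intro borel_measurable_continuous_onI continuous_intros)
    ultimately show ?thesis
      unfolding kern_def frac_kernel_def fc_def by (rule measurable_compose[rotated])
  qed
  define Ck where "Ck = fc / (2 * r) powr (real CARD('n) + 2 * s)"
  have kern_le: "kern (x, y) \<le> Ck" if "x \<in> W" "y \<in> K" for x y
    unfolding Ck_def kern_def frac_kernel_def fc_def[symmetric]
    using far[OF that] fc_pos r s by (intro divide_left_mono powr_mono2 mult_pos_pos) auto
  \<comment> \<open>the integrand of the inner integral, cut off to a box in which the kernel is bounded\<close>
  define F where "F z = indicator (box p q) (fst z) * (v (snd z) * kern z)" for z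
  have fstb[measurable]: "(fst :: (real^'n) \<times> (real^'n) \<Rightarrow> real^'n) \<in> borel_measurable borel"
    "(snd :: (real^'n) \<times> (real^'n) \<Rightarrow> real^'n) \<in> borel_measurable borel"
    by (intro borel_measurable_continuous_onI continuous_intros)+
  have Fb: "F \<in> borel_measurable borel" unfolding F_def by measurable
  have F_int: "integrable (lborel \<Otimes>\<^sub>M lborel) F"
  proof (rule Bochner_Integration.integrable_bound)
    let ?B = "\<lambda>z. Ck * (indicator (box p q) (fst z) * \<bar>v (snd z)\<bar>)"
    have "(\<integral>\<^sup>+z. ennreal (indicator (box p q) (fst z) * \<bar>v (snd z)\<bar>) \<partial>(lborel \<Otimes>\<^sub>M lborel))
      = (\<integral>\<^sup>+x. \<integral>\<^sup>+y. indicator (box p q) x * ennreal \<bar>v y\<bar> \<partial>lborel \<partial>lborel)"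
      by (subst lborel.nn_integral_fst[symmetric]) (auto simp: lborel_prod ennreal_mult ennreal_indicator intro!: nn_integral_cong)
    also have "\<dots> = (\<integral>\<^sup>+y. ennreal \<bar>v y\<bar> \<partial>lborel) * emeasure lborel (box p q)"
      by (simp add: nn_integral_cmult nn_integral_multc mult.commute)
    also have "\<dots> < \<infinity>"
      using v_int emeasure_lborel_box_finite[of p q] unfolding integrable_iff_bounded
      by (simp add: ennreal_mult_less_top)
    finally have "integrable (lborel \<Otimes>\<^sub>M lborel) (\<lambda>z. indicator (box p q) (fst z) * \<bar>v (snd z)\<bar>)"
      by (intro integrableI_nonneg) (auto simp: lborel_prod)
    then show "integrable (lborel \<Otimes>\<^sub>M lborel) ?B" by simp
    show "F \<in> borel_measurable (lborel \<Otimes>\<^sub>M lborel)" using Fb by (simp add: lborel_prod)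
    show "AE z in lborel \<Otimes>\<^sub>M lborel. norm (F z) \<le> norm (?B z)"
    proof (rule AE_I2)
      fix z
      show "norm (F z) \<le> norm (?B z)"
      proof (cases "fst z \<in> box p q \<and> snd z \<in> K")
        case True
        then have "fst z \<in> W" using pq box_subset_cbox by blast
        then have "kern z \<le> \<bar>Ck\<bar>" using kern_le[of "fst z" "snd z"] True by simp
        then have "kern z * \<bar>v (snd z)\<bar> \<le> \<bar>Ck\<bar> * \<bar>v (snd z)\<bar>" by (rule mult_right_mono) simp
        then show ?thesis using True kern_nonneg[of z] by (simp add: F_def abs_mult mult.commute)
      qed (auto simp: F_def v0 indicator_def)
    qed
  qed
  define h where "h x = (\<integral>y. F (x, y) \<partial>lborel)" for x
  have h_int: "integrable lborel h"
    unfolding h_def using lborel_pair.integrable_fst'[OF F_int] by simp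
  have hb[measurable]: "h \<in> borel_measurable borel" using h_int by auto
  have test: "(\<integral>x. h x * \<phi> x \<partial>lborel) = 0"
    if \<phi>: "\<phi> \<in> test_functions W" and \<phi>1: "\<And>x. \<bar>\<phi> x\<bar> \<le> 1" and \<phi>0: "\<And>x. x \<notin> box p q \<Longrightarrow> \<phi> x = 0" for \<phi>
  proof -
    have \<phi>b[measurable]: "\<phi> \<in> borel_measurable borel"
      by (intro borel_measurable_continuous_onI smooth_fun_continuous test_functions_smooth[OF \<phi>])
    have \<phi>H: "\<phi> \<in> Hs s" by (rule test_functions_Hs[OF s \<phi>])
    define P where "P z = \<phi> (fst z) * F z" for z
    have Pb: "P \<in> borel_measurable borel" unfolding P_def using Fb by measurable
    have P_int: "integrable (lborel \<Otimes>\<^sub>M lborel) P"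
    proof (rule Bochner_Integration.integrable_bound[OF F_int])
      show "P \<in> borel_measurable (lborel \<Otimes>\<^sub>M lborel)" using Pb by (simp add: lborel_prod)
      show "AE z in lborel \<Otimes>\<^sub>M lborel. norm (P z) \<le> norm (F z)"
        by (rule AE_I2) (use \<phi>1 in \<open>simp add: P_def abs_mult mult_left_le_one_le\<close>)
    qed
    have ks: "kern (y, x) = kern (x, y)" for x y by (simp add: kern_def frac_kernel_def norm_minus_commute)
    have ae: "AE z in lebesgue. mag_density w \<phi> z = - (P z + P (snd z, fst z))"
      using null_preserving_AE[OF null_preserving_fst wv] null_preserving_AE[OF null_preserving_snd wv]
        null_preserving_AE[OF null_preserving_fst voff] null_preserving_AE[OF null_preserving_snd voff]
    proof eventually_elim
      case (elim z)
      obtain x y where z: "z = (x, y)" by (cases z)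
      have disj: "v t * \<phi> t = 0" for t
      proof (cases "t \<in> K")
        case True
        then have "norm t < 3 * r" using r by (simp add: K_def)
        then have "t \<notin> W" using W(3) by auto
        then show ?thesis using test_functions_off[OF \<phi>] by simp
      qed (simp add: v0)
      have c1: "cos (phase z) * (v y * \<phi> x) = v y * \<phi> x"
      proof (cases "y \<in> \<Omega> \<and> x \<in> W")
        case True
        then have "cos (phase z) = 1" using W(3) by (intro cos_phase_far) (auto simp: z)
        then show ?thesis by simp
      next
        case False
        then show ?thesis using elim(4) test_functions_off[OF \<phi>] by (auto simp: z)
      qed
      have c2: "cos (phase z) * (v x * \<phi> y) = v x * \<phi> y"
      proof (cases "x \<in> \<Omega> \<and> y \<in> W")
        case True
        then have "cos (phase z) = 1" using W(3) by (intro cos_phase_far) (auto simp: z)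
        then show ?thesis by simp
      next
        case False
        then show ?thesis using elim(3) test_functions_off[OF \<phi>] by (auto simp: z)
      qed
      have PP: "P z = \<phi> x * v y * kern z" "P (snd z, fst z) = \<phi> y * v x * kern z"
        using \<phi>0 ks by (auto simp: P_def F_def z indicator_def)
      have "mag_density w \<phi> z = (v x * \<phi> x + v y * \<phi> y - (cos (phase z) * (v y * \<phi> x) + cos (phase z) * (v x * \<phi> y))) * kern z"
        using elim(1,2) by (simp add: mag_density_def z distrib_left)
      also have "\<dots> = - (P z + P (snd z, fst z))" unfolding c1 c2 disj PP by (simp add: algebra_simps)
      finally show ?case .
    qed
    have Psb: "(\<lambda>z. P (snd z, fst z)) \<in> borel_measurable borel" 
      using measurable_compose[of "\<lambda>z. (snd z, fst z)" borel borel P borel] Pb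
      by (simp add: borel_measurable_continuous_onI continuous_on_Pair continuous_on_fst continuous_on_snd)
    have Ps_int: "integrable (lborel \<Otimes>\<^sub>M lborel) (\<lambda>z. P (snd z, fst z))"
      using lborel_pair.integrable_product_swap[OF P_int] by (simp add: case_prod_beta')
    have Ps_eq: "(\<integral>z. P (snd z, fst z) \<partial>(lborel \<Otimes>\<^sub>M lborel)) = (\<integral>z. P z \<partial>(lborel \<Otimes>\<^sub>M lborel))"
      using lborel_pair.integral_product_swap[of P] Pb by (simp add: case_prod_beta' lborel_prod)
    have "0 = (\<integral>z. mag_density w \<phi> z \<partial>lebesgue)" using zero[OF \<phi>] by simp
    also have "\<dots> = (\<integral>z. - (P z + P (snd z, fst z)) \<partial>lebesgue)"
    proof (rule integral_cong_AE[OF density_measurable[OF wm HsD(1)[OF \<phi>H]] _ ae])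
      show "(\<lambda>z. - (P z + P (snd z, fst z))) \<in> borel_measurable lebesgue"
        by (rule measurable_lebesgueI) (use Pb Psb in measurable)
    qed
    also have "\<dots> = (\<integral>z. - (P z + P (snd z, fst z)) \<partial>lborel)"
      by (rule integral_completion) (use Pb Psb in \<open>simp, measurable\<close>)
    also have "\<dots> = - 2 * (\<integral>z. P z \<partial>(lborel \<Otimes>\<^sub>M lborel))"
      using P_int Ps_int Ps_eq by (simp add: lborel_prod)
    also have "(\<integral>z. P z \<partial>(lborel \<Otimes>\<^sub>M lborel)) = (\<integral>x. \<integral>y. P (x, y) \<partial>lborel \<partial>lborel)"
      by (rule lborel_pair.integral_fst'[OF P_int, symmetric])
    also have "\<dots> = (\<integral>x. h x * \<phi> x \<partial>lborel)"
      by (simp add: P_def h_def mult.commute)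
    finally show ?thesis by simp
  qed
  have AE_h: "AE x in lebesgue. x \<in> box p q \<longrightarrow> h x = 0"
  proof (rule AE_zero_of_plateau_integrals)
    show "integrable lebesgue h" using h_int by (subst integrable_completion) auto
    fix a b :: "real^'n" and m :: nat assume ab: "cbox a b \<subseteq> cbox p q"
    have "(\<integral>x. h x * plateau m a b x \<partial>lborel) = 0"
    proof (rule test[OF plateau_test_function plateau_abs_le plateau_off])
      show "cbox a b \<subseteq> W" using ab pq by blast
      show "x \<notin> box a b" if "x \<notin> box p q" for x
        using that interior_mono[OF ab] by (auto simp: interior_cbox)
    qed
    moreover have "(\<lambda>x. h x * plateau m a b x) \<in> borel_measurable borel"
      by (rule borel_measurable_times[OF hb plateau_measurable])
    ultimately show "(\<integral>x. h x * plateau m a b x \<partial>lebesgue) = 0"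
      by (subst integral_completion) simp_all
  qed
  define \<beta> where "\<beta> = real CARD('n) / 2 + s"
  define G where "G x = (\<integral>y. v y * ((x - y) \<bullet> (x - y)) powr (- \<beta>) \<partial>lebesgue)" for x
  have hG: "h x = fc * G x" if "x \<in> box p q" for x
  proof -
    have pw: "1 / norm z powr (real CARD('n) + 2 * s) = (z \<bullet> z) powr (- \<beta>)" for z :: "real^'n"
    proof (cases "z = 0")
      case False
      have "norm z powr 2 = z \<bullet> z" using powr_realpow[of "norm z" 2] False by (simp add: dot_square_norm)
      then have "(z \<bullet> z) powr (- \<beta>) = (norm z powr 2) powr (- \<beta>)" by simp
      also have "\<dots> = norm z powr (2 * - \<beta>)" by (rule powr_powr)
      also have "2 * - \<beta> = - (real CARD('n) + 2 * s)" by (simp add: \<beta>_def)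
      finally show ?thesis unfolding powr_minus_divide ..
    qed simp
    have "h x = (\<integral>y. fc * (v y * ((x - y) \<bullet> (x - y)) powr (- \<beta>)) \<partial>lborel)"
      unfolding h_def F_def using that
      by (intro Bochner_Integration.integral_cong) (auto simp: kern_def frac_kernel_def fc_def[symmetric] pw[symmetric])
    also have "\<dots> = (\<integral>y. fc * (v y * ((x - y) \<bullet> (x - y)) powr (- \<beta>)) \<partial>lebesgue)"
      by (rule integral_completion[symmetric]) simp
    finally show ?thesis by (simp add: G_def)
  qed
  have AE_G: "AE x in lebesgue. x \<in> box p q \<longrightarrow> G x = 0"
    using AE_h by eventually_elim (use hG fc_pos in auto)
  have boxW: "x \<in> W" if "x \<in> box p q" for x using that pq box_subset_cbox by blast
  have \<beta>: "\<beta> > 0" using s by (simp add: \<beta>_def)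
  have G_cont: "continuous_on (box p q) G"
  proof (rule continuous_on_sequentiallyI)
    fix u a assume u: "\<forall>n. u n \<in> box p q" "a \<in> box p q" "u \<longlonglongrightarrow> a"
    show "(\<lambda>n. G (u n)) \<longlonglongrightarrow> G a"
      unfolding G_def
    proof (rule integral_dominated_convergence[where w="\<lambda>y. ((2 * r)\<^sup>2) powr (- \<beta>) * norm (v y)"])
      show "(\<lambda>y. v y * ((a - y) \<bullet> (a - y)) powr (- \<beta>)) \<in> borel_measurable lebesgue"
        by (rule measurable_lebesgueI) measurable
      show "(\<lambda>y. v y * ((u n - y) \<bullet> (u n - y)) powr (- \<beta>)) \<in> borel_measurable lebesgue" for n
        by (rule measurable_lebesgueI) measurable
      show "integrable lebesgue (\<lambda>y. ((2 * r)\<^sup>2) powr (- \<beta>) * norm (v y))"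
        using v_int by (subst integrable_completion) auto
      show "AE y in lebesgue. (\<lambda>n. v y * ((u n - y) \<bullet> (u n - y)) powr (- \<beta>)) \<longlonglongrightarrow> v y * ((a - y) \<bullet> (a - y)) powr (- \<beta>)"
      proof (rule AE_I2)
        fix y
        show "(\<lambda>n. v y * ((u n - y) \<bullet> (u n - y)) powr (- \<beta>)) \<longlonglongrightarrow> v y * ((a - y) \<bullet> (a - y)) powr (- \<beta>)"
        proof (cases "y \<in> K")
          case True
          have "a - y \<noteq> 0" using far[OF boxW[OF u(2)] True] r by auto
          then show ?thesis using u(3) by (intro tendsto_intros) auto
        qed (simp add: v0)
      qed
      have "((u n - y) \<bullet> (u n - y)) powr (- \<beta>) \<le> ((2 * r)\<^sup>2) powr (- \<beta>)" if y: "y \<in> K" for n y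
      proof -
        have "2 * r \<le> norm (u n - y)" using far[OF boxW y, of "u n"] u(1) by blast
        from power_mono[OF this, of 2] have "(2 * r)\<^sup>2 \<le> (u n - y) \<bullet> (u n - y)"
          unfolding dot_square_norm using r by simp
        then show ?thesis using \<beta> r by (intro powr_mono2') auto
      qed
      then show "AE y in lebesgue. norm (v y * ((u n - y) \<bullet> (u n - y)) powr (- \<beta>)) \<le> ((2 * r)\<^sup>2) powr (- \<beta>) * norm (v y)" for n
        by (intro AE_I2 norm_mult_le_on[OF v0]) auto
    qed
  qed
  have G0: "G x = 0" if x: "x \<in> box p q" for x
  proof -
    have "\<bar>G x\<bar> \<le> 0"
      by (rule continuous_AE_le[OF open_box continuous_on_rabs[OF G_cont] _ x])
         (use AE_G in eventually_elim, simp)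
    then show ?thesis by simp
  qed
  obtain e where e: "e > 0" "ball x0 e \<subseteq> box p q" using pq(1) open_box openE by blast
  have "AE y in lebesgue. v y = 0"
  proof (rule riesz_potential_injective[of s v K e "2 * r" x0])
    show "integrable lebesgue v" using v_int by (subst integrable_completion) auto
    show "2 * r \<le> norm (x - y)" if "x \<in> ball x0 e" "y \<in> K" for x y
      using far boxW e that by blast
    show "(\<integral>y. v y * ((x - y) \<bullet> (x - y)) powr (- (real CARD('n) / 2 + s)) \<partial>lebesgue) = 0" if "x \<in> ball x0 e" for x
      using G0[of x] e that unfolding G_def \<beta>_def by blast
  qed (use s r e v0 in \<open>auto simp: K_def\<close>)
  with wv show ?thesis by eventually_elim simp
qed

end

section \<open>Hoelder functions\<close>

lemma linf_norm_AE:
  assumes U: "open U"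
  shows "AE x in lebesgue. x \<in> U \<longrightarrow> ereal \<bar>f x\<bar> \<le> linf_norm U f"
proof -
  have "AE x in lebesgue_on U. ereal \<bar>f x\<bar> \<le> linf_norm U f"
    unfolding linf_norm_def by (rule esssup_AE)
  then show ?thesis using U by (subst (asm) AE_restrict_space_iff) auto
qed

lemma linf_norm_nonneg:
  assumes "open U" "U \<noteq> {}"
  shows "linf_norm U f \<ge> 0"
proof (rule ccontr)
  assume n: "\<not> linf_norm U f \<ge> 0"
  have "AE x in lebesgue. x \<notin> U"
    using linf_norm_AE[OF assms(1), of f]
  proof eventually_elim
    case (elim x)
    have "ereal 0 \<le> ereal \<bar>f x\<bar>" by simp
    then show ?case using elim n by (metis order_trans zero_ereal_def)
  qed
  then have "negligible U"
    unfolding negligible_iff_null_sets using assms by (subst AE_iff_null_sets) auto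
  then show False using assms open_not_negligible by blast
qed

lemma linf_norm_le:
  fixes f :: "real^'n \<Rightarrow> real"
  assumes "f \<in> borel_measurable lebesgue" "\<And>x. \<bar>f x\<bar> \<le> C"
  shows "linf_norm UNIV f \<le> ereal C"
proof -
  note [measurable] = assms(1)
  have "esssup lebesgue (\<lambda>x. ereal \<bar>f x\<bar>) \<le> ereal C"
    by (rule esssup_I) (use assms(2) in auto)
  then show ?thesis by (simp add: linf_norm_def lebesgue_on_UNIV_eq)
qed

text \<open>Both parts of the norm are nonnegative, because a nonempty open set is not a null set and has more
  than one point; so each part is bounded by the whole norm.\<close>

lemma holder_normD:
  fixes f :: "real^'n \<Rightarrow> real"
  assumes U: "open U" "U \<noteq> {}" and b: "holder_norm s U f \<le> ereal C"
  shows "AE x in lebesgue. x \<in> U \<longrightarrow> \<bar>f x\<bar> \<le> C"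
    and "\<And>x y. x \<in> U \<Longrightarrow> y \<in> U \<Longrightarrow> \<bar>f x - f y\<bar> \<le> C * norm (x - y) powr s"
proof -
  define S where "S = (SUP (x, y) \<in> {(x, y). x \<in> U \<and> y \<in> U \<and> x \<noteq> y}. ereal (\<bar>f x - f y\<bar> / norm (x - y) powr s))"
  have le: "ereal (\<bar>f x - f y\<bar> / norm (x - y) powr s) \<le> S" if "x \<in> U" "y \<in> U" "x \<noteq> y" for x y
    unfolding S_def by (rule SUP_upper2[of "(x, y)"]) (use that in auto)
  obtain x where x: "x \<in> U" using U by blast
  obtain p q where pq: "x \<in> box p q" "cbox p q \<subseteq> U" by (rule cbox_inside_open[OF U(1) x])
  have "q \<in> U" "p \<in> U" "p \<noteq> q" using pq by (auto simp: subset_iff mem_box_cart less_imp_le intro: less_imp_le[OF less_trans])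
  then have "ereal 0 \<le> S" by (intro order_trans[OF _ le[of p q]]) auto
  then have S0: "S \<ge> 0" by (simp add: zero_ereal_def)
  have l0: "linf_norm U f \<ge> 0" by (rule linf_norm_nonneg[OF U])
  have sum: "linf_norm U f + S \<le> ereal C" using b by (simp add: holder_norm_def S_def)
  have 1: "linf_norm U f \<le> ereal C" using add_left_mono[OF S0, of "linf_norm U f"] sum by (metis add.right_neutral order_trans)
  have 2: "S \<le> ereal C" using add_right_mono[OF l0, of S] sum by (metis add.left_neutral order_trans)
  show "AE x in lebesgue. x \<in> U \<longrightarrow> \<bar>f x\<bar> \<le> C"
    using linf_norm_AE[OF U(1), of f] by eventually_elim (use 1 order_trans in \<open>fastforce\<close>)
  fix x y assume xy: "x \<in> U" "y \<in> U"
  show "\<bar>f x - f y\<bar> \<le> C * norm (x - y) powr s"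
  proof (cases "x = y")
    case False
    then have "\<bar>f x - f y\<bar> / norm (x - y) powr s \<le> C"
      using order_trans[OF le[OF xy False] 2] by simp
    then show ?thesis using False by (simp add: field_simps)
  qed simp
qed

lemma holder_continuous_on:
  fixes f :: "real^'n \<Rightarrow> real"
  assumes s: "s > 0" and h: "\<And>x y. x \<in> U \<Longrightarrow> y \<in> U \<Longrightarrow> \<bar>f x - f y\<bar> \<le> C * norm (x - y) powr s"
  shows "continuous_on U f"
  unfolding continuous_on_def
proof
  fix x assume x: "x \<in> U"
  have "((\<lambda>y. C * norm (y - x) powr s) \<longlongrightarrow> C * 0) (at x within U)"
  proof (intro tendsto_mult tendsto_const)
    have "((\<lambda>y. norm (y - x)) \<longlongrightarrow> norm (x - x)) (at x within U)" by (intro tendsto_intros)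
    then show "((\<lambda>y. norm (y - x) powr s) \<longlongrightarrow> 0) (at x within U)"
      using s by (intro tendsto_zero_powrI[where b=s]) auto
  qed
  then have "((\<lambda>y. C * norm (y - x) powr s) \<longlongrightarrow> 0) (at x within U)" by simp
  then have "((\<lambda>y. f y - f x) \<longlongrightarrow> 0) (at x within U)"
  proof (rule Lim_null_comparison[rotated])
    show "\<forall>\<^sub>F y in at x within U. norm (f y - f x) \<le> C * norm (y - x) powr s"
      using h x by (auto simp: eventually_at_filter intro!: always_eventually)
  qed
  then show "(f \<longlongrightarrow> f x) (at x within U)" by (simp add: LIM_zero_iff)
qed

section \<open>The nonlinearity\<close>

text \<open>Convergence in the norm is uniform convergence almost everywhere, and everywhere since the
  remainders are continuous. For \<open>z = 1\<close> consecutive remainders differ by \<open>a\<^sub>k(x) / k!\<close>, which is therefore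
  bounded uniformly in \<open>x\<close> and \<open>k\<close>.\<close>

lemma analytic_CsD:
  fixes a :: "real^'n \<Rightarrow> real \<Rightarrow> real"
  assumes s: "s > 0" and \<Omega>: "open \<Omega>" "\<Omega> \<noteq> {}" and a: "analytic_Cs s \<Omega> a"
  shows "\<And>k. k \<ge> 1 \<Longrightarrow> continuous_on \<Omega> (taylor_coeff a k)"
    and "\<And>x z. x \<in> \<Omega> \<Longrightarrow> (\<lambda>N. \<Sum>k=1..N. taylor_coeff a k x * z ^ k / fact k) \<longlonglongrightarrow> a x z"
    and "\<exists>C>0. \<forall>k\<ge>1. \<forall>x\<in>\<Omega>. \<bar>taylor_coeff a k x\<bar> \<le> C * fact k"
proof -
  have fin: "\<exists>C. holder_norm s \<Omega> (taylor_coeff a k) \<le> ereal C" if "k \<ge> 1" for k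
  proof -
    have "holder_norm s \<Omega> (taylor_coeff a k) < \<infinity>" using a that by (simp add: analytic_Cs_def holder_space_def)
    then show ?thesis by (cases "holder_norm s \<Omega> (taylor_coeff a k)") auto
  qed
  show cont: "continuous_on \<Omega> (taylor_coeff a k)" if "k \<ge> 1" for k
    using fin[OF that] holder_normD(2)[OF \<Omega>] holder_continuous_on[OF s] by metis
  define f where "f z N x = a x z - (\<Sum>k=1..N. taylor_coeff a k x * z ^ k / fact k)" for z N x
  have small: "\<exists>N0. \<forall>N\<ge>N0. \<forall>x\<in>\<Omega>. \<bar>f z N x\<bar> \<le> \<epsilon>" if "\<epsilon> > 0" for \<epsilon> z
  proof -
    have "(\<lambda>N. holder_norm s \<Omega> (f z N)) \<longlonglongrightarrow> 0" using a by (simp add: analytic_Cs_def f_def[abs_def])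
    then have "\<forall>\<^sub>F N in sequentially. holder_norm s \<Omega> (f z N) < ereal \<epsilon>"
      using that by (intro order_tendstoD(2)) auto
    then obtain N0 where N0: "\<And>N. N \<ge> N0 \<Longrightarrow> holder_norm s \<Omega> (f z N) \<le> ereal \<epsilon>"
      unfolding eventually_sequentially by (meson less_imp_le)
    have "\<bar>f z N x\<bar> \<le> \<epsilon>" if N: "N \<ge> N0" and x: "x \<in> \<Omega>" for N x
    proof -
      note hn = holder_normD[OF \<Omega> N0[OF N]]
      have "continuous_on \<Omega> (\<lambda>x. \<bar>f z N x\<bar>)"
        by (intro continuous_intros holder_continuous_on[OF s hn(2)])
      then show ?thesis using continuous_AE_le[OF \<Omega>(1) _ hn(1) x] by blast
    qed
    then show ?thesis by blast
  qed
  show lim: "(\<lambda>N. \<Sum>k=1..N. taylor_coeff a k x * z ^ k / fact k) \<longlonglongrightarrow> a x z" if x: "x \<in> \<Omega>" for x z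
  proof (rule LIMSEQ_I)
    fix \<epsilon> :: real assume "\<epsilon> > 0"
    then obtain N0 where "\<forall>N\<ge>N0. \<forall>x\<in>\<Omega>. \<bar>f z N x\<bar> \<le> \<epsilon> / 2" using small[of "\<epsilon>/2" z] by auto
    then have "norm ((\<Sum>k=1..N. taylor_coeff a k x * z ^ k / fact k) - a x z) < \<epsilon>" if "N \<ge> N0" for N
      using that x \<open>\<epsilon> > 0\<close> by (fastforce simp: f_def abs_minus_commute)
    then show "\<exists>N0. \<forall>N\<ge>N0. norm ((\<Sum>k=1..N. taylor_coeff a k x * z ^ k / fact k) - a x z) < \<epsilon>" by blast
  qed
  obtain N0 where N0: "\<And>N x. N \<ge> N0 \<Longrightarrow> x \<in> \<Omega> \<Longrightarrow> \<bar>f 1 N x\<bar> \<le> 1" using small[of 1 1] by auto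
  have large: "\<bar>taylor_coeff a k x\<bar> \<le> 2 * fact k" if k: "k > N0" and x: "x \<in> \<Omega>" for k x
  proof -
    obtain j where j: "k = Suc j" "j \<ge> N0" using k by (cases k) auto
    have "f 1 j x - f 1 k x = taylor_coeff a k x / fact k" using j by (simp add: f_def)
    then have "\<bar>taylor_coeff a k x / fact k\<bar> \<le> 2" using N0[of j x] N0[of k x] j x by linarith
    then show ?thesis by (simp add: field_simps)
  qed
  have "\<exists>C. \<forall>x\<in>\<Omega>. \<bar>taylor_coeff a k x\<bar> \<le> C" if "k \<ge> 1" for k
  proof -
    obtain C where C: "holder_norm s \<Omega> (taylor_coeff a k) \<le> ereal C" using fin[OF \<open>k \<ge> 1\<close>] by blast
    have "continuous_on \<Omega> (\<lambda>x. \<bar>taylor_coeff a k x\<bar>)" by (intro continuous_intros cont that)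
    from continuous_AE_le[OF \<Omega>(1) this holder_normD(1)[OF \<Omega> C]] show ?thesis by blast
  qed
  then obtain B where B: "\<And>k x. k \<ge> 1 \<Longrightarrow> x \<in> \<Omega> \<Longrightarrow> \<bar>taylor_coeff a k x\<bar> \<le> B k" by metis
  define C where "C = 2 + (\<Sum>k\<in>{1..N0}. \<bar>B k\<bar>)"
  have C2: "C \<ge> 2" by (simp add: C_def sum_nonneg)
  have "\<bar>taylor_coeff a k x\<bar> \<le> C * fact k" if k: "k \<ge> 1" and x: "x \<in> \<Omega>" for k x
  proof (cases "k > N0")
    case True
    then have "\<bar>taylor_coeff a k x\<bar> \<le> 2 * fact k" using large x by blast
    also have "\<dots> \<le> C * fact k" using C2 by (intro mult_right_mono) auto
    finally show ?thesis .
  next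
    case False
    have "\<bar>taylor_coeff a k x\<bar> \<le> \<bar>B k\<bar>" using B[OF k x] by linarith
    also have "\<dots> \<le> (\<Sum>k\<in>{1..N0}. \<bar>B k\<bar>)" using False k by (intro member_le_sum) auto
    also have "\<dots> \<le> C * 1" by (simp add: C_def)
    also have "\<dots> \<le> C * fact k" using C2 by (intro mult_left_mono) (auto simp: fact_ge_1)
    finally show ?thesis .
  qed
  then show "\<exists>C>0. \<forall>k\<ge>1. \<forall>x\<in>\<Omega>. \<bar>taylor_coeff a k x\<bar> \<le> C * fact k"
    using C2 by (intro exI[of _ C]) auto
qed

lemma geometric_tail_le:
  fixes y :: real
  assumes "0 \<le> y" "y \<le> 1/2"
  shows "(\<Sum>k=Suc m..N. y ^ k) \<le> 2 * y ^ Suc m"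
proof (cases "m \<le> N")
  case True
  then have "(\<Sum>k=Suc m..N. y ^ k) + 2 * y ^ Suc N \<le> 2 * y ^ Suc m"
  proof (induction N rule: dec_induct)
    case (step n)
    have "y ^ Suc n * (2 * y) \<le> y ^ Suc n * 1" using assms by (intro mult_left_mono) auto
    then have "2 * y ^ Suc (Suc n) \<le> y ^ Suc n" by (simp add: mult_ac)
    moreover have "(\<Sum>k=Suc m..Suc n. y ^ k) = (\<Sum>k=Suc m..n. y ^ k) + y ^ Suc n" using step.hyps by simp
    ultimately show ?case using step.IH by linarith
  qed simp
  moreover have "0 \<le> y ^ Suc N" using assms by simp
  ultimately show ?thesis by linarith
qed (use assms in simp)

lemma taylor_remainder:
  fixes d :: "nat \<Rightarrow> real"
  assumes lim: "(\<lambda>N. \<Sum>k=1..N. d k * z ^ k / fact k) \<longlonglongrightarrow> b"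
    and bnd: "\<And>k. k \<ge> 1 \<Longrightarrow> \<bar>d k\<bar> \<le> D * fact k"
    and m: "m \<ge> 1" and low: "\<And>k. 1 \<le> k \<Longrightarrow> k < m \<Longrightarrow> d k = 0" and z: "\<bar>z\<bar> \<le> 1/2"
  shows "\<bar>b - d m * z ^ m / fact m\<bar> \<le> 2 * D * \<bar>z\<bar> ^ Suc m"
proof -
  have D: "D \<ge> 0" using bnd[of 1] by simp
  have "\<bar>(\<Sum>k=1..N. d k * z ^ k / fact k) - d m * z ^ m / fact m\<bar> \<le> 2 * D * \<bar>z\<bar> ^ Suc m" if "N \<ge> m" for N
  proof -
    have "(\<Sum>k=1..N. d k * z ^ k / fact k) = (\<Sum>k=m..N. d k * z ^ k / fact k)"
      using m low by (intro sum.mono_neutral_right) auto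
    also have "\<dots> = d m * z ^ m / fact m + (\<Sum>k=Suc m..N. d k * z ^ k / fact k)"
      using that by (rule sum.atLeast_Suc_atMost)
    finally have "\<bar>(\<Sum>k=1..N. d k * z ^ k / fact k) - d m * z ^ m / fact m\<bar> = \<bar>\<Sum>k=Suc m..N. d k * z ^ k / fact k\<bar>" by simp
    also have "\<dots> \<le> (\<Sum>k=Suc m..N. D * \<bar>z\<bar> ^ k)"
    proof (rule order_trans[OF sum_abs sum_mono])
      fix k assume k: "k \<in> {Suc m..N}"
      have "\<bar>d k\<bar> * \<bar>z\<bar> ^ k \<le> (D * fact k) * \<bar>z\<bar> ^ k" using k by (intro mult_right_mono bnd) auto
      then show "\<bar>d k * z ^ k / fact k\<bar> \<le> D * \<bar>z\<bar> ^ k" by (simp add: abs_mult power_abs field_simps)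
    qed
    also have "\<dots> = D * (\<Sum>k=Suc m..N. \<bar>z\<bar> ^ k)" by (simp add: sum_distrib_left)
    also have "\<dots> \<le> D * (2 * \<bar>z\<bar> ^ Suc m)" using D z by (intro mult_left_mono geometric_tail_le) auto
    finally show ?thesis by simp
  qed
  then show ?thesis
    by (intro tendsto_upperbound[OF tendsto_rabs[OF tendsto_diff[OF lim tendsto_const]]])
       (auto simp: eventually_sequentially)
qed

text \<open>Let \<open>m\<close> be the least order at which the Taylor coefficients differ somewhere in \<open>\<Omega>\<close>. Near such a point
  the term of order \<open>m\<close> dominates the difference of the two functions, uniformly in \<open>x\<close>.\<close>

lemma distinct_nonlinearities_separate:
  fixes a b :: "real^'n \<Rightarrow> real \<Rightarrow> real"
  assumes s: "s > 0" and \<Omega>: "open \<Omega>" and a: "analytic_Cs s \<Omega> a" and b: "analytic_Cs s \<Omega> b"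
    and neq: "x1 \<in> \<Omega>" "a x1 z1 \<noteq> b x1 z1"
  obtains p q \<eta> where "cbox p q \<subseteq> \<Omega>" "box p q \<noteq> {}" "\<eta> > 0"
    "\<And>x z. x \<in> box p q \<Longrightarrow> 0 < \<bar>z\<bar> \<Longrightarrow> \<bar>z\<bar> < \<eta> \<Longrightarrow> a x z \<noteq> b x z"
proof -
  have ne: "\<Omega> \<noteq> {}" using neq by blast
  note A = analytic_CsD[OF s \<Omega> ne a] and B = analytic_CsD[OF s \<Omega> ne b]
  obtain C1 where C1: "C1 > 0" "\<And>k x. k \<ge> 1 \<Longrightarrow> x \<in> \<Omega> \<Longrightarrow> \<bar>taylor_coeff a k x\<bar> \<le> C1 * fact k" using A(3) by blast
  obtain C2 where C2: "C2 > 0" "\<And>k x. k \<ge> 1 \<Longrightarrow> x \<in> \<Omega> \<Longrightarrow> \<bar>taylor_coeff b k x\<bar> \<le> C2 * fact k" using B(3) by blast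
  define D where "D = C1 + C2"
  have D: "D > 0" using C1 C2 by (simp add: D_def)
  define d where "d x k = taylor_coeff a k x - taylor_coeff b k x" for x k
  have dD: "\<bar>d x k\<bar> \<le> D * fact k" if "k \<ge> 1" "x \<in> \<Omega>" for x k
    using C1(2)[OF that] C2(2)[OF that] unfolding d_def D_def distrib_right by linarith
  have lim: "(\<lambda>N. \<Sum>k=1..N. d x k * z ^ k / fact k) \<longlonglongrightarrow> a x z - b x z" if "x \<in> \<Omega>" for x z
    using tendsto_diff[OF A(2)[OF that] B(2)[OF that], of z z]
    by (simp add: d_def sum_subtractf[symmetric] left_diff_distrib diff_divide_distrib)
  have "\<exists>m. m \<ge> 1 \<and> (\<exists>x\<in>\<Omega>. d x m \<noteq> 0)"
  proof (rule ccontr)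
    assume "\<not> ?thesis"
    then have "(\<Sum>k=1..N. d x1 k * z1 ^ k / fact k) = 0" for N using neq(1) by (intro sum.neutral) auto
    then show False using lim[OF neq(1), of z1] neq(2) by (simp add: LIMSEQ_const_iff)
  qed
  define m where "m = (LEAST m. m \<ge> 1 \<and> (\<exists>x\<in>\<Omega>. d x m \<noteq> 0))"
  have m: "m \<ge> 1" "\<exists>x\<in>\<Omega>. d x m \<noteq> 0"
    using LeastI_ex[OF \<open>\<exists>m. m \<ge> 1 \<and> (\<exists>x\<in>\<Omega>. d x m \<noteq> 0)\<close>] by (auto simp: m_def)
  have low: "d x k = 0" if "1 \<le> k" "k < m" "x \<in> \<Omega>" for x k
    using not_less_Least[of k "\<lambda>m. m \<ge> 1 \<and> (\<exists>x\<in>\<Omega>. d x m \<noteq> 0)"] that by (auto simp: m_def)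
  obtain x0 where x0: "x0 \<in> \<Omega>" "d x0 m \<noteq> 0" using m by blast
  define \<kappa> where "\<kappa> = \<bar>d x0 m\<bar> / 2"
  have \<kappa>: "\<kappa> > 0" using x0 by (simp add: \<kappa>_def)
  define U where "U = \<Omega> \<inter> (\<lambda>x. \<bar>d x m\<bar>) -` {\<kappa><..}"
  have "continuous_on \<Omega> (\<lambda>x. \<bar>d x m\<bar>)"
    unfolding d_def by (intro continuous_intros A(1) B(1) m)
  then have "open U" unfolding U_def by (intro continuous_open_preimage \<Omega>) auto
  moreover have "x0 \<in> U" using x0 by (simp add: U_def \<kappa>_def)
  ultimately obtain p q where pq: "x0 \<in> box p q" "cbox p q \<subseteq> U" by (rule cbox_inside_open)
  define \<eta> where "\<eta> = min (1/2) (\<kappa> / (fact m * (2 * D)))"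
  have \<eta>: "\<eta> > 0" using \<kappa> D by (simp add: \<eta>_def)
  show ?thesis
  proof (rule that[OF _ _ \<eta>])
    show "cbox p q \<subseteq> \<Omega>" "box p q \<noteq> {}" using pq by (auto simp: U_def)
    fix x z assume x: "x \<in> box p q" and z: "0 < \<bar>z\<bar>" "\<bar>z\<bar> < \<eta>"
    have "x \<in> U" using x pq box_subset_cbox by blast
    then have xU: "x \<in> \<Omega>" "\<bar>d x m\<bar> > \<kappa>" by (auto simp: U_def)
    have "\<bar>(a x z - b x z) - d x m * z ^ m / fact m\<bar> \<le> 2 * D * \<bar>z\<bar> ^ Suc m"
      using z by (intro taylor_remainder[OF lim[OF xU(1)]] dD low m(1) xU(1)) (auto simp: \<eta>_def)
    also have "\<dots> = (2 * D * \<bar>z\<bar>) * \<bar>z\<bar> ^ m" by simp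
    also have "\<dots> < (\<kappa> / fact m) * \<bar>z\<bar> ^ m"
    proof (rule mult_strict_right_mono)
      have "\<bar>z\<bar> < \<kappa> / (fact m * (2 * D))" using z by (simp add: \<eta>_def)
      then show "2 * D * \<bar>z\<bar> < \<kappa> / fact m" using D by (simp add: field_simps)
    qed (use z in simp)
    also have "\<dots> \<le> (\<bar>d x m\<bar> / fact m) * \<bar>z\<bar> ^ m"
      using xU by (intro mult_right_mono divide_right_mono) auto
    also have "\<dots> = \<bar>d x m * z ^ m / fact m\<bar>" by (simp add: abs_mult power_abs)
    finally show "a x z \<noteq> b x z" by auto
  qed
qed

text \<open>For small \<open>z \<noteq> 0\<close> the quotient \<open>a(x,z) / z\<close> differs from the slope at zero by at most half of the lower
  bound for the slope. So it can serve as the potential of a linear problem.\<close>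

lemma slope_bounds:
  fixes a :: "real^'n \<Rightarrow> real \<Rightarrow> real"
  assumes s: "s > 0" and \<Omega>: "open \<Omega>" "\<Omega> \<noteq> {}" and a: "analytic_Cs s \<Omega> a" and pos: "positive_slope_at_zero \<Omega> a"
  obtains c C \<delta> where "0 < c" "0 < \<delta>" "\<And>x. x \<in> \<Omega> \<Longrightarrow> a x 0 = 0"
    "\<And>x. x \<in> \<Omega> \<Longrightarrow> c \<le> taylor_coeff a 1 x \<and> taylor_coeff a 1 x \<le> C"
    "\<And>x z. x \<in> \<Omega> \<Longrightarrow> z \<noteq> 0 \<Longrightarrow> \<bar>z\<bar> \<le> \<delta> \<Longrightarrow> c \<le> a x z / z \<and> a x z / z \<le> C"
proof -
  obtain c where c: "c > 0" "\<And>x. x \<in> \<Omega> \<Longrightarrow> a x 0 = 0" "\<And>x. x \<in> \<Omega> \<Longrightarrow> c \<le> taylor_coeff a 1 x"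
    using pos by (auto simp: positive_slope_at_zero_def taylor_coeff_def)
  note A = analytic_CsD[OF s \<Omega> a]
  obtain C where C: "C > 0" "\<And>k x. k \<ge> 1 \<Longrightarrow> x \<in> \<Omega> \<Longrightarrow> \<bar>taylor_coeff a k x\<bar> \<le> C * fact k" using A(3) by blast
  define \<delta> where "\<delta> = min (1/2) (c / (4 * C))"
  have \<delta>: "\<delta> > 0" using c C by (simp add: \<delta>_def)
  have t1: "taylor_coeff a 1 x \<le> C" if "x \<in> \<Omega>" for x using C(2)[of 1 x] that by simp
  have quot: "c / 2 \<le> a x z / z \<and> a x z / z \<le> C + c" if x: "x \<in> \<Omega>" and z: "z \<noteq> 0" "\<bar>z\<bar> \<le> \<delta>" for x z
  proof -
    have "\<bar>a x z - taylor_coeff a 1 x * z ^ 1 / fact 1\<bar> \<le> 2 * C * \<bar>z\<bar> ^ Suc 1"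
      using z by (intro taylor_remainder[OF A(2)[OF x]] C x) (auto simp: \<delta>_def)
    then have "\<bar>a x z - taylor_coeff a 1 x * z\<bar> / \<bar>z\<bar> \<le> 2 * C * \<bar>z\<bar>"
      using z by (simp add: field_simps power2_eq_square)
    moreover have "\<bar>a x z - taylor_coeff a 1 x * z\<bar> / \<bar>z\<bar> = \<bar>a x z / z - taylor_coeff a 1 x\<bar>"
      using z by (simp add: abs_divide[symmetric] diff_divide_distrib)
    moreover have "2 * C * \<bar>z\<bar> \<le> c / 2" using z C by (simp add: \<delta>_def field_simps)
    ultimately have "\<bar>a x z / z - taylor_coeff a 1 x\<bar> \<le> c / 2" by linarith
    then have "a x z / z \<le> taylor_coeff a 1 x + c / 2" "taylor_coeff a 1 x - c / 2 \<le> a x z / z" by linarith+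
    then show ?thesis using c(1) c(3)[OF x] t1[OF x] by (intro conjI) linarith+
  qed
  show ?thesis
  proof (rule that[of "c/2" \<delta> "C + c"])
    show "c / 2 \<le> taylor_coeff a 1 x \<and> taylor_coeff a 1 x \<le> C + c" if "x \<in> \<Omega>" for x
      using c(1) c(3)[OF that] t1[OF that] by auto
  qed (use c \<delta> quot in auto)
qed

lemma nonlinearity_measurable:
  fixes a :: "real^'n \<Rightarrow> real \<Rightarrow> real"
  assumes s: "s > 0" and \<Omega>: "open \<Omega>" "\<Omega> \<noteq> {}" and a: "analytic_Cs s \<Omega> a"
  shows "k \<ge> 1 \<Longrightarrow> (\<lambda>x. indicator \<Omega> x * taylor_coeff a k x) \<in> borel_measurable lebesgue"
    and "u \<in> borel_measurable lebesgue \<Longrightarrow> (\<lambda>x. indicator \<Omega> x * a x (u x)) \<in> borel_measurable lebesgue"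
proof -
  note A = analytic_CsD[OF s \<Omega> a]
  show tm: "(\<lambda>x. indicator \<Omega> x * taylor_coeff a k x) \<in> borel_measurable lebesgue" if "k \<ge> 1" for k
    using borel_measurable_continuous_on_indicator[OF _ A(1)[OF that]] \<Omega>
    by (intro measurable_lebesgueI) simp
  assume u: "u \<in> borel_measurable lebesgue"
  note [measurable] = u
  show "(\<lambda>x. indicator \<Omega> x * a x (u x)) \<in> borel_measurable lebesgue"
  proof (rule borel_measurable_LIMSEQ_real)
    show "(\<lambda>N. \<Sum>k=1..N. (indicator \<Omega> x * taylor_coeff a k x) * ((u x) ^ k / fact k)) \<longlonglongrightarrow> indicator \<Omega> x * a x (u x)" for x
      using A(2)[of x "u x"] by (cases "x \<in> \<Omega>") auto
    show "(\<lambda>x. \<Sum>k=1..N. (indicator \<Omega> x * taylor_coeff a k x) * ((u x) ^ k / fact k)) \<in> borel_measurable lebesgue" for N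
      by (intro borel_measurable_sum borel_measurable_times tm) (auto intro: measurable_compose[OF u])
  qed
qed

section \<open>Solutions of the nonlinear problem\<close>

context magnetic
begin

text \<open>By definition \<open>u\<close> differs by at most \<open>\<rho>\<close> from a solution of the linearised problem, whose values lie
  between 0 and \<open>M\<close>. So \<open>u\<close> is small, and \<open>q(x) = a(x,u(x)) / u(x)\<close> is bounded below by a positive constant.
  As \<open>u\<close> solves the linear problem with this potential, the bounds for linear solutions apply to \<open>u\<close>
  itself; in particular \<open>u\<close> is nonnegative, which the first estimate does not show.\<close>

lemma nl_solution_bounded:
  assumes ne: "\<Omega> \<noteq> {}" and a: "analytic_Cs s \<Omega> a" and pos: "positive_slope_at_zero \<Omega> a"
  obtains \<delta> where "\<delta> > 0"
    "\<And>W g M \<rho> u. g \<in> test_functions W \<Longrightarrow> (\<And>x. 0 \<le> g x \<and> g x \<le> M) \<Longrightarrow> M \<le> \<rho> \<Longrightarrow> \<rho> \<le> \<delta> \<Longrightarrow>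
       nl_solution s \<Omega> A a \<rho> g u \<Longrightarrow>
       (AE x in lebesgue. 0 \<le> u x \<and> u x \<le> M) \<and> integrable lebesgue (\<lambda>x. indicator \<Omega> x * a x (u x))"
proof -
  obtain c C \<delta>0 where c: "0 < c" and \<delta>0: "0 < \<delta>0" and a0: "\<And>x. x \<in> \<Omega> \<Longrightarrow> a x 0 = 0"
    and t1: "\<And>x. x \<in> \<Omega> \<Longrightarrow> c \<le> taylor_coeff a 1 x \<and> taylor_coeff a 1 x \<le> C"
    and quot: "\<And>x z. x \<in> \<Omega> \<Longrightarrow> z \<noteq> 0 \<Longrightarrow> \<bar>z\<bar> \<le> \<delta>0 \<Longrightarrow> c \<le> a x z / z \<and> a x z / z \<le> C"
    using slope_bounds[OF s(1) \<Omega>(1) ne a pos] by metis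
  have Om[measurable]: "\<Omega> \<in> sets lebesgue" using \<Omega>(1) by auto
  show ?thesis
  proof (rule that[of "\<delta>0 / 2"])
    show "\<delta>0 / 2 > 0" using \<delta>0 by simp
    fix W g M \<rho> u
    assume g: "g \<in> test_functions W" and M: "\<And>x. 0 \<le> g x \<and> g x \<le> M" and \<rho>: "M \<le> \<rho>" "\<rho> \<le> \<delta>0 / 2"
      and u: "nl_solution s \<Omega> A a \<rho> g u"
    interpret lin: magnetic_potential s r \<Omega> A "taylor_coeff a 1" c C
      by unfold_locales (use nonlinearity_measurable(1)[OF s(1) \<Omega>(1) ne a, of 1] c t1 in auto)
    have uH: "u \<in> Hs s" and ut: "(\<lambda>x. u x - g x) \<in> Hs_tilde s \<Omega>"
      and eq: "\<And>v. v \<in> Hs_tilde s \<Omega> \<Longrightarrow> mag_op s A u v + (LINT x:\<Omega>|lebesgue. a x (u x) * v x) = 0"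
      using u unfolding nl_solution_def by auto
    obtain w where w: "holder_norm s UNIV w \<le> ereal \<rho>"
      "AE x in lebesgue. u x - lin_solve s \<Omega> A (taylor_coeff a 1) g x = w x"
      using u unfolding nl_solution_def by blast
    have small: "AE x in lebesgue. \<bar>u x\<bar> \<le> \<delta>0"
      using w(2) holder_normD(1)[OF open_UNIV UNIV_not_empty w(1)] lin.lin_solve_bounded[OF g M]
      by eventually_elim (use \<rho> in auto)
    \<comment> \<open>the second case only fixes values within the required bounds, where the quotient is not controlled\<close>
    define q where "q x = (if u x \<noteq> 0 \<and> \<bar>u x\<bar> \<le> \<delta>0 then a x (u x) / u x else taylor_coeff a 1 x)" for x
    note um[measurable] = HsD(1)[OF uH]
    have am: "(\<lambda>x. indicator \<Omega> x * a x (u x)) \<in> borel_measurable lebesgue"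
      by (rule nonlinearity_measurable(2)[OF s(1) \<Omega>(1) ne a um])
    have qm: "(\<lambda>x. indicator \<Omega> x * q x) \<in> borel_measurable lebesgue"
    proof -
      note [measurable] = am nonlinearity_measurable(1)[OF s(1) \<Omega>(1) ne a order_refl]
      have "(\<lambda>x. if u x \<noteq> 0 \<and> \<bar>u x\<bar> \<le> \<delta>0 then (indicator \<Omega> x * a x (u x)) / u x else indicator \<Omega> x * taylor_coeff a 1 x) \<in> borel_measurable lebesgue"
        by measurable
      moreover have "(\<lambda>x. if u x \<noteq> 0 \<and> \<bar>u x\<bar> \<le> \<delta>0 then (indicator \<Omega> x * a x (u x)) / u x else indicator \<Omega> x * taylor_coeff a 1 x) = (\<lambda>x. indicator \<Omega> x * q x)"
        by (auto simp: q_def)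
      ultimately show ?thesis by simp
    qed
    have qb: "c \<le> q x \<and> q x \<le> C" if "x \<in> \<Omega>" for x
      using quot[OF that, of "u x"] t1[OF that] by (auto simp: q_def)
    interpret quo: magnetic_potential s r \<Omega> A q c C
      by unfold_locales (use qm c qb in auto)
    have au: "AE x in lebesgue. indicator \<Omega> x * a x (u x) = indicator \<Omega> x * (q x * u x)"
      using small by eventually_elim (auto simp: q_def a0 indicator_def)
    have "lin_solution s \<Omega> A q g u"
      unfolding lin_solution_def
    proof (intro conjI ballI uH ut)
      fix v assume v: "v \<in> Hs_tilde s \<Omega>"
      note [measurable] = HsD(1)[OF Hs_tilde_Hs[OF v]] qm am
      have "(LINT x:\<Omega>|lebesgue. q x * u x * v x) = (\<integral>x. (indicator \<Omega> x * q x) * (u x * v x) \<partial>lebesgue)"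
        by (simp add: set_lebesgue_integral_def mult.assoc)
      also have "\<dots> = (\<integral>x. (indicator \<Omega> x * a x (u x)) * v x \<partial>lebesgue)"
      proof (rule integral_cong_AE)
        have "(\<lambda>x. u x * v x) \<in> borel_measurable lebesgue" by measurable
        then show "(\<lambda>x. (indicator \<Omega> x * q x) * (u x * v x)) \<in> borel_measurable lebesgue"
          by (rule borel_measurable_times[OF qm])
        show "(\<lambda>x. (indicator \<Omega> x * a x (u x)) * v x) \<in> borel_measurable lebesgue"
          by (rule borel_measurable_times[OF am HsD(1)[OF Hs_tilde_Hs[OF v]]])
        show "AE x in lebesgue. (indicator \<Omega> x * q x) * (u x * v x) = (indicator \<Omega> x * a x (u x)) * v x"
          using au by eventually_elim auto
      qed
      also have "\<dots> = (LINT x:\<Omega>|lebesgue. a x (u x) * v x)"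
        by (simp add: set_lebesgue_integral_def mult.assoc)
      finally show "mag_op s A u v + (LINT x:\<Omega>|lebesgue. q x * u x * v x) = 0" using eq[OF v] by simp
    qed
    then have bnd: "AE x in lebesgue. 0 \<le> u x \<and> u x \<le> M" by (rule quo.lin_solution_bounded[OF g M])
    have "integrable lebesgue (\<lambda>x. indicator \<Omega> x * a x (u x))"
    proof (rule Bochner_Integration.integrable_bound[OF _ am])
      have "\<Omega> \<in> lmeasurable"
        using \<Omega>(2) Om by (intro bounded_set_imp_lmeasurable bounded_subset[OF bounded_ball])
      then show "integrable lebesgue (\<lambda>x. (\<bar>C\<bar> * M) * indicator \<Omega> x)"
        by (simp add: lmeasurable_iff_integrable)
      show "AE x in lebesgue. norm (indicator \<Omega> x * a x (u x)) \<le> norm ((\<bar>C\<bar> * M) * indicator \<Omega> x)"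
        using au bnd
      proof eventually_elim
        case (elim x)
        show ?case
        proof (cases "x \<in> \<Omega>")
          case True
          have "\<bar>q x\<bar> * \<bar>u x\<bar> \<le> \<bar>C\<bar> * M" using qb[OF True] c elim(2) by (intro mult_mono) auto
          then show ?thesis using elim True by (simp add: abs_mult)
        qed simp
      qed
    qed
    with bnd show "(AE x in lebesgue. 0 \<le> u x \<and> u x \<le> M) \<and> integrable lebesgue (\<lambda>x. indicator \<Omega> x * a x (u x))"
      by blast
  qed
qed

text \<open>The product of \<open>u\<close> and the bump \<open>\<phi>\<close> is zero, so only the mixed terms
  \<open>- cos \<theta> (u(y) \<phi>(x) + u(x) \<phi>(y))\<close> of the density remain. They have a sign, as \<open>cos \<theta> \<ge> 0\<close> if \<open>x\<close>
  or \<open>y\<close> lies in \<open>\<Omega>\<close>, and they do not vanish if \<open>x\<close> lies in the first box and \<open>y\<close> in the second one.\<close>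

lemma form_with_bump_nonzero:
  assumes u: "u \<in> Hs s" "AE x in lebesgue. 0 \<le> u x"
    and pq: "cbox p q \<subseteq> \<Omega>" "box p q \<noteq> {}" "AE x in lebesgue. x \<in> box p q \<longrightarrow> u x = 0"
    and pq': "box p' q' \<inter> ball 0 (3 * r) = {}" "box p' q' \<noteq> {}" "AE x in lebesgue. x \<in> box p' q' \<longrightarrow> u x > 0"
  shows "(\<integral>z. mag_density u (bump p q) z \<partial>lebesgue) \<noteq> 0"
proof
  assume 0: "(\<integral>z. mag_density u (bump p q) z \<partial>lebesgue) = 0"
  define \<phi> where "\<phi> = bump p q"
  have \<phi>H: "\<phi> \<in> Hs s" unfolding \<phi>_def by (rule test_functions_Hs[OF s bump_test_function[OF pq(1)]])
  have boxOm: "x \<in> \<Omega>" if "x \<in> box p q" for x using that pq(1) box_subset_cbox by blast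
  have \<phi>0: "\<phi> x \<ge> 0" "\<phi> x \<noteq> 0 \<longleftrightarrow> x \<in> box p q" for x
    using bump_nonneg[of p q x] bump_pos_iff[of p q x] by (auto simp: \<phi>_def)
  define f where "f z = cos (phase z) * (u (snd z) * \<phi> (fst z) + u (fst z) * \<phi> (snd z)) * kern z" for z
  have ae: "AE z in lebesgue. mag_density u \<phi> z = - f z \<and> 0 \<le> f z \<and> (z \<in> box p q \<times> box p' q' \<longrightarrow> f z > 0)"
    using null_preserving_AE[OF null_preserving_fst u(2)] null_preserving_AE[OF null_preserving_snd u(2)]
      null_preserving_AE[OF null_preserving_fst pq(3)] null_preserving_AE[OF null_preserving_snd pq(3)]
      null_preserving_AE[OF null_preserving_snd pq'(3)]
  proof eventually_elim
    case (elim z)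
    have z0: "u (fst z) * \<phi> (fst z) = 0" "u (snd z) * \<phi> (snd z) = 0" using elim \<phi>0(2) by auto
    have d: "mag_density u \<phi> z = - f z" by (simp add: mag_density_def f_def z0)
    have 1: "0 \<le> cos (phase z) * (u (snd z) * \<phi> (fst z) + u (fst z) * \<phi> (snd z))"
    proof (cases "fst z \<in> box p q \<or> snd z \<in> box p q")
      case True
      then have "cos (phase z) \<ge> 0" using boxOm by (intro cos_phase_nonneg) auto
      then show ?thesis using elim \<phi>0(1) by auto
    next
      case False
      then have "\<phi> (fst z) = 0" "\<phi> (snd z) = 0" using \<phi>0(2) by auto
      then show ?thesis by simp
    qed
    have "f z > 0" if z: "z \<in> box p q \<times> box p' q'"
    proof -
      have zz: "fst z \<in> box p q" "snd z \<in> box p' q'" using z by auto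
      have c: "cos (phase z) = 1" using zz boxOm pq'(1) by (intro cos_phase_far) auto
      have "norm (fst z) < r" using boxOm[OF zz(1)] \<Omega>(2) by auto
      moreover have "norm (snd z) \<ge> 3 * r" using zz(2) pq'(1) by (auto simp: disjoint_iff not_less)
      ultimately have "fst z \<noteq> snd z" using r by auto
      then have k: "kern z > 0" by (rule kern_pos)
      have "u (snd z) * \<phi> (fst z) > 0" using elim(5) zz \<phi>0[of "fst z"] by (simp add: less_le)
      moreover have "u (fst z) * \<phi> (snd z) \<ge> 0" using elim(1) \<phi>0(1) by simp
      ultimately show ?thesis using k by (simp add: f_def c add_pos_nonneg)
    qed
    then show ?case using d 1 kern_nonneg[of z] by (simp add: f_def)
  qed
  have "(\<integral>z. - mag_density u \<phi> z \<partial>lebesgue) = 0" using 0 by (simp add: \<phi>_def)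
  moreover have "AE z in lebesgue. 0 \<le> - mag_density u \<phi> z" using ae by eventually_elim simp
  ultimately have "AE z in lebesgue. - mag_density u \<phi> z = 0"
    using integral_nonneg_eq_0_iff_AE[of lebesgue "\<lambda>z. - mag_density u \<phi> z"] density_integrable[OF u(1) \<phi>H] by simp
  with ae have "AE z in lebesgue. z \<notin> box p q \<times> box p' q'" by eventually_elim auto
  moreover have o: "open (box p q \<times> box p' q')" by (intro open_Times open_box)
  ultimately have "negligible (box p q \<times> box p' q')"
    unfolding negligible_iff_null_sets by (subst AE_iff_null_sets) auto
  then show False using o pq(2) pq'(2) open_not_negligible by blast
qed

end

section \<open>Small exterior data\<close>

lemma iter_partial_scale:
  fixes f :: "real^'n \<Rightarrow> real"
  assumes "smooth_fun f"
  shows "iter_partial js (\<lambda>x. \<tau> * f x) = (\<lambda>x. \<tau> * iter_partial js f x)"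
proof (induction js)
  case (Cons j js)
  have "partial_deriv j (\<lambda>x. \<tau> * iter_partial js f x) x = \<tau> * partial_deriv j (iter_partial js f) x" for x
  proof -
    obtain D where D: "(iter_partial js f has_derivative D) (at x)"
      using smooth_fun_differentiable[OF smooth_fun_iter_partial[OF assms]] unfolding differentiable_def by blast
    show ?thesis
      using partial_deriv_eq[OF has_derivative_mult_right[OF D]] partial_deriv_eq[OF D] by simp
  qed
  then show ?case using Cons by auto
qed simp

lemma c2_norm_scale:
  fixes f :: "real^'n \<Rightarrow> real"
  assumes f: "f \<in> test_functions U"
  obtains N where "N \<ge> 0" "\<And>\<tau>. \<tau> \<ge> 0 \<Longrightarrow> c2_norm (\<lambda>x. \<tau> * f x) \<le> ereal (\<tau> * N)"
proof -
  have "\<exists>C. \<forall>x. \<bar>multi_partial \<alpha> f x\<bar> \<le> C" for \<alpha>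
    using test_functions_bounded[OF f] unfolding multi_partial_def by blast
  then have "\<forall>\<alpha>. \<exists>C. \<forall>x. \<bar>multi_partial \<alpha> f x\<bar> \<le> C" by blast
  from choice[OF this] obtain C where C: "\<And>\<alpha> x. \<bar>multi_partial \<alpha> f x\<bar> \<le> C \<alpha>" by blast
  have C0: "C \<alpha> \<ge> 0" for \<alpha> using C[of \<alpha> 0] by linarith
  show ?thesis
  proof (rule that[of "\<Sum>\<alpha>\<in>multi_indices 2. C \<alpha>"])
    show "(\<Sum>\<alpha>\<in>multi_indices 2. C \<alpha>) \<ge> 0" by (intro sum_nonneg C0)
    fix \<tau> :: real assume \<tau>: "\<tau> \<ge> 0"
    have "linf_norm UNIV (multi_partial \<alpha> (\<lambda>x. \<tau> * f x)) \<le> ereal (\<tau> * C \<alpha>)" for \<alpha>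
    proof (rule linf_norm_le)
      have e: "multi_partial \<alpha> (\<lambda>x. \<tau> * f x) = (\<lambda>x. \<tau> * multi_partial \<alpha> f x)"
        unfolding multi_partial_def by (rule iter_partial_scale[OF test_functions_smooth[OF f]])
      show "\<bar>multi_partial \<alpha> (\<lambda>x. \<tau> * f x) x\<bar> \<le> \<tau> * C \<alpha>" for x
        unfolding e using \<tau> C by (simp add: abs_mult mult_left_mono)
      have "smooth_fun (multi_partial \<alpha> f)"
        unfolding multi_partial_def by (rule smooth_fun_iter_partial[OF test_functions_smooth[OF f]])
      then have "continuous_on UNIV (\<lambda>x. \<tau> * multi_partial \<alpha> f x)" by (intro continuous_intros smooth_fun_continuous)
      then show "multi_partial \<alpha> (\<lambda>x. \<tau> * f x) \<in> borel_measurable lebesgue"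
        unfolding e by (intro measurable_lebesgueI borel_measurable_continuous_onI)
    qed
    then have "c2_norm (\<lambda>x. \<tau> * f x) \<le> (\<Sum>\<alpha>\<in>multi_indices 2. ereal (\<tau> * C \<alpha>))"
      unfolding c2_norm_def by (rule sum_mono)
    then show "c2_norm (\<lambda>x. \<tau> * f x) \<le> ereal (\<tau> * (\<Sum>\<alpha>\<in>multi_indices 2. C \<alpha>))"
      by (simp add: sum_distrib_left)
  qed
qed

lemma small_radius_antimono:
  assumes "small_radius s \<Omega> A W a \<rho>\<^sub>0" "0 < \<rho>" "\<rho> \<le> \<rho>\<^sub>0"
  shows "small_radius s \<Omega> A W a \<rho>"
  using assms unfolding small_radius_def by (meson order_trans)

text \<open>The complement of the essential support is a union of possibly uncountably many open sets on which
  \<open>A\<close> vanishes almost everywhere; by Lindelof's theorem countably many of them suffice.\<close>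

lemma magneticI:
  fixes A :: "real^'n \<Rightarrow> real^'n"
  assumes "0 < s" "s < 1" "r > 0" "open \<Omega>" and A: "A \<in> Linf_vec"
    and supp: "\<Omega> \<union> ess_support A \<subseteq> ball 0 r"
    and bound: "linf_norm_vec A \<le> ereal (pi / (8 * sqrt (real CARD('n)) * r))"
  shows "magnetic s r \<Omega> A"
proof
  show "A \<in> borel_measurable lebesgue" using A by (simp add: Linf_vec_def)
  define b where "b = pi / (8 * sqrt (real CARD('n)) * r)"
  have b: "b > 0" using assms by (simp add: b_def)
  have comp: "AE x in lebesgue. \<bar>A x $ j\<bar> \<le> b" for j
  proof -
    have "linf_norm UNIV (\<lambda>x. A x $ j) \<le> linf_norm_vec A" unfolding linf_norm_vec_def by (rule Max_ge) auto
    then have le: "linf_norm UNIV (\<lambda>x. A x $ j) \<le> ereal b" using bound b_def by (metis order_trans)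
    show ?thesis
      using linf_norm_AE[OF open_UNIV, of "\<lambda>x. A x $ j"]
    proof eventually_elim
      case (elim x)
      then have "ereal \<bar>A x $ j\<bar> \<le> ereal b" using le by (blast intro: order_trans)
      then show ?case by simp
    qed
  qed
  then have "AE x in lebesgue. \<forall>j. \<bar>A x $ j\<bar> \<le> b" by (simp add: AE_all_countable)
  then show "AE x in lebesgue. norm (A x) \<le> pi / (8 * r)"
  proof eventually_elim
    case (elim x)
    have "(norm (A x))\<^sup>2 = (\<Sum>j\<in>UNIV. (A x $ j)\<^sup>2)" 
      unfolding power2_norm_eq_inner inner_vec_def by (simp add: power2_eq_square)
    also have "\<dots> \<le> (\<Sum>j\<in>(UNIV::'n set). b\<^sup>2)"
    proof (rule sum_mono)
      fix j
      have "\<bar>A x $ j\<bar> \<le> \<bar>b\<bar>" using elim b by simp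
      then show "(A x $ j)\<^sup>2 \<le> b\<^sup>2" by (simp add: abs_le_square_iff)
    qed
    also have "\<dots> = (sqrt (real CARD('n)) * b)\<^sup>2" by (simp add: power_mult_distrib)
    finally have "(norm (A x))\<^sup>2 \<le> (sqrt (real CARD('n)) * b)\<^sup>2" .
    then have "norm (A x) \<le> sqrt (real CARD('n)) * b" by (rule power2_le_imp_le) (use b in simp)
    also have "\<dots> = pi / (8 * r)" by (simp add: b_def)
    finally show ?case .
  qed
  define \<F> where "\<F> = {U :: (real^'n) set. open U \<and> (AE x in lebesgue. x \<in> U \<longrightarrow> A x = 0)}"
  obtain \<F>' where \<F>': "\<F>' \<subseteq> \<F>" "countable \<F>'" "\<Union>\<F>' = \<Union>\<F>"
    using Lindelof[of \<F>] by (auto simp: \<F>_def)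
  have "AE x in lebesgue. \<forall>U\<in>\<F>'. x \<in> U \<longrightarrow> A x = 0"
    using \<F>' by (subst AE_ball_countable) (auto simp: \<F>_def)
  then show "AE x in lebesgue. x \<notin> ball 0 r \<longrightarrow> A x = 0"
  proof eventually_elim
    case (elim x)
    have "x \<in> \<Union>\<F>'" if "x \<notin> ball 0 r"
    proof -
      have "x \<notin> ess_support A" using that supp by blast
      then show ?thesis unfolding \<F>' by (auto simp: ess_support_def \<F>_def)
    qed
    then show ?case using elim by blast
  qed
qed (use assms in auto)

section \<open>Uniqueness of the nonlinearity\<close>

theorem theorem1p1:
  fixes s r \<rho>\<^sub>0 :: real
    and \<Omega> W\<^sub>1 W\<^sub>2 :: "(real^'n) set"
    and A :: "real^'n \<Rightarrow> real^'n"
    and a\<^sub>1 a\<^sub>2 :: "real^'n \<Rightarrow> real \<Rightarrow> real"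
  assumes "CARD('n) \<ge> 2"
    and "0 < s" "s < 1"
    and "bounded_C11_domain \<Omega>"
    and "A \<in> Linf_vec"
    and "r > 0"
    and "\<Omega> \<union> ess_support A \<subseteq> ball 0 r"
    and "linf_norm_vec A \<le> ereal (pi / (8 * sqrt (real CARD('n)) * r))"
    and "analytic_Cs s \<Omega> a\<^sub>1" "analytic_Cs s \<Omega> a\<^sub>2"
    and "positive_slope_at_zero \<Omega> a\<^sub>1" "positive_slope_at_zero \<Omega> a\<^sub>2"
    and "open W\<^sub>1" "W\<^sub>1 \<noteq> {}" "W\<^sub>1 \<inter> ball 0 (3 * r) = {}"
    and "open W\<^sub>2" "W\<^sub>2 \<noteq> {}" "W\<^sub>2 \<inter> ball 0 (3 * r) = {}"
    and "\<rho>\<^sub>0 > 0"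
    and "small_radius s \<Omega> A W\<^sub>1 a\<^sub>1 \<rho>\<^sub>0" "small_radius s \<Omega> A W\<^sub>1 a\<^sub>2 \<rho>\<^sub>0"
    and "\<And>g. g \<in> test_functions W\<^sub>1 \<Longrightarrow> c2_norm g \<le> ereal \<rho>\<^sub>0 \<Longrightarrow>
           dist_restrict (DN_map s \<Omega> A W\<^sub>1 a\<^sub>1 g) W\<^sub>2 = dist_restrict (DN_map s \<Omega> A W\<^sub>1 a\<^sub>2 g) W\<^sub>2"
  shows "\<forall>x\<in>\<Omega>. \<forall>z. a\<^sub>1 x z = a\<^sub>2 x z"
proof (rule ccontr)
  note an = assms(9,10) and slope = assms(11,12)
    and W1 = assms(13-15) and W2 = assms(16-18) and sr = assms(20,21) and DN = assms(22)
  have Om: "open \<Omega>" "\<Omega> \<noteq> {}" "\<Omega> \<subseteq> ball 0 r" using assms(4,7) by (auto simp: bounded_C11_domain_def)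
  interpret magnetic s r \<Omega> A
    by (rule magneticI) (use assms Om in auto)
  assume "\<not> (\<forall>x\<in>\<Omega>. \<forall>z. a\<^sub>1 x z = a\<^sub>2 x z)"
  then obtain x1 z1 where neq: "x1 \<in> \<Omega>" "a\<^sub>1 x1 z1 \<noteq> a\<^sub>2 x1 z1" by blast
  obtain p q \<eta> where pq: "cbox p q \<subseteq> \<Omega>" "box p q \<noteq> {}" and \<eta>: "\<eta> > 0"
    and sep: "\<And>x z. x \<in> box p q \<Longrightarrow> 0 < \<bar>z\<bar> \<Longrightarrow> \<bar>z\<bar> < \<eta> \<Longrightarrow> a\<^sub>1 x z \<noteq> a\<^sub>2 x z"
    by (rule distinct_nonlinearities_separate[OF s(1) Om(1) an neq]) blast
  obtain \<delta>1 where \<delta>1: "\<delta>1 > 0" "\<And>W g M \<rho> u. g \<in> test_functions W \<Longrightarrow> (\<And>x. 0 \<le> g x \<and> g x \<le> M) \<Longrightarrow> M \<le> \<rho> \<Longrightarrow> \<rho> \<le> \<delta>1 \<Longrightarrow>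
       nl_solution s \<Omega> A a\<^sub>1 \<rho> g u \<Longrightarrow>
       (AE x in lebesgue. 0 \<le> u x \<and> u x \<le> M) \<and> integrable lebesgue (\<lambda>x. indicator \<Omega> x * a\<^sub>1 x (u x))"
    by (rule nl_solution_bounded[OF Om(2) an(1) slope(1)]) blast
  obtain \<delta>2 where \<delta>2: "\<delta>2 > 0" "\<And>W g M \<rho> u. g \<in> test_functions W \<Longrightarrow> (\<And>x. 0 \<le> g x \<and> g x \<le> M) \<Longrightarrow> M \<le> \<rho> \<Longrightarrow> \<rho> \<le> \<delta>2 \<Longrightarrow>
       nl_solution s \<Omega> A a\<^sub>2 \<rho> g u \<Longrightarrow>
       (AE x in lebesgue. 0 \<le> u x \<and> u x \<le> M) \<and> integrable lebesgue (\<lambda>x. indicator \<Omega> x * a\<^sub>2 x (u x))"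
    by (rule nl_solution_bounded[OF Om(2) an(2) slope(2)]) blast
  \<comment> \<open>small enough for well-posedness, for the bounds on the solutions, and for the separation of \<open>a\<^sub>1\<close> and \<open>a\<^sub>2\<close>\<close>
  define \<rho> where "\<rho> = min (min \<rho>\<^sub>0 (\<eta> / 2)) (min \<delta>1 \<delta>2)"
  have \<rho>: "\<rho> > 0" "\<rho> \<le> \<rho>\<^sub>0" "\<rho> < \<eta>" "\<rho> \<le> \<delta>1" "\<rho> \<le> \<delta>2"
    using assms(19) \<eta> \<delta>1(1) \<delta>2(1) by (auto simp: \<rho>_def)
  obtain y1 where y1: "y1 \<in> W\<^sub>1" using W1 by blast
  obtain p' q' where pq': "y1 \<in> box p' q'" "cbox p' q' \<subseteq> W\<^sub>1" by (rule cbox_inside_open[OF W1(1) y1])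
  have bt: "bump p' q' \<in> test_functions W\<^sub>1" by (rule bump_test_function[OF pq'(2)])
  obtain N where N: "N \<ge> 0" "\<And>\<tau>. \<tau> \<ge> 0 \<Longrightarrow> c2_norm (\<lambda>x. \<tau> * bump p' q' x) \<le> ereal (\<tau> * N)"
    using c2_norm_scale[OF bt] by metis
  obtain B where B: "\<And>x. \<bar>bump p' q' x\<bar> \<le> B" using test_functions_bounded[OF bt, of "[]"] by auto
  have B0: "B \<ge> 0" using B[of 0] by linarith
  define \<tau> where "\<tau> = \<rho> / (N + B + 1)"
  have \<tau>: "\<tau> > 0" using \<rho>(1) N(1) B0 by (simp add: \<tau>_def add_nonneg_pos)
  have "\<tau> * (N + B + 1) = \<rho>" using N(1) B0 by (simp add: \<tau>_def)
  then have \<tau>N: "\<tau> * N \<le> \<rho>" "\<tau> * B \<le> \<rho>"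
    using \<tau> N(1) B0 mult_left_mono[of N "N + B + 1" \<tau>] mult_left_mono[of B "N + B + 1" \<tau>] by auto
  define g where "g x = \<tau> * bump p' q' x" for x
  have gt: "g \<in> test_functions W\<^sub>1"
    using test_functions_lincomb[OF bt bt, of \<tau> 0] by (simp add: g_def[abs_def])
  have gM: "0 \<le> g x \<and> g x \<le> \<rho>" for x
  proof -
    have "\<tau> * bump p' q' x \<le> \<tau> * B" using \<tau> B[of x] by (intro mult_left_mono) auto
    then have "\<tau> * bump p' q' x \<le> \<rho>" using \<tau>N(2) by linarith
    then show ?thesis using \<tau> bump_nonneg[of p' q' x] by (simp add: g_def)
  qed
  have "c2_norm g \<le> ereal (\<tau> * N)" using N(2)[of \<tau>] \<tau> by (simp add: g_def[abs_def])
  also have "ereal (\<tau> * N) \<le> ereal \<rho>" using \<tau>N(1) by simp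
  finally have gc2: "c2_norm g \<le> ereal \<rho>" .
  also have "ereal \<rho> \<le> ereal \<rho>\<^sub>0" using \<rho>(2) by simp
  finally have gc2': "c2_norm g \<le> ereal \<rho>\<^sub>0" .
  have sr': "small_radius s \<Omega> A W\<^sub>1 a\<^sub>1 \<rho>" "small_radius s \<Omega> A W\<^sub>1 a\<^sub>2 \<rho>"
    by (rule small_radius_antimono[OF sr(1) \<rho>(1,2)], rule small_radius_antimono[OF sr(2) \<rho>(1,2)])
  obtain u1 where u1: "nl_solution s \<Omega> A a\<^sub>1 \<rho> g u1"
    using sr'(1) gt gc2 \<rho>(1) unfolding small_radius_def by blast
  obtain u2 where u2: "nl_solution s \<Omega> A a\<^sub>2 \<rho> g u2"
    using sr'(2) gt gc2 \<rho>(1) unfolding small_radius_def by blast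
  have nl: "nl_solve s \<Omega> A W\<^sub>1 a\<^sub>1 g = u1" "nl_solve s \<Omega> A W\<^sub>1 a\<^sub>2 g = u2"
    by (rule nl_solve_eqI[OF sr'(1) gt gc2 u1], rule nl_solve_eqI[OF sr'(2) gt gc2 u2])
  have u1': "u1 \<in> Hs s" "(\<lambda>x. u1 x - g x) \<in> Hs_tilde s \<Omega>"
    "\<And>v. v \<in> Hs_tilde s \<Omega> \<Longrightarrow> mag_op s A u1 v + (LINT x:\<Omega>|lebesgue. a\<^sub>1 x (u1 x) * v x) = 0"
    using u1 unfolding nl_solution_def by auto
  have u2': "u2 \<in> Hs s" "(\<lambda>x. u2 x - g x) \<in> Hs_tilde s \<Omega>"
    "\<And>v. v \<in> Hs_tilde s \<Omega> \<Longrightarrow> mag_op s A u2 v + (LINT x:\<Omega>|lebesgue. a\<^sub>2 x (u2 x) * v x) = 0"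
    using u2 unfolding nl_solution_def by auto
  have b1: "AE x in lebesgue. 0 \<le> u1 x \<and> u1 x \<le> \<rho>" "integrable lebesgue (\<lambda>x. indicator \<Omega> x * a\<^sub>1 x (u1 x))"
    using \<delta>1(2)[OF gt gM order_refl \<rho>(4) u1] by auto
  have b2: "integrable lebesgue (\<lambda>x. indicator \<Omega> x * a\<^sub>2 x (u2 x))"
    using \<delta>2(2)[OF gt gM order_refl \<rho>(5) u2] by auto
  have ext: "test_functions W\<^sub>2 \<subseteq> test_functions (exterior \<Omega>)"
  proof -
    have "closure \<Omega> \<subseteq> cball 0 r" using Om(3) by (intro closure_minimal) auto
    then have "W\<^sub>2 \<subseteq> exterior \<Omega>" using W2(3) r by (fastforce simp: exterior_def disjoint_iff)
    then show ?thesis by (auto simp: test_functions_def)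
  qed
  have same: "mag_op s A u1 \<phi> = mag_op s A u2 \<phi>" if "\<phi> \<in> test_functions W\<^sub>2" for \<phi>
    using fun_cong[OF DN[OF gt gc2'], of \<phi>] that ext by (simp add: DN_map_def dist_restrict_def nl subset_iff)
  define w where "w x = u1 x - u2 x" for x
  have wt: "w \<in> Hs_tilde s \<Omega>"
    using Hs_tilde_lincomb[OF s u1'(2) u2'(2), of 1 "-1"] by (simp add: w_def[abs_def])
  have "AE x in lebesgue. w x = 0"
  proof (rule unique_continuation[OF Hs_tilde_Hs[OF wt] Hs_tilde_AE_zero[OF s wt Om(1)] W2])
    fix \<phi> assume \<phi>: "\<phi> \<in> test_functions W\<^sub>2"
    have \<phi>H: "\<phi> \<in> Hs s" by (rule test_functions_Hs[OF s \<phi>])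
    have "mag_density w \<phi> z = mag_density u1 \<phi> z - mag_density u2 \<phi> z" for z
      by (simp add: mag_density_def w_def algebra_simps)
    then have "(\<integral>z. mag_density w \<phi> z \<partial>lebesgue) = mag_op s A u1 \<phi> - mag_op s A u2 \<phi>"
      using density_integrable[OF u1'(1) \<phi>H] density_integrable[OF u2'(1) \<phi>H]
      by (simp add: mag_op_eq u1'(1) u2'(1) \<phi>H)
    then show "(\<integral>z. mag_density w \<phi> z \<partial>lebesgue) = 0" using same[OF \<phi>] by simp
  qed
  then have eq: "AE x in lebesgue. u1 x = u2 x" by eventually_elim (simp add: w_def)
  define h where "h x = indicator \<Omega> x * a\<^sub>1 x (u1 x) - indicator \<Omega> x * a\<^sub>2 x (u2 x)" for x
  have h_int: "integrable lebesgue h" unfolding h_def by (intro Bochner_Integration.integrable_diff b1 b2)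
  have "AE x in lebesgue. x \<in> box p q \<longrightarrow> h x = 0"
  proof (rule AE_zero_of_plateau_integrals[OF h_int])
    fix a b :: "real^'n" and m :: nat assume ab: "cbox a b \<subseteq> cbox p q"
    have \<phi>: "plateau m a b \<in> test_functions \<Omega>" by (rule plateau_test_function) (use ab pq in blast)
    note \<phi>t = test_functions_Hs_tilde[OF s \<phi>]
    have i: "integrable lebesgue (\<lambda>x. f x * plateau m a b x)" if "integrable lebesgue f" for f :: "real^'n \<Rightarrow> real"
      by (rule integrable_mult_bounded_on[OF that measurable_lebesgueI[OF plateau_measurable] _ plateau_abs_le, of UNIV]) simp
    have "mag_op s A u1 (plateau m a b) = mag_op s A u2 (plateau m a b)"
      by (rule mag_op_cong_AE[OF u1'(1) u2'(1) test_functions_Hs[OF s \<phi>] eq])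
    then have "(LINT x:\<Omega>|lebesgue. a\<^sub>1 x (u1 x) * plateau m a b x) = (LINT x:\<Omega>|lebesgue. a\<^sub>2 x (u2 x) * plateau m a b x)"
      using u1'(3)[OF \<phi>t] u2'(3)[OF \<phi>t] by simp
    then have "(\<integral>x. (indicator \<Omega> x * a\<^sub>1 x (u1 x)) * plateau m a b x \<partial>lebesgue) = (\<integral>x. (indicator \<Omega> x * a\<^sub>2 x (u2 x)) * plateau m a b x \<partial>lebesgue)"
      by (simp add: set_lebesgue_integral_def mult.assoc)
    then show "(\<integral>x. h x * plateau m a b x \<partial>lebesgue) = 0"
      using i[OF b1(2)] i[OF b2] by (simp add: h_def left_diff_distrib)
  qed
  then have zero: "AE x in lebesgue. x \<in> box p q \<longrightarrow> u1 x = 0"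
    using b1(1) eq
  proof eventually_elim
    case (elim x)
    show ?case
    proof
      assume x: "x \<in> box p q"
      then have "x \<in> \<Omega>" using pq(1) box_subset_cbox by blast
      then have "a\<^sub>1 x (u1 x) = a\<^sub>2 x (u1 x)" using elim x by (simp add: h_def)
      then show "u1 x = 0" using sep[OF x, of "u1 x"] elim(2) \<rho>(3) by force
    qed
  qed
  have gpos: "AE x in lebesgue. x \<in> box p' q' \<longrightarrow> u1 x > 0"
    using Hs_tilde_AE_zero[OF s u1'(2) Om(1)]
  proof eventually_elim
    case (elim x)
    show ?case
    proof
      assume x: "x \<in> box p' q'"
      then have "x \<in> W\<^sub>1" using pq'(2) box_subset_cbox by blast
      then have "norm x \<ge> 3 * r" using W1(3) by (auto simp: disjoint_iff not_less)
      moreover have "norm x < r" if "x \<in> \<Omega>" using Om(3) that by auto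
      ultimately have "x \<notin> \<Omega>" using r by fastforce
      then have "u1 x = g x" using elim by simp
      then show "u1 x > 0" using \<tau> bump_pos_iff[of p' q' x] x by (simp add: g_def)
    qed
  qed
  have \<phi>: "bump p q \<in> test_functions \<Omega>" by (rule bump_test_function[OF pq(1)])
  have a0: "a\<^sub>1 x 0 = 0" if "x \<in> \<Omega>" for x using slope(1) that by (auto simp: positive_slope_at_zero_def)
  have "(LINT x:\<Omega>|lebesgue. a\<^sub>1 x (u1 x) * bump p q x) = 0"
    unfolding set_lebesgue_integral_def
  proof (rule integral_eq_zero_AE)
    show "AE x in lebesgue. indicator \<Omega> x *\<^sub>R (a\<^sub>1 x (u1 x) * bump p q x) = 0"
      using zero
    proof eventually_elim
      case (elim x)
      have "bump p q x = 0" if "x \<notin> box p q"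
        using that bump_pos_iff[of p q x] bump_nonneg[of p q x] by linarith
      then show ?case using elim a0[of x] by (cases "x \<in> box p q") (auto simp: indicator_def)
    qed
  qed
  then have "mag_op s A u1 (bump p q) = 0"
    using u1'(3)[OF test_functions_Hs_tilde[OF s \<phi>]] by simp
  then have "(\<integral>z. mag_density u1 (bump p q) z \<partial>lebesgue) = 0"
    by (simp add: mag_op_eq[OF u1'(1) test_functions_Hs[OF s \<phi>]])
  moreover have "(\<integral>z. mag_density u1 (bump p q) z \<partial>lebesgue) \<noteq> 0"
  proof (rule form_with_bump_nonzero[OF u1'(1) _ pq zero _ _ gpos])
    show "AE x in lebesgue. 0 \<le> u1 x" using b1(1) by eventually_elim simp
    show "box p' q' \<inter> ball 0 (3 * r) = {}" using pq'(2) W1(3) box_subset_cbox by blast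
    show "box p' q' \<noteq> {}" using pq'(1) by blast
  qed
  ultimately show False by simp
qed

end
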